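(* Let $R$ be a commutative ring and $\mathcal{P}$ an operad over $R$. Then for any $R$-module $V$, the free $\mathcal{P}$-algebra $\mathsf{S}(\mathcal{P},V)$ is a differential object in $(\mathsf{ALG}_{\mathcal{P}}^{op},\mathbb{T}^\circ)$, where in particular the zero $\zeta^\circ:\mathsf{S}(\mathcal{P},V)\to\mathcal{P}(0)$ is defined by $$\zeta^\circ(\mu;v_1,\dots,v_n)=0,$$ and the differential lift $\ell^\circ:\mathsf{T}^\circ(\mathsf{S}(\mathcal{P},V))\to\mathsf{S}(\mathcal{P},V)$ is defined on generators by $$\ell^\circ(\mu;v_1,\dots,v_n)=0,\qquad \ell^\circ\big(\mathsf{d}(\mu;v_1,\dots,v_n)\big)=(\mu;v_1,\dots,v_n).$$ Furthermore, $\mathsf{T}^\circ(\mathsf{S}(\mathcal{P},V))\cong\mathsf{S}(\mathcal{P},V\times V)$ as $\mathcal{P}$-algebras.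
   Context: $R$ is a commutative ring. An operad $\mathcal{P}$ is a symmetric operad in $R$-modules ($R$-modules $\mathcal{P}(n)$, $n\ge0$, right $\Sigma(n)$-actions, unit $1_{\mathcal{P}}\in\mathcal{P}(1)$, compositions, usual axioms). $\mathsf{ALG}_{\mathcal{P}}$ is the category of $\mathcal{P}$-algebras, operations written $\mu(a_1,\dots,a_n)$; $\mathsf{S}(\mathcal{P},V)=\bigoplus_{n\ge0}(\mathcal{P}(n)\otimes V^{\otimes n})_{\Sigma(n)}$ is the free $\mathcal{P}$-algebra on $V$, with $(\mu;v_1,\dots,v_n)$ the class of $\mu\otimes v_1\otimes\cdots\otimes v_n$. $\mathcal{P}(0)$ with operations given by composition is the initial $\mathcal{P}$-algebra; $t^\circ_A:\mathcal{P}(0)\to A$ is the unique morphism. $\mathsf{T}^\circ(A)$ is the quotient of $\mathsf{S}(\mathcal{P},A\times A)$ by the relations $\mu((a_1,0),\dots,(a_n,0))=(\mu(a_1,\dots,a_n),0)$ and $(0,\mu(a_1,\dots,a_n))=\sum_i\mu((a_1,0),\dots,(0,a_i),\dots,(a_n,0))$; one writes $a:=(a,0)$, $\mathsf{d}(a):=(0,a)$, and these elements, for $a\in A$, are the generators of $\mathsf{T}^\circ(A)$; $\mathsf{T}^\circ(f)(a)=f(a)$, $\mathsf{T}^\circ(f)(\mathsf{d}(a))=\mathsf{d}(f(a))$. ${\mathsf{T}^\circ}^2(A)$ is generated by $a,\mathsf{d}(a),\mathsf{d}'(a),\mathsf{d}'\mathsf{d}(a)$ ($\mathsf{d}'$ for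 the outer $\mathsf{T}^\circ$). The relevant parts of the Cartesian Rosický tangent structure $\mathbb{T}^\circ$ on $\mathsf{ALG}_{\mathcal{P}}^{op}$, written in $\mathsf{ALG}_{\mathcal{P}}$: $p^\circ_A:A\to\mathsf{T}^\circ(A)$, $a\mapsto a$; $z^\circ_A:\mathsf{T}^\circ(A)\to A$, $a\mapsto a$, $\mathsf{d}(a)\mapsto0$; $l^\circ_A:{\mathsf{T}^\circ}^2(A)\to\mathsf{T}^\circ(A)$, $a\mapsto a$, $\mathsf{d}(a),\mathsf{d}'(a)\mapsto0$, $\mathsf{d}'\mathsf{d}(a)\mapsto\mathsf{d}(a)$. In a Cartesian Rosický tangent category, differential objects are equivalently given by an object with a zero map and a differential lift; this description is used here. A differential object in $(\mathsf{ALG}_{\mathcal{P}}^{op},\mathbb{T}^\circ)$ is a triple $(A,\zeta^\circ,\ell^\circ)$ of a $\mathcal{P}$-algebra $A$ and $\mathcal{P}$-algebra morphisms $\zeta^\circ:A\to\mathcal{P}(0)$, $\ell^\circ:\mathsf{T}^\circ(A)\to A$ such that $\ell^\circ\circ p^\circ_A=t^\circ_A\circ\zeta^\circ$, $\zeta^\circ\circ\ell^\circ=\zeta^\circ\circ z^\circ_A$, $\ell^\circ\circ\mathsf{T}^\circ(\ell^\circ)=\ell^\circ\circ l^\circ_A$, and the square formed by $p^\circ_A:A\to\mathsf{T}^\circ(A)$, $\zeta^\circ:A\to\mathcal{P}(0)$, $\ell^\circ:\mathsf{T}^\circ(A)\to A$, $t^\circ_A:\mathcal{P}(0)\to A$ is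 a pushout in $\mathsf{ALG}_{\mathcal{P}}$ (automatically preserved by powers of $\mathsf{T}^\circ$, a left adjoint).
   Formalization: The formulas hold as displayed only for n=1; the values forced on morphisms are used otherwise: for n=0, ζ°(μ;)=μ, ℓ°(μ;)=(μ;) and ℓ°(d(μ;))=0; for n≥2, ℓ°(d(μ;v1,…,vn))=0 instead of (μ;v1,…,vn). *)

theory Defs
  imports "HOL-Combinatorics.Permutations" "HOL-Algebra.Module" "HOL-Algebra.AbelCoset"
begin

section \<open>Symmetric operads in modules\<close>

text \<open>
  \<open>op_mod P n\<close> is the module of operations of arity \<open>n\<close>, \<open>op_sym P n \<mu> \<sigma>\<close> is \<open>\<mu> \<cdot> \<sigma>\<close> for a
  permutation \<open>\<sigma>\<close> of \<open>{..<n}\<close>, and \<open>op_comp P [k1, \<dots>, kn] [\<nu>1, \<dots>, \<nu>n] \<mu>\<close> is the total composite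
  \<open>\<mu>(\<nu>1, \<dots>, \<nu>n)\<close> with \<open>\<nu>i\<close> of arity \<open>ki\<close>. The arities are arguments because the carriers of the
  modules \<open>op_mod P n\<close> need not be disjoint subsets of the type of operations.
\<close>

record ('r, 'p) operad =
  op_mod :: "nat \<Rightarrow> ('r, 'p) module"
  op_sym :: "nat \<Rightarrow> 'p \<Rightarrow> (nat \<Rightarrow> nat) \<Rightarrow> 'p"
  op_unit :: 'p
  op_comp :: "nat list \<Rightarrow> 'p list \<Rightarrow> 'p \<Rightarrow> 'p"

abbreviation ops :: "('r, 'p, 'm) operad_scheme \<Rightarrow> nat \<Rightarrow> 'p set" where
  "ops P n \<equiv> carrier (op_mod P n)"

text \<open>
  Block permutations are given by their one-line notation: cut \<open>[0..<k1 + \<dots> + kn]\<close> into consecutive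
  blocks of lengths \<open>k1, \<dots>, kn\<close>, rearrange, and concatenate again. With the convention
  \<open>permute_list \<sigma> [x0, x1, \<dots>] = [x(\<sigma> 0), x(\<sigma> 1), \<dots>]\<close> one has, for \<open>ks = map length xss\<close>,
  \<open>permute_list (block_perm \<sigma> ks) (concat xss) = concat (permute_list \<sigma> xss)\<close> and
  \<open>permute_list (sum_perm \<tau>s ks) (concat xss) = concat (map2 permute_list \<tau>s xss)\<close>.
\<close>

fun index_blocks :: "nat \<Rightarrow> nat list \<Rightarrow> nat list list" where
  "index_blocks m [] = []"
| "index_blocks m (k # ks) = [m..<m + k] # index_blocks (m + k) ks"

definition perm_of_list :: "nat list \<Rightarrow> nat \<Rightarrow> nat" where
  "perm_of_list js i = (if i < length js then js ! i else i)"

definition block_perm :: "(nat \<Rightarrow> nat) \<Rightarrow> nat list \<Rightarrow> nat \<Rightarrow> nat" where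
  "block_perm \<sigma> ks = perm_of_list (concat (permute_list \<sigma> (index_blocks 0 ks)))"

definition sum_perm :: "(nat \<Rightarrow> nat) list \<Rightarrow> nat list \<Rightarrow> nat \<Rightarrow> nat" where
  "sum_perm \<tau>s ks = perm_of_list (concat (map2 permute_list \<tau>s (index_blocks 0 ks)))"

locale operad = cring R for R (structure) +
  fixes P :: "('a, 'p, 'n) operad_scheme"
  assumes op_module: "module R (op_mod P n)"
    and unit_closed: "op_unit P \<in> ops P 1"
    and sym_closed: "\<lbrakk>\<sigma> permutes {..<n}; \<mu> \<in> ops P n\<rbrakk> \<Longrightarrow> op_sym P n \<mu> \<sigma> \<in> ops P n"
    and sym_add: "\<lbrakk>\<sigma> permutes {..<n}; \<mu> \<in> ops P n; \<mu>' \<in> ops P n\<rbrakk> \<Longrightarrow>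
      op_sym P n (\<mu> \<oplus>\<^bsub>op_mod P n\<^esub> \<mu>') \<sigma> = op_sym P n \<mu> \<sigma> \<oplus>\<^bsub>op_mod P n\<^esub> op_sym P n \<mu>' \<sigma>"
    and sym_smult: "\<lbrakk>\<sigma> permutes {..<n}; \<mu> \<in> ops P n; r \<in> carrier R\<rbrakk> \<Longrightarrow>
      op_sym P n (r \<odot>\<^bsub>op_mod P n\<^esub> \<mu>) \<sigma> = r \<odot>\<^bsub>op_mod P n\<^esub> op_sym P n \<mu> \<sigma>"
    and sym_id: "\<mu> \<in> ops P n \<Longrightarrow> op_sym P n \<mu> id = \<mu>"
    and sym_sym: "\<lbrakk>\<sigma> permutes {..<n}; \<tau> permutes {..<n}; \<mu> \<in> ops P n\<rbrakk> \<Longrightarrow>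
      op_sym P n (op_sym P n \<mu> \<sigma>) \<tau> = op_sym P n \<mu> (\<sigma> \<circ> \<tau>)"
    and comp_closed: "\<lbrakk>\<mu> \<in> ops P (length ks); list_all2 (\<lambda>k \<nu>. \<nu> \<in> ops P k) ks \<nu>s\<rbrakk> \<Longrightarrow>
      op_comp P ks \<nu>s \<mu> \<in> ops P (sum_list ks)"
    and comp_add: "\<lbrakk>\<mu> \<in> ops P (length ks); \<mu>' \<in> ops P (length ks);
        list_all2 (\<lambda>k \<nu>. \<nu> \<in> ops P k) ks \<nu>s\<rbrakk> \<Longrightarrow>
      op_comp P ks \<nu>s (\<mu> \<oplus>\<^bsub>op_mod P (length ks)\<^esub> \<mu>') =
      op_comp P ks \<nu>s \<mu> \<oplus>\<^bsub>op_mod P (sum_list ks)\<^esub> op_comp P ks \<nu>s \<mu>'"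
    and comp_smult: "\<lbrakk>\<mu> \<in> ops P (length ks); r \<in> carrier R;
        list_all2 (\<lambda>k \<nu>. \<nu> \<in> ops P k) ks \<nu>s\<rbrakk> \<Longrightarrow>
      op_comp P ks \<nu>s (r \<odot>\<^bsub>op_mod P (length ks)\<^esub> \<mu>) = r \<odot>\<^bsub>op_mod P (sum_list ks)\<^esub> op_comp P ks \<nu>s \<mu>"
    and comp_args_add: "\<lbrakk>\<mu> \<in> ops P (length ks); list_all2 (\<lambda>k \<nu>. \<nu> \<in> ops P k) ks \<nu>s;
        i < length ks; \<nu> \<in> ops P (ks ! i); \<nu>' \<in> ops P (ks ! i)\<rbrakk> \<Longrightarrow>
      op_comp P ks (\<nu>s[i := \<nu> \<oplus>\<^bsub>op_mod P (ks ! i)\<^esub> \<nu>']) \<mu> =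
      op_comp P ks (\<nu>s[i := \<nu>]) \<mu> \<oplus>\<^bsub>op_mod P (sum_list ks)\<^esub> op_comp P ks (\<nu>s[i := \<nu>']) \<mu>"
    and comp_args_smult: "\<lbrakk>\<mu> \<in> ops P (length ks); list_all2 (\<lambda>k \<nu>. \<nu> \<in> ops P k) ks \<nu>s;
        i < length ks; \<nu> \<in> ops P (ks ! i); r \<in> carrier R\<rbrakk> \<Longrightarrow>
      op_comp P ks (\<nu>s[i := r \<odot>\<^bsub>op_mod P (ks ! i)\<^esub> \<nu>]) \<mu> =
      r \<odot>\<^bsub>op_mod P (sum_list ks)\<^esub> op_comp P ks (\<nu>s[i := \<nu>]) \<mu>"
    and comp_unit_left: "\<mu> \<in> ops P n \<Longrightarrow> op_comp P [n] [\<mu>] (op_unit P) = \<mu>"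
    and comp_unit_right: "\<mu> \<in> ops P n \<Longrightarrow>
      op_comp P (replicate n 1) (replicate n (op_unit P)) \<mu> = \<mu>"
    and comp_assoc: "\<lbrakk>\<mu> \<in> ops P (length lss);
        list_all2 (\<lambda>ls \<nu>. \<nu> \<in> ops P (length ls)) lss \<nu>s;
        list_all2 (list_all2 (\<lambda>l \<xi>. \<xi> \<in> ops P l)) lss \<xi>ss\<rbrakk> \<Longrightarrow>
      op_comp P (concat lss) (concat \<xi>ss) (op_comp P (map length lss) \<nu>s \<mu>) =
      op_comp P (map sum_list lss)
        (map (\<lambda>(ls, \<xi>s, \<nu>). op_comp P ls \<xi>s \<nu>) (zip lss (zip \<xi>ss \<nu>s))) \<mu>"
    and comp_sym: "\<lbrakk>\<mu> \<in> ops P (length ks); list_all2 (\<lambda>k \<nu>. \<nu> \<in> ops P k) ks \<nu>s;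
        \<sigma> permutes {..<length ks}\<rbrakk> \<Longrightarrow>
      op_comp P (permute_list \<sigma> ks) (permute_list \<sigma> \<nu>s) (op_sym P (length ks) \<mu> \<sigma>) =
      op_sym P (sum_list ks) (op_comp P ks \<nu>s \<mu>) (block_perm \<sigma> ks)"
    and comp_args_sym: "\<lbrakk>\<mu> \<in> ops P (length ks); list_all2 (\<lambda>k \<nu>. \<nu> \<in> ops P k) ks \<nu>s;
        list_all2 (\<lambda>k \<tau>. \<tau> permutes {..<k}) ks \<tau>s\<rbrakk> \<Longrightarrow>
      op_comp P ks (map (\<lambda>(k, \<nu>, \<tau>). op_sym P k \<nu> \<tau>) (zip ks (zip \<nu>s \<tau>s))) \<mu> =
      op_sym P (sum_list ks) (op_comp P ks \<nu>s \<mu>) (sum_perm \<tau>s ks)"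

section \<open>Algebras over an operad\<close>

text \<open>
  In \<open>act A \<mu> [a1, \<dots>, an]\<close> the arity of \<open>\<mu>\<close> is the length of the list. As for every
  \<open>module\<close>, the inherited fields \<open>mult\<close> and \<open>one\<close> carry no meaning.
\<close>

record ('r, 'p, 'a) operad_alg = "('r, 'a) module" +
  act :: "'p \<Rightarrow> 'a list \<Rightarrow> 'a"

locale operad_algebra = operad R P + module R A
  for R (structure) and P :: "('r, 'p, 'n) operad_scheme"
    and A :: "('r, 'p, 'a, 'm) operad_alg_scheme" +
  assumes act_closed: "\<lbrakk>as \<in> lists (carrier A); \<mu> \<in> ops P (length as)\<rbrakk> \<Longrightarrow> act A \<mu> as \<in> carrier A"
    and act_add: "\<lbrakk>as \<in> lists (carrier A); \<mu> \<in> ops P (length as); \<mu>' \<in> ops P (length as)\<rbrakk> \<Longrightarrow>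
      act A (\<mu> \<oplus>\<^bsub>op_mod P (length as)\<^esub> \<mu>') as = act A \<mu> as \<oplus>\<^bsub>A\<^esub> act A \<mu>' as"
    and act_smult: "\<lbrakk>as \<in> lists (carrier A); \<mu> \<in> ops P (length as); r \<in> carrier R\<rbrakk> \<Longrightarrow>
      act A (r \<odot>\<^bsub>op_mod P (length as)\<^esub> \<mu>) as = r \<odot>\<^bsub>A\<^esub> act A \<mu> as"
    and act_args_add: "\<lbrakk>as \<in> lists (carrier A); \<mu> \<in> ops P (length as); i < length as;
        a \<in> carrier A; b \<in> carrier A\<rbrakk> \<Longrightarrow>
      act A \<mu> (as[i := a \<oplus>\<^bsub>A\<^esub> b]) = act A \<mu> (as[i := a]) \<oplus>\<^bsub>A\<^esub> act A \<mu> (as[i := b])"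
    and act_args_smult: "\<lbrakk>as \<in> lists (carrier A); \<mu> \<in> ops P (length as); i < length as;
        a \<in> carrier A; r \<in> carrier R\<rbrakk> \<Longrightarrow>
      act A \<mu> (as[i := r \<odot>\<^bsub>A\<^esub> a]) = r \<odot>\<^bsub>A\<^esub> act A \<mu> (as[i := a])"
    and act_unit: "a \<in> carrier A \<Longrightarrow> act A (op_unit P) [a] = a"
    and act_comp: "\<lbrakk>ass \<in> lists (lists (carrier A)); \<mu> \<in> ops P (length ass);
        list_all2 (\<lambda>as \<nu>. \<nu> \<in> ops P (length as)) ass \<nu>s\<rbrakk> \<Longrightarrow>
      act A (op_comp P (map length ass) \<nu>s \<mu>) (concat ass) = act A \<mu> (map2 (act A) \<nu>s ass)"
    and act_sym: "\<lbrakk>as \<in> lists (carrier A); \<mu> \<in> ops P (length as); \<sigma> permutes {..<length as}\<rbrakk> \<Longrightarrow>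
      act A (op_sym P (length as) \<mu> \<sigma>) (permute_list \<sigma> as) = act A \<mu> as"

definition alg_hom :: "('r, 'k) ring_scheme \<Rightarrow> ('r, 'p, 'n) operad_scheme \<Rightarrow>
    ('r, 'p, 'a, 'm) operad_alg_scheme \<Rightarrow> ('r, 'p, 'b, 'l) operad_alg_scheme \<Rightarrow> ('a \<Rightarrow> 'b) set" where
  "alg_hom R P A B = {f \<in> carrier A \<rightarrow>\<^sub>E carrier B.
     (\<forall>x\<in>carrier A. \<forall>y\<in>carrier A. f (x \<oplus>\<^bsub>A\<^esub> y) = f x \<oplus>\<^bsub>B\<^esub> f y) \<and>
     (\<forall>r\<in>carrier R. \<forall>x\<in>carrier A. f (r \<odot>\<^bsub>A\<^esub> x) = r \<odot>\<^bsub>B\<^esub> f x) \<and>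
     (\<forall>xs\<in>lists (carrier A). \<forall>\<mu>\<in>ops P (length xs). f (act A \<mu> xs) = act B \<mu> (map f xs))}"

definition alg_iso :: "('r, 'k) ring_scheme \<Rightarrow> ('r, 'p, 'n) operad_scheme \<Rightarrow>
    ('r, 'p, 'a, 'm) operad_alg_scheme \<Rightarrow> ('r, 'p, 'b, 'l) operad_alg_scheme \<Rightarrow> ('a \<Rightarrow> 'b) set" where
  "alg_iso R P A B = {f \<in> alg_hom R P A B. bij_betw f (carrier A) (carrier B)}"

definition initial_alg :: "('r, 'p, 'n) operad_scheme \<Rightarrow> ('r, 'p, 'p) operad_alg" where
  "initial_alg P = \<lparr>carrier = ops P 0, mult = mult (op_mod P 0), one = one (op_mod P 0),
     zero = zero (op_mod P 0), add = add (op_mod P 0), smult = smult (op_mod P 0),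
     act = (\<lambda>\<mu> \<nu>s. op_comp P (replicate (length \<nu>s) 0) \<nu>s \<mu>)\<rparr>"

text \<open>
  The unique morphism out of the initial algebra: in it, \<open>\<mu> = act (initial_alg P) \<mu> []\<close>.
\<close>

definition initial_map :: "('r, 'p, 'n) operad_scheme \<Rightarrow> ('r, 'p, 'a, 'm) operad_alg_scheme \<Rightarrow>
    'p \<Rightarrow> 'a" where
  "initial_map P A = (\<lambda>\<mu>\<in>ops P 0. act A \<mu> [])"

section \<open>Submodules, ideals and quotients given by relations\<close>

definition alg_ideal :: "('r, 'k) ring_scheme \<Rightarrow> ('r, 'p, 'n) operad_scheme \<Rightarrow>
    ('r, 'p, 'a, 'm) operad_alg_scheme \<Rightarrow> 'a set \<Rightarrow> bool" where
  "alg_ideal R P B I \<longleftrightarrow> submodule I R B \<and>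
     (\<forall>xs\<in>lists (carrier B). \<forall>\<mu>\<in>ops P (length xs). set xs \<inter> I \<noteq> {} \<longrightarrow> act B \<mu> xs \<in> I)"

text \<open>A pair \<open>(x, y)\<close> in \<open>E\<close> stands for the relation \<open>x = y\<close> to be imposed.\<close>

definition gen_submodule :: "('r, 'k) ring_scheme \<Rightarrow>
    ('r, 'a, 'm) module_scheme \<Rightarrow> ('a \<times> 'a) set \<Rightarrow> 'a set" where
  "gen_submodule R B E = \<Inter>{I. submodule I R B \<and> (\<forall>(x, y)\<in>E. x \<ominus>\<^bsub>B\<^esub> y \<in> I)}"

definition gen_ideal :: "('r, 'k) ring_scheme \<Rightarrow> ('r, 'p, 'n) operad_scheme \<Rightarrow>
    ('r, 'p, 'a, 'm) operad_alg_scheme \<Rightarrow> ('a \<times> 'a) set \<Rightarrow> 'a set" where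
  "gen_ideal R P B E = \<Inter>{I. alg_ideal R P B I \<and> (\<forall>(x, y)\<in>E. x \<ominus>\<^bsub>B\<^esub> y \<in> I)}"

definition quot_alg :: "('r, 'p, 'a, 'm) operad_alg_scheme \<Rightarrow> 'a set \<Rightarrow>
    ('r, 'p, 'a set) operad_alg" where
  "quot_alg B I = \<lparr>carrier = a_rcosets\<^bsub>B\<^esub> I, mult = undefined, one = undefined,
     zero = I, add = set_add B,
     smult = (\<lambda>r X. \<Union>x\<in>X. I +>\<^bsub>B\<^esub> (r \<odot>\<^bsub>B\<^esub> x)),
     act = (\<lambda>\<mu> Xs. \<Union>xs\<in>listset Xs. I +>\<^bsub>B\<^esub> act B \<mu> xs)\<rparr>"

section \<open>The free algebra on a module\<close>

text \<open>
  The module \<open>\<Oplus>n. (P(n) \<otimes> V\<^sup>\<otimes>\<^sup>n)\<^sub>\<Sigma>\<^sub>(\<^sub>n\<^sub>)\<close> is presented in one step, as the free module on the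
  symbols \<open>(\<mu>, [v1, \<dots>, vn])\<close> modulo multilinearity and the relations
  \<open>(\<mu> \<cdot> \<sigma>, [v(\<sigma> 1), \<dots>, v(\<sigma> n)]) = (\<mu>, [v1, \<dots>, vn])\<close> defining the coinvariants. The operations
  on symbols are \<open>\<mu>((\<nu>1, vs1), \<dots>, (\<nu>n, vsn)) = (\<mu>(\<nu>1, \<dots>, \<nu>n), vs1 @ \<dots> @ vsn)\<close>, extended
  multilinearly to formal linear combinations.
\<close>

type_synonym ('r, 'p, 'v) formal = "'p \<times> 'v list \<Rightarrow> 'r"
type_synonym ('r, 'p, 'v) free = "('r, 'p, 'v) formal set"

definition symbols :: "('r, 'p, 'n) operad_scheme \<Rightarrow> ('r, 'v, 'm) module_scheme \<Rightarrow>
    ('p \<times> 'v list) set" where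
  "symbols P V = {(\<mu>, vs). vs \<in> lists (carrier V) \<and> \<mu> \<in> ops P (length vs)}"

definition supp :: "('r, 'k) ring_scheme \<Rightarrow> ('s \<Rightarrow> 'r) \<Rightarrow> 's set" where
  "supp R f = {s. f s \<noteq> \<zero>\<^bsub>R\<^esub>}"

definition comp_symbols :: "('r, 'p, 'n) operad_scheme \<Rightarrow> 'p \<Rightarrow> ('p \<times> 'v list) list \<Rightarrow>
    'p \<times> 'v list" where
  "comp_symbols P \<mu> ss =
     (op_comp P (map (length \<circ> snd) ss) (map fst ss) \<mu>, concat (map snd ss))"

definition formal_alg :: "('r, 'k) ring_scheme \<Rightarrow> ('r, 'p, 'n) operad_scheme \<Rightarrow>
    ('r, 'v, 'm) module_scheme \<Rightarrow> ('r, 'p, ('r, 'p, 'v) formal) operad_alg" where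
  "formal_alg R P V =
    \<lparr>carrier = {f. range f \<subseteq> carrier R \<and> finite (supp R f) \<and> supp R f \<subseteq> symbols P V},
     mult = undefined, one = undefined,
     zero = (\<lambda>_. \<zero>\<^bsub>R\<^esub>), add = (\<lambda>f g s. f s \<oplus>\<^bsub>R\<^esub> g s), smult = (\<lambda>r f s. r \<otimes>\<^bsub>R\<^esub> f s),
     act = (\<lambda>\<mu> fs t. \<Oplus>\<^bsub>R\<^esub>ss\<in>{ss \<in> listset (map (supp R) fs). comp_symbols P \<mu> ss = t}.
       foldr (\<otimes>\<^bsub>R\<^esub>) (map2 (\<lambda>f s. f s) fs ss) \<one>\<^bsub>R\<^esub>)\<rparr>"

definition symb :: "('r, 'k) ring_scheme \<Rightarrow> 'p \<Rightarrow> 'v list \<Rightarrow> ('r, 'p, 'v) formal" where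
  "symb R \<mu> vs = (\<lambda>s. if s = (\<mu>, vs) then \<one>\<^bsub>R\<^esub> else \<zero>\<^bsub>R\<^esub>)"

inductive_set free_rels :: "('r, 'k) ring_scheme \<Rightarrow> ('r, 'p, 'n) operad_scheme \<Rightarrow>
    ('r, 'v, 'm) module_scheme \<Rightarrow> (('r, 'p, 'v) formal \<times> ('r, 'p, 'v) formal) set"
  for R P V where
  op_add: "\<lbrakk>vs \<in> lists (carrier V); \<mu> \<in> ops P (length vs); \<mu>' \<in> ops P (length vs)\<rbrakk> \<Longrightarrow>
    (symb R (\<mu> \<oplus>\<^bsub>op_mod P (length vs)\<^esub> \<mu>') vs, symb R \<mu> vs \<oplus>\<^bsub>formal_alg R P V\<^esub> symb R \<mu>' vs)
      \<in> free_rels R P V"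
| op_smult: "\<lbrakk>vs \<in> lists (carrier V); \<mu> \<in> ops P (length vs); r \<in> carrier R\<rbrakk> \<Longrightarrow>
    (symb R (r \<odot>\<^bsub>op_mod P (length vs)\<^esub> \<mu>) vs, r \<odot>\<^bsub>formal_alg R P V\<^esub> symb R \<mu> vs)
      \<in> free_rels R P V"
| vec_add: "\<lbrakk>vs \<in> lists (carrier V); \<mu> \<in> ops P (length vs); i < length vs;
      v \<in> carrier V; w \<in> carrier V\<rbrakk> \<Longrightarrow>
    (symb R \<mu> (vs[i := v \<oplus>\<^bsub>V\<^esub> w]),
     symb R \<mu> (vs[i := v]) \<oplus>\<^bsub>formal_alg R P V\<^esub> symb R \<mu> (vs[i := w])) \<in> free_rels R P V"
| vec_smult: "\<lbrakk>vs \<in> lists (carrier V); \<mu> \<in> ops P (length vs); i < length vs;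
      v \<in> carrier V; r \<in> carrier R\<rbrakk> \<Longrightarrow>
    (symb R \<mu> (vs[i := r \<odot>\<^bsub>V\<^esub> v]), r \<odot>\<^bsub>formal_alg R P V\<^esub> symb R \<mu> (vs[i := v]))
      \<in> free_rels R P V"
| coinv: "\<lbrakk>vs \<in> lists (carrier V); \<mu> \<in> ops P (length vs); \<sigma> permutes {..<length vs}\<rbrakk> \<Longrightarrow>
    (symb R (op_sym P (length vs) \<mu> \<sigma>) (permute_list \<sigma> vs), symb R \<mu> vs) \<in> free_rels R P V"

definition free_null :: "('r, 'k) ring_scheme \<Rightarrow> ('r, 'p, 'n) operad_scheme \<Rightarrow>
    ('r, 'v, 'm) module_scheme \<Rightarrow> ('r, 'p, 'v) formal set" where
  "free_null R P V = gen_submodule R (formal_alg R P V) (free_rels R P V)"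

definition free_alg :: "('r, 'k) ring_scheme \<Rightarrow> ('r, 'p, 'n) operad_scheme \<Rightarrow>
    ('r, 'v, 'm) module_scheme \<Rightarrow> ('r, 'p, ('r, 'p, 'v) free) operad_alg" where
  "free_alg R P V = quot_alg (formal_alg R P V) (free_null R P V)"

definition free_elem :: "('r, 'k) ring_scheme \<Rightarrow> ('r, 'p, 'n) operad_scheme \<Rightarrow>
    ('r, 'v, 'm) module_scheme \<Rightarrow> 'p \<Rightarrow> 'v list \<Rightarrow> ('r, 'p, 'v) free" where
  "free_elem R P V \<mu> vs = free_null R P V +>\<^bsub>formal_alg R P V\<^esub> symb R \<mu> vs"

section \<open>The tangent structure\<close>

definition prod_mod :: "('r, 'a, 'm) module_scheme \<Rightarrow> ('r, 'b, 'l) module_scheme \<Rightarrow>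
    ('r, 'a \<times> 'b) module" where
  "prod_mod M N = \<lparr>carrier = carrier M \<times> carrier N, mult = undefined, one = undefined,
     zero = (\<zero>\<^bsub>M\<^esub>, \<zero>\<^bsub>N\<^esub>), add = (\<lambda>(a, b) (c, d). (a \<oplus>\<^bsub>M\<^esub> c, b \<oplus>\<^bsub>N\<^esub> d)),
     smult = (\<lambda>r (a, b). (r \<odot>\<^bsub>M\<^esub> a, r \<odot>\<^bsub>N\<^esub> b))\<rparr>"

type_synonym ('r, 'p, 'a) tan = "('r, 'p, 'a \<times> 'a) free set"

definition pair_elem :: "('r, 'k) ring_scheme \<Rightarrow> ('r, 'p, 'n) operad_scheme \<Rightarrow>
    ('r, 'p, 'a, 'm) operad_alg_scheme \<Rightarrow> 'a \<Rightarrow> 'a \<Rightarrow> ('r, 'p, 'a \<times> 'a) free" where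
  "pair_elem R P A a b = free_elem R P (prod_mod A A) (op_unit P) [(a, b)]"

inductive_set tan_rels :: "('r, 'k) ring_scheme \<Rightarrow> ('r, 'p, 'n) operad_scheme \<Rightarrow>
    ('r, 'p, 'a, 'm) operad_alg_scheme \<Rightarrow>
    (('r, 'p, 'a \<times> 'a) free \<times> ('r, 'p, 'a \<times> 'a) free) set"
  for R P A where
  base_act: "\<lbrakk>as \<in> lists (carrier A); \<mu> \<in> ops P (length as)\<rbrakk> \<Longrightarrow>
    (act (free_alg R P (prod_mod A A)) \<mu> (map (\<lambda>a. pair_elem R P A a \<zero>\<^bsub>A\<^esub>) as),
     pair_elem R P A (act A \<mu> as) \<zero>\<^bsub>A\<^esub>) \<in> tan_rels R P A"
| diff_act: "\<lbrakk>as \<in> lists (carrier A); \<mu> \<in> ops P (length as)\<rbrakk> \<Longrightarrow>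
    (pair_elem R P A \<zero>\<^bsub>A\<^esub> (act A \<mu> as),
     \<Oplus>\<^bsub>free_alg R P (prod_mod A A)\<^esub>i\<in>{..<length as}. act (free_alg R P (prod_mod A A)) \<mu>
       ((map (\<lambda>a. pair_elem R P A a \<zero>\<^bsub>A\<^esub>) as)[i := pair_elem R P A \<zero>\<^bsub>A\<^esub> (as ! i)]))
      \<in> tan_rels R P A"

definition tan_null :: "('r, 'k) ring_scheme \<Rightarrow> ('r, 'p, 'n) operad_scheme \<Rightarrow>
    ('r, 'p, 'a, 'm) operad_alg_scheme \<Rightarrow> ('r, 'p, 'a \<times> 'a) free set" where
  "tan_null R P A = gen_ideal R P (free_alg R P (prod_mod A A)) (tan_rels R P A)"

definition tan_alg :: "('r, 'k) ring_scheme \<Rightarrow> ('r, 'p, 'n) operad_scheme \<Rightarrow>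
    ('r, 'p, 'a, 'm) operad_alg_scheme \<Rightarrow> ('r, 'p, ('r, 'p, 'a) tan) operad_alg" where
  "tan_alg R P A = quot_alg (free_alg R P (prod_mod A A)) (tan_null R P A)"

definition tan_base :: "('r, 'k) ring_scheme \<Rightarrow> ('r, 'p, 'n) operad_scheme \<Rightarrow>
    ('r, 'p, 'a, 'm) operad_alg_scheme \<Rightarrow> 'a \<Rightarrow> ('r, 'p, 'a) tan" where
  "tan_base R P A a =
     tan_null R P A +>\<^bsub>free_alg R P (prod_mod A A)\<^esub> pair_elem R P A a \<zero>\<^bsub>A\<^esub>"

definition tan_d :: "('r, 'k) ring_scheme \<Rightarrow> ('r, 'p, 'n) operad_scheme \<Rightarrow>
    ('r, 'p, 'a, 'm) operad_alg_scheme \<Rightarrow> 'a \<Rightarrow> ('r, 'p, 'a) tan" where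
  "tan_d R P A a =
     tan_null R P A +>\<^bsub>free_alg R P (prod_mod A A)\<^esub> pair_elem R P A \<zero>\<^bsub>A\<^esub> a"

text \<open>
  The remaining maps are the unique morphisms with the prescribed values on generators. In
  \<open>tan_l\<close>, the outer tangent functor is applied to \<open>T = tan_alg R P A\<close>, so the four kinds of
  generators \<open>a\<close>, \<open>d a\<close>, \<open>d' a\<close>, \<open>d' d a\<close> of \<open>tan_alg R P T\<close> are
  \<open>tan_base R P T (tan_base R P A a)\<close>, \<open>tan_base R P T (tan_d R P A a)\<close>,
  \<open>tan_d R P T (tan_base R P A a)\<close>, \<open>tan_d R P T (tan_d R P A a)\<close>.
\<close>

definition tan_map :: "('r, 'k) ring_scheme \<Rightarrow> ('r, 'p, 'n) operad_scheme \<Rightarrow>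
    ('r, 'p, 'a, 'm) operad_alg_scheme \<Rightarrow> ('r, 'p, 'b, 'l) operad_alg_scheme \<Rightarrow>
    ('a \<Rightarrow> 'b) \<Rightarrow> ('r, 'p, 'a) tan \<Rightarrow> ('r, 'p, 'b) tan" where
  "tan_map R P A B f = (THE g. g \<in> alg_hom R P (tan_alg R P A) (tan_alg R P B) \<and>
     (\<forall>a\<in>carrier A. g (tan_base R P A a) = tan_base R P B (f a) \<and>
                    g (tan_d R P A a) = tan_d R P B (f a)))"

definition tan_p :: "('r, 'k) ring_scheme \<Rightarrow> ('r, 'p, 'n) operad_scheme \<Rightarrow>
    ('r, 'p, 'a, 'm) operad_alg_scheme \<Rightarrow> 'a \<Rightarrow> ('r, 'p, 'a) tan" where
  "tan_p R P A = (\<lambda>a\<in>carrier A. tan_base R P A a)"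

definition tan_z :: "('r, 'k) ring_scheme \<Rightarrow> ('r, 'p, 'n) operad_scheme \<Rightarrow>
    ('r, 'p, 'a, 'm) operad_alg_scheme \<Rightarrow> ('r, 'p, 'a) tan \<Rightarrow> 'a" where
  "tan_z R P A = (THE z. z \<in> alg_hom R P (tan_alg R P A) A \<and>
     (\<forall>a\<in>carrier A. z (tan_base R P A a) = a \<and> z (tan_d R P A a) = \<zero>\<^bsub>A\<^esub>))"

definition tan_l :: "('r, 'k) ring_scheme \<Rightarrow> ('r, 'p, 'n) operad_scheme \<Rightarrow>
    ('r, 'p, 'a, 'm) operad_alg_scheme \<Rightarrow>
    ('r, 'p, ('r, 'p, 'a) tan) tan \<Rightarrow> ('r, 'p, 'a) tan" where
  "tan_l R P A = (let T = tan_alg R P A in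
     THE l. l \<in> alg_hom R P (tan_alg R P T) T \<and>
       (\<forall>a\<in>carrier A.
          l (tan_base R P T (tan_base R P A a)) = tan_base R P A a \<and>
          l (tan_base R P T (tan_d R P A a)) = \<zero>\<^bsub>T\<^esub> \<and>
          l (tan_d R P T (tan_base R P A a)) = \<zero>\<^bsub>T\<^esub> \<and>
          l (tan_d R P T (tan_d R P A a)) = tan_d R P A a))"

section \<open>Differential objects\<close>

text \<open>
  The universal property is tested against algebras on an arbitrary but fixed type \<open>'e\<close>;
  statements about pushouts should be polymorphic in \<open>'e\<close>.
\<close>

definition is_pushout :: "'e itself \<Rightarrow> ('r, 'k) ring_scheme \<Rightarrow> ('r, 'p, 'n) operad_scheme \<Rightarrow>
    ('r, 'p, 'a, 'm) operad_alg_scheme \<Rightarrow> ('r, 'p, 'b, 'm1) operad_alg_scheme \<Rightarrow>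
    ('r, 'p, 'c, 'm2) operad_alg_scheme \<Rightarrow> ('r, 'p, 'd, 'm3) operad_alg_scheme \<Rightarrow>
    ('a \<Rightarrow> 'b) \<Rightarrow> ('a \<Rightarrow> 'c) \<Rightarrow> ('b \<Rightarrow> 'd) \<Rightarrow> ('c \<Rightarrow> 'd) \<Rightarrow> bool" where
  "is_pushout _ R P A B C D f g h k \<longleftrightarrow>
     f \<in> alg_hom R P A B \<and> g \<in> alg_hom R P A C \<and> h \<in> alg_hom R P B D \<and> k \<in> alg_hom R P C D \<and>
     (\<forall>x\<in>carrier A. h (f x) = k (g x)) \<and>
     (\<forall>(E :: ('r, 'p, 'e) operad_alg) u v.
        operad_algebra R P E \<and> u \<in> alg_hom R P B E \<and> v \<in> alg_hom R P C E \<and>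
        (\<forall>x\<in>carrier A. u (f x) = v (g x)) \<longrightarrow>
        (\<exists>!w. w \<in> alg_hom R P D E \<and>
           (\<forall>x\<in>carrier B. w (h x) = u x) \<and> (\<forall>x\<in>carrier C. w (k x) = v x)))"

definition differential_object :: "'e itself \<Rightarrow> ('r, 'k) ring_scheme \<Rightarrow>
    ('r, 'p, 'n) operad_scheme \<Rightarrow> ('r, 'p, 'a, 'm) operad_alg_scheme \<Rightarrow>
    ('a \<Rightarrow> 'p) \<Rightarrow> (('r, 'p, 'a) tan \<Rightarrow> 'a) \<Rightarrow> bool" where
  "differential_object e R P A \<zeta> L \<longleftrightarrow>
     operad_algebra R P A \<and>
     \<zeta> \<in> alg_hom R P A (initial_alg P) \<and>
     L \<in> alg_hom R P (tan_alg R P A) A \<and>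
     (\<forall>a\<in>carrier A. L (tan_p R P A a) = initial_map P A (\<zeta> a)) \<and>
     (\<forall>x\<in>carrier (tan_alg R P A). \<zeta> (L x) = \<zeta> (tan_z R P A x)) \<and>
     (\<forall>y\<in>carrier (tan_alg R P (tan_alg R P A)).
        L (tan_map R P (tan_alg R P A) A L y) = L (tan_l R P A y)) \<and>
     is_pushout e R P A (tan_alg R P A) (initial_alg P) A
       (tan_p R P A) \<zeta> L (initial_map P A)"

end

theory Submission
  imports Defs
begin

text \<open>
  For an algebra \<open>E\<close> let \<open>E[\<epsilon>]\<close> be the algebra of dual numbers over \<open>E\<close>, whose operations are those
  of \<open>E\<close> extended multilinearly with \<open>\<epsilon>\<^sup>2 = 0\<close>. A morphism \<open>A \<rightarrow> E[\<epsilon>]\<close> is a morphism \<open>A \<rightarrow> E\<close> together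
  with a derivation along it, so the tangent algebra represents such pairs: morphisms \<open>T A \<rightarrow> E\<close> are
  morphisms \<open>A \<rightarrow> E[\<epsilon>]\<close>. Hence a morphism out of \<open>T S(V)\<close> is determined, freely, by its values on the
  elements \<open>v\<close> and \<open>d v\<close> for \<open>v\<close> in \<open>V\<close>, and likewise for \<open>T T S(V)\<close>. The zero sends \<open>v\<close> to \<open>0\<close>, the lift
  sends \<open>v\<close> to \<open>0\<close> and \<open>d v\<close> to \<open>v\<close>, all equations between morphisms are checked on these generators,
  the pushout mediator of \<open>f : T S(V) \<rightarrow> E\<close> and \<open>g : P(0) \<rightarrow> E\<close> is the extension of \<open>v \<mapsto> f (d v)\<close>,
  and \<open>T S(V) \<cong> S(V \<times> V)\<close> because both have the same universal property.
\<close>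

section \<open>Lists\<close>

text \<open>A morphism preserves the operations of arity 0, so the zero has to send the class of
  \<open>(\<mu>, [])\<close> to \<open>\<mu>\<close> and can vanish only in positive arity. The lift
  is induced by the morphism S(V) -> S(V)[\<epsilon>] with v |-> \<epsilon> v. On (\<mu>; v1, ...,
  vn) this morphism has constant term \<mu>(0, ..., 0), and its \<epsilon>-coefficient is the sum of
  the n terms \<mu>(0, ..., vi, ..., 0). The former is zero for n > 0, the latter for n \<noteq> 1.
  This is the origin of the case distinctions in the values of the zero and the lift.

  The obstacle lies in the construction of S(V). Formal combinations of symbols satisfy the laws of
  an algebra only modulo the relations, and the relations are generated as a submodule, not as an
  ideal. Ideals and quotients are therefore treated for actions that are merely multilinear in their
  arguments, the submodule of relations is shown to be an ideal for such an action, and the laws of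
  an algebra, which are multilinear themselves, are tested on classes of symbols.\<close>

lemma update_lists_closed: "xs \<in> lists C \<Longrightarrow> x \<in> C \<Longrightarrow> xs[i := x] \<in> lists C"
  using set_update_subset_insert[of xs i x] by (auto simp: in_lists_conv_set)

text \<open>Place \<open>i\<close> of the permuted list shows entry \<open>\<sigma> i\<close>, so an
  update has to be moved accordingly. This carries multilinearity, and later the Leibniz sum, past a
  permutation of the arguments.\<close>

lemma list_update_permute:
  assumes "\<sigma> permutes {..<length xs}" "i < length xs"
  shows "permute_list \<sigma> (xs[\<sigma> i := a]) = (permute_list \<sigma> xs)[i := a]"
proof -
  have lt: "\<sigma> j < length xs \<longleftrightarrow> j < length xs" for j
    using permutes_in_image[OF assms(1), of j] by simp
  have "permute_list \<sigma> (xs[\<sigma> i := a]) ! j = (permute_list \<sigma> xs)[i := a] ! j" if "j < length xs" for j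
    using assms that lt permutes_inj[OF assms(1)]
    by (cases "j = i") (auto simp: permute_list_def inj_eq)
  then show ?thesis by (intro nth_equalityI) auto
qed

text \<open>A distinguished entry of a concatenation sits in one block. Varying one inner argument
  of a nested composite therefore varies one argument of one inner operation.\<close>

lemma concat_eq_splitD:
  assumes "concat xss = ys @ z # zs"
  shows "\<exists>pre p q post. xss = pre @ (p @ z # q) # post \<and> ys = concat pre @ p \<and> zs = q @ concat post"
  using assms
proof (induction xss arbitrary: ys)
  case (Cons xs xss)
  then have *: "xs @ concat xss = ys @ z # zs" by simp
  then consider us where "xs @ us = ys" "concat xss = us @ z # zs"
    | us where "xs = ys @ z # us" "us @ concat xss = zs"
    by (auto simp: append_eq_append_conv2 Cons_eq_append_conv append_eq_Cons_conv)
  then show ?case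
  proof cases
    case 1
    from Cons.IH[OF 1(2)] obtain pre p q post where
      "xss = pre @ (p @ z # q) # post" "us = concat pre @ p" "zs = q @ concat post" by blast
    then show ?thesis using 1
      by (intro exI[of _ "xs # pre"] exI[of _ p] exI[of _ q] exI[of _ post]) auto
  next
    case 2
    then show ?thesis
      by (intro exI[of _ "[]"] exI[of _ ys] exI[of _ us] exI[of _ xss]) auto
  qed
qed simp

section \<open>Modules: spans and quotients\<close>

text \<open>Closure under the operations instead of finite linear combinations: linear identities
  then follow by rule induction.\<close>

inductive_set mod_span :: "('r, 'k) ring_scheme \<Rightarrow> ('r, 'a, 'm) module_scheme \<Rightarrow> 'a set \<Rightarrow> 'a set"
  for R M G where
  zero: "\<zero>\<^bsub>M\<^esub> \<in> mod_span R M G"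
| gen: "x \<in> G \<Longrightarrow> x \<in> mod_span R M G"
| add: "\<lbrakk>x \<in> mod_span R M G; y \<in> mod_span R M G\<rbrakk> \<Longrightarrow> x \<oplus>\<^bsub>M\<^esub> y \<in> mod_span R M G"
| smult: "\<lbrakk>r \<in> carrier R; x \<in> mod_span R M G\<rbrakk> \<Longrightarrow> r \<odot>\<^bsub>M\<^esub> x \<in> mod_span R M G"

text \<open>Equality rather than inclusion, so that spanning also places \<open>G\<close> inside the
  carrier.\<close>

definition spans :: "('r, 'k) ring_scheme \<Rightarrow> ('r, 'a, 'm) module_scheme \<Rightarrow> 'a set \<Rightarrow> bool" where
  "spans R M G \<longleftrightarrow> mod_span R M G = carrier M"

text \<open>In contrast to \<open>alg_hom\<close>, values off the carrier are arbitrary, so coset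
  projections and evaluations in one argument are linear maps without a
  \<open>restrict\<close>.\<close>

definition mod_hom :: "('r, 'k) ring_scheme \<Rightarrow> ('r, 'a, 'm) module_scheme \<Rightarrow>
    ('r, 'b, 'l) module_scheme \<Rightarrow> ('a \<Rightarrow> 'b) set" where
  "mod_hom R M N = {f \<in> carrier M \<rightarrow> carrier N.
     (\<forall>x\<in>carrier M. \<forall>y\<in>carrier M. f (x \<oplus>\<^bsub>M\<^esub> y) = f x \<oplus>\<^bsub>N\<^esub> f y) \<and>
     (\<forall>r\<in>carrier R. \<forall>x\<in>carrier M. f (r \<odot>\<^bsub>M\<^esub> x) = r \<odot>\<^bsub>N\<^esub> f x)}"

lemma mod_homI:
  assumes "\<And>x. x \<in> carrier M \<Longrightarrow> f x \<in> carrier N"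
    and "\<And>x y. x \<in> carrier M \<Longrightarrow> y \<in> carrier M \<Longrightarrow> f (x \<oplus>\<^bsub>M\<^esub> y) = f x \<oplus>\<^bsub>N\<^esub> f y"
    and "\<And>r x. r \<in> carrier R \<Longrightarrow> x \<in> carrier M \<Longrightarrow> f (r \<odot>\<^bsub>M\<^esub> x) = r \<odot>\<^bsub>N\<^esub> f x"
  shows "f \<in> mod_hom R M N"
  using assms by (auto simp: mod_hom_def)

lemma mod_homD:
  assumes "f \<in> mod_hom R M N"
  shows "x \<in> carrier M \<Longrightarrow> f x \<in> carrier N"
    and "x \<in> carrier M \<Longrightarrow> y \<in> carrier M \<Longrightarrow> f (x \<oplus>\<^bsub>M\<^esub> y) = f x \<oplus>\<^bsub>N\<^esub> f y"
    and "r \<in> carrier R \<Longrightarrow> x \<in> carrier M \<Longrightarrow> f (r \<odot>\<^bsub>M\<^esub> x) = r \<odot>\<^bsub>N\<^esub> f x"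
  using assms by (auto simp: mod_hom_def)

lemma mod_hom_zero:
  assumes "module R M" "module R N" "f \<in> mod_hom R M N"
  shows "f \<zero>\<^bsub>M\<^esub> = \<zero>\<^bsub>N\<^esub>"
proof -
  interpret M: module R M by fact
  interpret N: module R N by fact
  have "f \<zero>\<^bsub>M\<^esub> = f (\<zero>\<^bsub>R\<^esub> \<odot>\<^bsub>M\<^esub> \<zero>\<^bsub>M\<^esub>)" by simp
  also have "\<dots> = \<zero>\<^bsub>R\<^esub> \<odot>\<^bsub>N\<^esub> f \<zero>\<^bsub>M\<^esub>" by (intro mod_homD[OF assms(3)]) auto
  also have "\<dots> = \<zero>\<^bsub>N\<^esub>" by (intro N.smult_l_null mod_homD[OF assms(3)]) auto
  finally show ?thesis .
qed

lemma mod_hom_minus: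
  assumes "module R M" "module R N" "f \<in> mod_hom R M N" "x \<in> carrier M" "y \<in> carrier M"
  shows "f (x \<ominus>\<^bsub>M\<^esub> y) = f x \<ominus>\<^bsub>N\<^esub> f y"
proof -
  interpret M: module R M by fact
  interpret N: module R N by fact
  note f = mod_homD[OF assms(3)]
  have "f (\<ominus>\<^bsub>M\<^esub> y) = f ((\<ominus>\<^bsub>R\<^esub> \<one>\<^bsub>R\<^esub>) \<odot>\<^bsub>M\<^esub> y)" using assms by (simp add: M.smult_l_minus)
  also have "\<dots> = (\<ominus>\<^bsub>R\<^esub> \<one>\<^bsub>R\<^esub>) \<odot>\<^bsub>N\<^esub> f y" using assms by (intro f) auto
  also have "\<dots> = \<ominus>\<^bsub>N\<^esub> f y" using assms f(1) by (simp add: N.smult_l_minus)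
  finally show ?thesis using assms f by (simp add: M.minus_eq N.minus_eq)
qed

lemma mod_hom_kernel_submodule:
  assumes "module R M" "module R N" "f \<in> mod_hom R M N"
  shows "submodule {x \<in> carrier M. f x = \<zero>\<^bsub>N\<^esub>} R M"
proof -
  interpret M: module R M by fact
  interpret N: module R N by fact
  note f = mod_homD[OF assms(3)]
  have neg: "f (\<ominus>\<^bsub>M\<^esub> a) = \<zero>\<^bsub>N\<^esub>" if "a \<in> carrier M" "f a = \<zero>\<^bsub>N\<^esub>" for a
    using mod_hom_minus[OF assms, of "\<zero>\<^bsub>M\<^esub>" a] that mod_hom_zero[OF assms]
    by (simp add: M.minus_eq N.minus_eq)
  show ?thesis
    by (rule M.submoduleI) (auto simp: f mod_hom_zero[OF assms] neg)
qed

lemma mod_hom_finsum: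
  assumes "module R M" "module R N" "f \<in> mod_hom R M N" "finite I" "g \<in> I \<rightarrow> carrier M"
  shows "f (finsum M g I) = finsum N (\<lambda>i. f (g i)) I"
  using assms(4,5)
proof (induction I)
  case empty
  interpret M: module R M by fact
  interpret N: module R N by fact
  show ?case using mod_hom_zero[OF assms(1-3)] by simp
next
  case (insert i I)
  interpret M: module R M by fact
  interpret N: module R N by fact
  note f = mod_homD[OF assms(3)]
  have "f (finsum M g (insert i I)) = f (g i \<oplus>\<^bsub>M\<^esub> finsum M g I)"
    using insert by (subst M.finsum_insert) auto
  also have "\<dots> = f (g i) \<oplus>\<^bsub>N\<^esub> f (finsum M g I)" using insert by (intro f) auto
  also have "\<dots> = finsum N (\<lambda>i. f (g i)) (insert i I)"
    using insert by (subst N.finsum_insert) (auto intro!: f(1) simp: Pi_def)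
  finally show ?case .
qed

lemma mod_hom_eq_on_span:
  assumes "module R M" "module R N" "f \<in> mod_hom R M N" "g \<in> mod_hom R M N"
    and "spans R M G" "\<And>x. x \<in> G \<Longrightarrow> f x = g x" "x \<in> carrier M"
  shows "f x = g x"
proof -
  have "x \<in> mod_span R M G" using assms by (simp add: spans_def)
  then have "x \<in> carrier M \<and> f x = g x"
  proof induction
    case zero
    interpret M: module R M by fact
    show ?case using mod_hom_zero[OF assms(1-3)] mod_hom_zero[OF assms(1,2,4)] by simp
  next
    case (gen x)
    then show ?case using assms(5,6) mod_span.gen by (fastforce simp: spans_def)
  next
    case (add x y)
    interpret M: module R M by fact
    show ?case using add mod_homD[OF assms(3)] mod_homD[OF assms(4)] by simp
  next
    case (smult r x)
    interpret M: module R M by fact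
    show ?case using smult mod_homD[OF assms(3)] mod_homD[OF assms(4)] by simp
  qed
  then show ?thesis ..
qed

lemma spans_image:
  assumes "module R M" "module R N" "f \<in> mod_hom R M N" "f ` carrier M = carrier N" "spans R M G"
  shows "spans R N (f ` G)"
proof -
  interpret M: module R M by fact
  interpret N: module R N by fact
  note f = mod_homD[OF assms(3)]
  have GM: "G \<subseteq> carrier M" using assms(5) by (auto simp: spans_def intro: mod_span.gen)
  have 1: "x \<in> carrier M \<and> f x \<in> mod_span R N (f ` G)" if "x \<in> mod_span R M G" for x
    using that
  proof induction
    case zero
    then show ?case using mod_hom_zero[OF assms(1-3)] by (auto intro: mod_span.zero)
  next
    case (gen x)
    then show ?case using GM by (auto intro: mod_span.gen)
  next
    case (add x y)
    then show ?case by (auto simp: f(2) intro: mod_span.add)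
  next
    case (smult r x)
    then show ?case by (auto simp: f(3) intro: mod_span.smult)
  qed
  have 2: "y \<in> carrier N" if "y \<in> mod_span R N (f ` G)" for y
    using that GM by induction (auto intro: f(1))
  show ?thesis unfolding spans_def
  proof (intro equalityI subsetI)
    fix y assume "y \<in> carrier N"
    then obtain x where "x \<in> carrier M" "y = f x" using assms(4) by blast
    then show "y \<in> mod_span R N (f ` G)" using 1 assms(5) by (auto simp: spans_def)
  qed (rule 2)
qed

lemma spans_carrier: "module R M \<Longrightarrow> spans R M (carrier M)"
proof -
  assume "module R M"
  then interpret module R M .
  have "x \<in> carrier M" if "x \<in> mod_span R M (carrier M)" for x
    using that by induction auto
  then show ?thesis unfolding spans_def by (auto intro: mod_span.gen)
qed

section \<open>Submodules, cosets and generated submodules\<close>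

context module
begin

lemma submodule_mem:
  assumes "submodule I R M"
  shows "x \<in> I \<Longrightarrow> x \<in> carrier M"
    and "\<zero>\<^bsub>M\<^esub> \<in> I"
    and "x \<in> I \<Longrightarrow> y \<in> I \<Longrightarrow> x \<oplus>\<^bsub>M\<^esub> y \<in> I"
    and "x \<in> I \<Longrightarrow> \<ominus>\<^bsub>M\<^esub> x \<in> I"
    and "r \<in> carrier R \<Longrightarrow> x \<in> I \<Longrightarrow> r \<odot>\<^bsub>M\<^esub> x \<in> I"
  using submoduleE[OF assms] subgroup.one_closed[OF submodule.axioms(1)[OF assms]] by auto

lemma submodule_abelian_subgroup: "submodule I R M \<Longrightarrow> abelian_subgroup I M"
  by (intro abelian_subgroupI3 additive_subgroupI submodule.axioms(1) abelian_group_axioms)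

lemma coset_eq_iff:
  assumes "submodule I R M" "x \<in> carrier M" "y \<in> carrier M"
  shows "I +>\<^bsub>M\<^esub> x = I +>\<^bsub>M\<^esub> y \<longleftrightarrow> x \<ominus>\<^bsub>M\<^esub> y \<in> I"
proof -
  interpret I: abelian_subgroup I M by (rule submodule_abelian_subgroup) fact
  show ?thesis
    using I.a_rcos_module[OF assms(3,2)] I.a_repr_independence'[of x y] I.a_repr_independenceD[of x y]
      assms by (auto simp: M.minus_eq)
qed

lemma coset_memD:
  assumes "submodule I R M" "x \<in> carrier M" "y \<in> I +>\<^bsub>M\<^esub> x"
  shows "y \<in> carrier M" "I +>\<^bsub>M\<^esub> y = I +>\<^bsub>M\<^esub> x"
proof -
  interpret I: abelian_subgroup I M by (rule submodule_abelian_subgroup) fact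
  show "y \<in> carrier M" using I.a_elemrcos_carrier assms by blast
  show "I +>\<^bsub>M\<^esub> y = I +>\<^bsub>M\<^esub> x" using I.a_repr_independence' assms by blast
qed

lemma coset_mem_self: "submodule I R M \<Longrightarrow> x \<in> carrier M \<Longrightarrow> x \<in> I +>\<^bsub>M\<^esub> x"
  using abelian_subgroup.a_rcos_self[OF submodule_abelian_subgroup] by blast

lemma coset_eq_zero_iff:
  assumes "submodule I R M" "x \<in> carrier M"
  shows "I +>\<^bsub>M\<^esub> x = I \<longleftrightarrow> x \<in> I"
proof -
  have z: "\<ominus>\<^bsub>M\<^esub> \<zero>\<^bsub>M\<^esub> = \<zero>\<^bsub>M\<^esub>"
    by (metis M.l_zero M.r_neg M.zero_closed M.a_inv_closed)
  show ?thesis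
    using coset_eq_iff[OF assms(1,2) M.zero_closed] assms
    abelian_subgroup.a_rcos_const[OF submodule_abelian_subgroup[OF assms(1)], of "\<zero>\<^bsub>M\<^esub>"]
    submodule_mem(2)[OF assms(1)]
    by (simp add: M.minus_eq z)
qed

lemma coset_add:
  assumes "submodule I R M" "x \<in> carrier M" "y \<in> carrier M"
  shows "(I +>\<^bsub>M\<^esub> x) <+>\<^bsub>M\<^esub> (I +>\<^bsub>M\<^esub> y) = I +>\<^bsub>M\<^esub> (x \<oplus>\<^bsub>M\<^esub> y)"
  by (rule abelian_subgroup.a_rcos_sum[OF submodule_abelian_subgroup]) fact+

text \<open>The scalar action on cosets is defined as a union over representatives. It collapses to
  one coset because the difference of two representatives stays in \<open>I\<close> after
  scaling.\<close>

lemma coset_smult: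
  assumes I: "submodule I R M" and x: "x \<in> carrier M" and r: "r \<in> carrier R"
  shows "(\<Union>x'\<in>I +>\<^bsub>M\<^esub> x. I +>\<^bsub>M\<^esub> (r \<odot>\<^bsub>M\<^esub> x')) = I +>\<^bsub>M\<^esub> (r \<odot>\<^bsub>M\<^esub> x)"
proof -
  have "I +>\<^bsub>M\<^esub> (r \<odot>\<^bsub>M\<^esub> x') = I +>\<^bsub>M\<^esub> (r \<odot>\<^bsub>M\<^esub> x)" if "x' \<in> I +>\<^bsub>M\<^esub> x" for x'
  proof -
    note x' = coset_memD[OF I x that]
    have "x' \<ominus>\<^bsub>M\<^esub> x \<in> I" using coset_eq_iff[OF I x'(1) x] x'(2) by simp
    then have "r \<odot>\<^bsub>M\<^esub> (x' \<ominus>\<^bsub>M\<^esub> x) \<in> I" using r submodule_mem(5)[OF I] by blast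
    then have "r \<odot>\<^bsub>M\<^esub> x' \<ominus>\<^bsub>M\<^esub> r \<odot>\<^bsub>M\<^esub> x \<in> I"
      using x x' r by (simp add: M.minus_eq smult_r_distr smult_r_minus)
    then show ?thesis using coset_eq_iff[OF I] x x' r by simp
  qed
  then show ?thesis using coset_mem_self[OF I x] by blast
qed

text \<open>With all relations inside the carrier, the carrier itself belongs to the intersected
  family and bounds the intersection; an empty family would yield the whole type.\<close>

lemma gen_submodule_submodule:
  "submodule (gen_submodule R M E) R M" if "\<And>x y. (x, y) \<in> E \<Longrightarrow> x \<in> carrier M \<and> y \<in> carrier M"
proof -
  have c: "submodule (carrier M) R M \<and> (\<forall>(x, y)\<in>E. x \<ominus>\<^bsub>M\<^esub> y \<in> carrier M)"
    using that carrier_is_submodule by auto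
  then have "gen_submodule R M E \<subseteq> carrier M"
    unfolding gen_submodule_def by (intro Inter_lower) simp
  then show ?thesis
    by (intro submoduleI) (auto simp: gen_submodule_def submodule_mem(2-5))
qed

lemma gen_submodule_least:
  assumes "submodule I R M" "\<And>x y. (x, y) \<in> E \<Longrightarrow> x \<ominus>\<^bsub>M\<^esub> y \<in> I"
  shows "gen_submodule R M E \<subseteq> I"
  using assms unfolding gen_submodule_def by blast

end

lemma gen_submodule_gen: "(x, y) \<in> E \<Longrightarrow> x \<ominus>\<^bsub>M\<^esub> y \<in> gen_submodule R M E"
  unfolding gen_submodule_def by blast

text \<open>The module laws are equations, so they pass along a surjection that respects the
  operations. With the identity as \<open>f\<close>, this also moves a module structure between two
  records that share carrier and operations.\<close>

lemma module_surj_image: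
  fixes N :: "('r, 'b, 'l) module_scheme"
  assumes "module R M" "f ` carrier M = carrier N" "\<zero>\<^bsub>N\<^esub> = f \<zero>\<^bsub>M\<^esub>"
    and add: "\<And>x y. x \<in> carrier M \<Longrightarrow> y \<in> carrier M \<Longrightarrow> f x \<oplus>\<^bsub>N\<^esub> f y = f (x \<oplus>\<^bsub>M\<^esub> y)"
    and smult: "\<And>r x. r \<in> carrier R \<Longrightarrow> x \<in> carrier M \<Longrightarrow> r \<odot>\<^bsub>N\<^esub> f x = f (r \<odot>\<^bsub>M\<^esub> x)"
  shows "module R N"
proof -
  interpret M: module R M by fact
  have ex: "\<exists>x\<in>carrier M. y = f x" if "y \<in> carrier N" for y using assms(2) that by blast
  have cl: "f x \<in> carrier N" if "x \<in> carrier M" for x using assms(2) that by blast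
  have abel: "abelian_group N"
  proof (rule abelian_groupI)
    fix x y z assume "x \<in> carrier N" "y \<in> carrier N" "z \<in> carrier N"
    then obtain a b c where "a \<in> carrier M" "b \<in> carrier M" "c \<in> carrier M" "x = f a" "y = f b" "z = f c"
      using ex by meson
    then show "x \<oplus>\<^bsub>N\<^esub> y \<oplus>\<^bsub>N\<^esub> z = x \<oplus>\<^bsub>N\<^esub> (y \<oplus>\<^bsub>N\<^esub> z)"
      by (simp add: add M.M.a_assoc)
  next
    fix x y assume "x \<in> carrier N" "y \<in> carrier N"
    then obtain a b where "a \<in> carrier M" "b \<in> carrier M" "x = f a" "y = f b"
      using ex by meson
    then show "x \<oplus>\<^bsub>N\<^esub> y = y \<oplus>\<^bsub>N\<^esub> x" "x \<oplus>\<^bsub>N\<^esub> y \<in> carrier N"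
      by (auto simp: add M.M.a_comm intro: cl)
  next
    fix x assume "x \<in> carrier N"
    then obtain a where "a \<in> carrier M" "x = f a"
      using ex by meson
    then show "\<zero>\<^bsub>N\<^esub> \<oplus>\<^bsub>N\<^esub> x = x" "\<exists>y\<in>carrier N. y \<oplus>\<^bsub>N\<^esub> x = \<zero>\<^bsub>N\<^esub>"
       by (auto simp: assms(3) add M.M.l_neg intro!: bexI[of _ "f (\<ominus>\<^bsub>M\<^esub> a)"] cl)
  qed (auto simp: assms(3) intro: cl)
  have c1: "r \<odot>\<^bsub>N\<^esub> x \<in> carrier N" if "r \<in> carrier R" "x \<in> carrier N" for r x
    using that ex[of x] cl[OF M.smult_closed] by (auto simp: smult)
  have c2: "\<one>\<^bsub>R\<^esub> \<odot>\<^bsub>N\<^esub> x = x" if "x \<in> carrier N" for x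
    using that ex[of x] by (auto simp: smult)
  have c3: "(r \<oplus>\<^bsub>R\<^esub> s) \<odot>\<^bsub>N\<^esub> x = r \<odot>\<^bsub>N\<^esub> x \<oplus>\<^bsub>N\<^esub> s \<odot>\<^bsub>N\<^esub> x"
    "(r \<otimes>\<^bsub>R\<^esub> s) \<odot>\<^bsub>N\<^esub> x = r \<odot>\<^bsub>N\<^esub> (s \<odot>\<^bsub>N\<^esub> x)"
    if "r \<in> carrier R" "s \<in> carrier R" "x \<in> carrier N" for r s x
    using that ex[of x] by (auto simp: add smult M.smult_l_distr M.smult_assoc1)
  have c4: "r \<odot>\<^bsub>N\<^esub> (x \<oplus>\<^bsub>N\<^esub> y) = r \<odot>\<^bsub>N\<^esub> x \<oplus>\<^bsub>N\<^esub> r \<odot>\<^bsub>N\<^esub> y"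
    if "r \<in> carrier R" "x \<in> carrier N" "y \<in> carrier N" for r x y
    using that ex[of x] ex[of y] by (auto simp: add smult M.smult_r_distr)
  show ?thesis by (rule moduleI[OF M.cring_axioms abel c1 c3(1) c4 c3(2) c2])
qed

section \<open>Multilinear actions\<close>

text \<open>A part of \<open>operad_algebra\<close> that holds already for formal combinations of
  symbols: no law about sums of operations, units, composites or permutations is assumed. It
  suffices for kernels, ideals and quotients.\<close>

locale multilinear_act = module R A + operad R P
  for R (structure) and P :: "('r, 'p, 'n) operad_scheme"
    and A :: "('r, 'p, 'a, 'm) operad_alg_scheme" +
  assumes act_closed: "\<lbrakk>as \<in> lists (carrier A); \<mu> \<in> ops P (length as)\<rbrakk> \<Longrightarrow> act A \<mu> as \<in> carrier A"
    and act_args_add: "\<lbrakk>as \<in> lists (carrier A); \<mu> \<in> ops P (length as); i < length as;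
        a \<in> carrier A; b \<in> carrier A\<rbrakk> \<Longrightarrow>
      act A \<mu> (as[i := a \<oplus>\<^bsub>A\<^esub> b]) = act A \<mu> (as[i := a]) \<oplus>\<^bsub>A\<^esub> act A \<mu> (as[i := b])"
    and act_args_smult: "\<lbrakk>as \<in> lists (carrier A); \<mu> \<in> ops P (length as); i < length as;
        a \<in> carrier A; r \<in> carrier R\<rbrakk> \<Longrightarrow>
      act A \<mu> (as[i := r \<odot>\<^bsub>A\<^esub> a]) = r \<odot>\<^bsub>A\<^esub> act A \<mu> (as[i := a])"
begin

lemma act_split_add:
  assumes "ys \<in> lists (carrier A)" "zs \<in> lists (carrier A)" "a \<in> carrier A" "b \<in> carrier A"
    and "\<mu> \<in> ops P (length ys + Suc (length zs))"
  shows "act A \<mu> (ys @ (a \<oplus>\<^bsub>A\<^esub> b) # zs) = act A \<mu> (ys @ a # zs) \<oplus>\<^bsub>A\<^esub> act A \<mu> (ys @ b # zs)"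
  using act_args_add[of "ys @ a # zs" \<mu> "length ys" a b] assms by simp

lemma act_split_smult:
  assumes "ys \<in> lists (carrier A)" "zs \<in> lists (carrier A)" "a \<in> carrier A" "r \<in> carrier R"
    and "\<mu> \<in> ops P (length ys + Suc (length zs))"
  shows "act A \<mu> (ys @ (r \<odot>\<^bsub>A\<^esub> a) # zs) = r \<odot>\<^bsub>A\<^esub> act A \<mu> (ys @ a # zs)"
  using act_args_smult[of "ys @ a # zs" \<mu> "length ys" a r] assms by simp

lemma act_arg_hom:
  assumes "as \<in> lists (carrier A)" "\<mu> \<in> ops P (length as)" "i < length as"
  shows "(\<lambda>a. act A \<mu> (as[i := a])) \<in> mod_hom R A A"
proof (rule mod_homI)
  fix x assume "x \<in> carrier A"
  then show "act A \<mu> (as[i := x]) \<in> carrier A"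
    using assms set_update_subset_insert[of as i x] by (intro act_closed) auto
qed (use assms act_args_add act_args_smult in auto)

lemma act_arg_zero:
  assumes "as \<in> lists (carrier A)" "\<mu> \<in> ops P (length as)" "i < length as"
  shows "act A \<mu> (as[i := \<zero>\<^bsub>A\<^esub>]) = \<zero>\<^bsub>A\<^esub>"
  using mod_hom_zero[OF module_axioms module_axioms act_arg_hom[OF assms]] .

lemma act_zero_mem:
  assumes "as \<in> lists (carrier A)" "\<mu> \<in> ops P (length as)" "\<zero>\<^bsub>A\<^esub> \<in> set as"
  shows "act A \<mu> as = \<zero>\<^bsub>A\<^esub>"
proof -
  obtain i where "i < length as" "as ! i = \<zero>\<^bsub>A\<^esub>" using assms(3) by (auto simp: in_set_conv_nth)
  then show ?thesis using act_arg_zero[OF assms(1,2)] by (metis list_update_id)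
qed

end

text \<open>Multilinear extension in the form of an induction rule: a property that survives zeros,
  sums and multiples in each single place only has to be checked on lists of generators.\<close>

lemma multilinear_induct [consumes 4, case_names gen zero add smult]:
  assumes "module R A" "spans R A G" "xs \<in> lists (carrier A)" "length xs = n"
    and gen: "\<And>xs. xs \<in> lists G \<Longrightarrow> length xs = n \<Longrightarrow> Q xs"
    and zero: "\<And>ys zs. ys \<in> lists (carrier A) \<Longrightarrow> zs \<in> lists (carrier A) \<Longrightarrow>
      length ys + Suc (length zs) = n \<Longrightarrow> Q (ys @ \<zero>\<^bsub>A\<^esub> # zs)"
    and add: "\<And>ys zs a b. ys \<in> lists (carrier A) \<Longrightarrow> zs \<in> lists (carrier A) \<Longrightarrow>
      length ys + Suc (length zs) = n \<Longrightarrow> a \<in> carrier A \<Longrightarrow> b \<in> carrier A \<Longrightarrow>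
      Q (ys @ a # zs) \<Longrightarrow> Q (ys @ b # zs) \<Longrightarrow> Q (ys @ (a \<oplus>\<^bsub>A\<^esub> b) # zs)"
    and smult: "\<And>ys zs a r. ys \<in> lists (carrier A) \<Longrightarrow> zs \<in> lists (carrier A) \<Longrightarrow>
      length ys + Suc (length zs) = n \<Longrightarrow> a \<in> carrier A \<Longrightarrow> r \<in> carrier R \<Longrightarrow>
      Q (ys @ a # zs) \<Longrightarrow> Q (ys @ (r \<odot>\<^bsub>A\<^esub> a) # zs)"
  shows "Q xs"
proof -
  interpret module R A by fact
  have GA: "G \<subseteq> carrier A" using assms(2) by (auto simp: spans_def intro: mod_span.gen)
  then have lG: "zs \<in> lists (carrier A)" if "zs \<in> lists G" for zs using that by auto
  \<comment> \<open>Invariant: generators on the right, arbitrary entries on the left. The last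
    arbitrary entry is expanded along its derivation in the span; a generator reached in this way
    joins the right part.\<close>
  have "Q (ys @ zs)" if "ys \<in> lists (carrier A)" "zs \<in> lists G" "length ys + length zs = n" for ys zs
    using that
  proof (induction ys arbitrary: zs rule: rev_induct)
    case Nil
    then show ?case by (simp add: gen)
  next
    case (snoc y ys)
    have "y \<in> mod_span R A G" using assms(2) snoc.prems by (simp add: spans_def)
    then have "y \<in> carrier A \<and> Q (ys @ y # zs)"
    proof induction
      case zero
      show ?case using snoc.prems assms(6)[of ys zs] lG[of zs] by simp
    next
      case (gen y)
      have "Q (ys @ (y # zs))" using snoc.prems gen by (intro snoc.IH) auto
      then show ?case using gen GA by auto
    next
      case (add x y)
      then show ?case using snoc.prems assms(7)[of ys zs x y] lG[of zs] by simp
    next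
      case (smult r x)
      then show ?case using snoc.prems assms(8)[of ys zs x r] lG[of zs] by simp
    qed
    then show ?case by simp
  qed
  from this[of xs "[]"] show ?thesis using assms(3,4) by simp
qed

lemma operad_algebra_imp_multilinear:
  assumes "operad_algebra R P A" shows "multilinear_act R P A"
proof -
  interpret A: operad_algebra R P A by fact
  show ?thesis
    by (intro multilinear_act.intro A.module_axioms A.operad_axioms multilinear_act_axioms.intro)
      (fact A.act_closed A.act_args_add A.act_args_smult)+
qed

text \<open>Each law of an algebra compares two expressions that are multilinear in the elements, so
  it can be tested on a spanning set. The delicate law is that of composition, where the elements
  are nested in blocks.\<close>

lemma (in multilinear_act) operad_algebraI:
  assumes G: "spans R A G"
    and add: "\<And>xs \<mu> \<mu>'. \<lbrakk>xs \<in> lists G; \<mu> \<in> ops P (length xs); \<mu>' \<in> ops P (length xs)\<rbrakk> \<Longrightarrow>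
      act A (\<mu> \<oplus>\<^bsub>op_mod P (length xs)\<^esub> \<mu>') xs = act A \<mu> xs \<oplus>\<^bsub>A\<^esub> act A \<mu>' xs"
    and smult: "\<And>xs \<mu> r. \<lbrakk>xs \<in> lists G; \<mu> \<in> ops P (length xs); r \<in> carrier R\<rbrakk> \<Longrightarrow>
      act A (r \<odot>\<^bsub>op_mod P (length xs)\<^esub> \<mu>) xs = r \<odot>\<^bsub>A\<^esub> act A \<mu> xs"
    and unit: "\<And>x. x \<in> G \<Longrightarrow> act A (op_unit P) [x] = x"
    and comp: "\<And>xss \<mu> \<nu>s. \<lbrakk>xss \<in> lists (lists G); \<mu> \<in> ops P (length xss);
        list_all2 (\<lambda>xs \<nu>. \<nu> \<in> ops P (length xs)) xss \<nu>s\<rbrakk> \<Longrightarrow>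
      act A (op_comp P (map length xss) \<nu>s \<mu>) (concat xss) = act A \<mu> (map2 (act A) \<nu>s xss)"
    and sym: "\<And>xs \<mu> \<sigma>. \<lbrakk>xs \<in> lists G; \<mu> \<in> ops P (length xs); \<sigma> permutes {..<length xs}\<rbrakk> \<Longrightarrow>
      act A (op_sym P (length xs) \<mu> \<sigma>) (permute_list \<sigma> xs) = act A \<mu> xs"
  shows "operad_algebra R P A"
proof -
  note indct = multilinear_induct[OF module_axioms G _ refl, consumes 1, case_names gen zero add smult]
  have GA: "G \<subseteq> carrier A" using G by (auto simp: spans_def intro: mod_span.gen)
  have opm: "module R (op_mod P n)" for n by (rule op_module)
  have opc: "\<mu> \<oplus>\<^bsub>op_mod P n\<^esub> \<mu>' \<in> ops P n" "r \<odot>\<^bsub>op_mod P n\<^esub> \<mu> \<in> ops P n"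
    if "\<mu> \<in> ops P n" "\<mu>' \<in> ops P n" "r \<in> carrier R" for \<mu> \<mu>' n r
    using module.axioms(2)[OF opm[of n]] module.smult_closed[OF opm[of n]] that
    by (auto simp: abelian_group_def intro: abelian_monoid.a_closed)
  have 1: "act A (\<mu> \<oplus>\<^bsub>op_mod P (length as)\<^esub> \<mu>') as = act A \<mu> as \<oplus>\<^bsub>A\<^esub> act A \<mu>' as"
    if as: "as \<in> lists (carrier A)" and \<mu>: "\<mu> \<in> ops P (length as)" "\<mu>' \<in> ops P (length as)" for as \<mu> \<mu>'
    using as
  proof (induction rule: indct)
    case (gen xs)
    then show ?case using add[of xs \<mu> \<mu>'] \<mu> by simp
  next
    case (zero ys zs)
    then show ?case using \<mu> opc(1)[OF \<mu> R.zero_closed]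
      by (subst act_zero_mem, auto)+
  next
    case (add ys zs a b)
    then show ?case using \<mu> opc(1)[OF \<mu> R.zero_closed]
      by (simp add: act_split_add M.a_ac act_closed)
  next
    case (smult ys zs a r)
    then show ?case using \<mu> opc(1)[OF \<mu> R.zero_closed]
      by (simp add: act_split_smult act_closed smult_r_distr)
  qed
  have 2: "act A (r \<odot>\<^bsub>op_mod P (length as)\<^esub> \<mu>) as = r \<odot>\<^bsub>A\<^esub> act A \<mu> as"
    if as: "as \<in> lists (carrier A)" and \<mu>: "\<mu> \<in> ops P (length as)" and r: "r \<in> carrier R" for as \<mu> r
    using as
  proof (induction rule: indct)
    case (gen xs)
    then show ?case using smult[of xs \<mu> r] \<mu> r by simp
  next
    case (zero ys zs)
    then show ?case using \<mu> r opc(2)[OF \<mu> \<mu> r]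
      by (subst act_zero_mem, auto)+
  next
    case (add ys zs a b)
    then show ?case using \<mu> r opc(2)[OF \<mu> \<mu> r]
      by (simp add: act_split_add act_closed smult_r_distr)
  next
    case (smult ys zs a s)
    then show ?case using \<mu> r opc(2)[OF \<mu> \<mu> r]
      by (simp add: act_split_smult act_closed R.m_comm flip: smult_assoc1)
  qed
  have 3: "act A (op_unit P) [a] = a" if a: "a \<in> carrier A" for a
  proof (rule mod_hom_eq_on_span[OF module_axioms module_axioms _ _ G _ a, of _ "\<lambda>x. x"])
    show "(\<lambda>a. act A (op_unit P) [a]) \<in> mod_hom R A A"
      using act_arg_hom[of "[a]" "op_unit P" 0] a unit_closed by simp
  qed (auto simp: mod_hom_def unit)
  have 4: "act A (op_comp P (map length ass) \<nu>s \<mu>) (concat ass) = act A \<mu> (map2 (act A) \<nu>s ass)"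
    if ass: "ass \<in> lists (lists (carrier A))" and \<mu>: "\<mu> \<in> ops P (length ass)"
      and \<nu>s: "list_all2 (\<lambda>as \<nu>. \<nu> \<in> ops P (length as)) ass \<nu>s" for ass \<mu> \<nu>s
  proof -
    define E where "E ass \<longleftrightarrow> (\<mu> \<in> ops P (length ass) \<longrightarrow> list_all2 (\<lambda>as \<nu>. \<nu> \<in> ops P (length as)) ass \<nu>s \<longrightarrow>
      act A (op_comp P (map length ass) \<nu>s \<mu>) (concat ass) = act A \<mu> (map2 (act A) \<nu>s ass))" for ass
    \<comment> \<open>Finds the block that contains the varied entry \<open>z\<close> and collects
      the typing facts about the inner and the outer action around it, for all three non-generator
      cases below.\<close>
    have split: "\<exists>pre p q post \<nu>1 \<nu> \<nu>2. ass = pre @ (p @ z # q) # post \<and> ys = concat pre @ p \<and>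
        zs = q @ concat post \<and> \<nu>s = \<nu>1 @ \<nu> # \<nu>2 \<and>
        list_all2 (\<lambda>as \<nu>. \<nu> \<in> ops P (length as)) pre \<nu>1 \<and> \<nu> \<in> ops P (length p + Suc (length q)) \<and>
        list_all2 (\<lambda>as \<nu>. \<nu> \<in> ops P (length as)) post \<nu>2 \<and> 
        op_comp P (map length pre @ Suc (length p + length q) # map length post) \<nu>s \<mu> \<in>
          ops P (length ys + Suc (length zs)) \<and>
        map2 (act A) \<nu>1 pre \<in> lists (carrier A) \<and> map2 (act A) \<nu>2 post \<in> lists (carrier A) \<and>
        length (map2 (act A) \<nu>1 pre) = length pre \<and> length (map2 (act A) \<nu>2 post) = length post \<and>
        p \<in> lists (carrier A) \<and> q \<in> lists (carrier A) \<and> length \<nu>1 = length pre"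
      if h: "concat ass = ys @ z # zs" "ys \<in> lists (carrier A)" "zs \<in> lists (carrier A)"
        "\<mu> \<in> ops P (length ass)" "list_all2 (\<lambda>as \<nu>. \<nu> \<in> ops P (length as)) ass \<nu>s" for ass ys zs z
    proof -
      obtain pre p q post where *: "ass = pre @ (p @ z # q) # post" "ys = concat pre @ p"
          "zs = q @ concat post"
        using concat_eq_splitD[OF h(1)] by blast
      then obtain \<nu>1 \<nu> \<nu>2 where **: "\<nu>s = \<nu>1 @ \<nu> # \<nu>2"
        "list_all2 (\<lambda>as \<nu>. \<nu> \<in> ops P (length as)) pre \<nu>1" "\<nu> \<in> ops P (length p + Suc (length q))"
        "list_all2 (\<lambda>as \<nu>. \<nu> \<in> ops P (length as)) post \<nu>2"
        using h(5) by (auto simp: list_all2_append1 list_all2_Cons1)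
      have m: "map2 (act A) \<nu>s xss \<in> lists (carrier A)"
        if "list_all2 (\<lambda>as \<nu>. \<nu> \<in> ops P (length as)) xss \<nu>s" "xss \<in> lists (lists (carrier A))" for xss \<nu>s
        using that by induction (auto intro: act_closed)
      have pp: "pre \<in> lists (lists (carrier A))" "post \<in> lists (lists (carrier A))"
        using * h(2,3) by auto
      have len: "sum_list (map length ass) = length ys + Suc (length zs)"
        using arg_cong[OF h(1), of length] by (simp add: length_concat)
      have "op_comp P (map length ass) \<nu>s \<mu> \<in> ops P (sum_list (map length ass))"
        using h(4,5) by (intro comp_closed) (auto simp: list_all2_map1)
      then have oc: "op_comp P (map length pre @ Suc (length p + length q) # map length post) \<nu>s \<mu> \<in>
          ops P (length ys + Suc (length zs))"
        unfolding len by (simp add: *(1))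
      have pq: "p \<in> lists (carrier A)" "q \<in> lists (carrier A)" using * h(2,3) by auto
      have l: "length (map2 (act A) \<nu>1 pre) = length pre" "length (map2 (act A) \<nu>2 post) = length post"
        "length \<nu>1 = length pre"
        using list_all2_lengthD[OF **(2)] list_all2_lengthD[OF **(4)] by simp_all
      show ?thesis
        by (rule exI[of _ pre], rule exI[of _ p], rule exI[of _ q], rule exI[of _ post], rule exI[of _ \<nu>1],
            rule exI[of _ \<nu>], rule exI[of _ \<nu>2], intro conjI)
          (fact * ** oc l pq m[OF **(2) pp(1)] m[OF **(4) pp(2)])+
    qed
    have "concat ass \<in> lists (carrier A)" using ass by fastforce
    \<comment> \<open>The induction runs over the flat list of all inner arguments. That list does
      not determine its blocks, so the claim is made for every way of cutting it.\<close>
    then have "\<forall>yss. concat yss = concat ass \<longrightarrow> E yss"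
    proof (induction rule: indct)
      case (gen xs)
      then show ?case unfolding E_def by (intro allI impI comp) auto
    next
      case (zero ys zs)
      show ?case unfolding E_def
      proof (intro allI impI)
        fix ass assume ass: "concat ass = ys @ \<zero>\<^bsub>A\<^esub> # zs" "\<mu> \<in> ops P (length ass)"
          "list_all2 (\<lambda>as \<nu>. \<nu> \<in> ops P (length as)) ass \<nu>s"
        from split[OF ass(1) zero(1,2) ass(2,3)] obtain pre p q post \<nu>1 \<nu> \<nu>2 where *:
          "ass = pre @ (p @ \<zero>\<^bsub>A\<^esub> # q) # post" "ys = concat pre @ p"
          "zs = q @ concat post" "\<nu>s = \<nu>1 @ \<nu> # \<nu>2"
          "list_all2 (\<lambda>as \<nu>. \<nu> \<in> ops P (length as)) pre \<nu>1" "\<nu> \<in> ops P (length p + Suc (length q))"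
          "list_all2 (\<lambda>as \<nu>. \<nu> \<in> ops P (length as)) post \<nu>2"
          "op_comp P (map length pre @ Suc (length p + length q) # map length post) \<nu>s \<mu> \<in>
            ops P (length ys + Suc (length zs))"
          "map2 (act A) \<nu>1 pre \<in> lists (carrier A)" "map2 (act A) \<nu>2 post \<in> lists (carrier A)"
          "length (map2 (act A) \<nu>1 pre) = length pre" "length (map2 (act A) \<nu>2 post) = length post"
          "p \<in> lists (carrier A)" "q \<in> lists (carrier A)" "length \<nu>1 = length pre" by blast
        have l: "act A (op_comp P (map length ass) \<nu>s \<mu>) (concat ass) = \<zero>\<^bsub>A\<^esub>"
          unfolding ass(1) using *(1,8) zero(1-3) by (intro act_zero_mem) auto
        have z: "act A \<nu> (p @ \<zero>\<^bsub>A\<^esub> # q) = \<zero>\<^bsub>A\<^esub>"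
          using * by (intro act_zero_mem) auto
        have "act A \<mu> (map2 (act A) \<nu>1 pre @ act A \<nu> (p @ \<zero>\<^bsub>A\<^esub> # q) # map2 (act A) \<nu>2 post) = \<zero>\<^bsub>A\<^esub>"
          unfolding z using *(1,9-12) ass(2) by (intro act_zero_mem) auto
        then show "act A (op_comp P (map length ass) \<nu>s \<mu>) (concat ass) = act A \<mu> (map2 (act A) \<nu>s ass)"
          using * l by simp
      qed
    next
      case (add ys zs a b)
      show ?case unfolding E_def
      proof (intro allI impI)
        fix ass assume ass: "concat ass = ys @ (a \<oplus>\<^bsub>A\<^esub> b) # zs" "\<mu> \<in> ops P (length ass)"
          "list_all2 (\<lambda>as \<nu>. \<nu> \<in> ops P (length as)) ass \<nu>s"
        from split[OF ass(1) add(1,2) ass(2,3)] obtain pre p q post \<nu>1 \<nu> \<nu>2 where *: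
          "ass = pre @ (p @ (a \<oplus>\<^bsub>A\<^esub> b) # q) # post" "ys = concat pre @ p"
          "zs = q @ concat post" "\<nu>s = \<nu>1 @ \<nu> # \<nu>2"
          "list_all2 (\<lambda>as \<nu>. \<nu> \<in> ops P (length as)) pre \<nu>1" "\<nu> \<in> ops P (length p + Suc (length q))"
          "list_all2 (\<lambda>as \<nu>. \<nu> \<in> ops P (length as)) post \<nu>2"
          "op_comp P (map length pre @ Suc (length p + length q) # map length post) \<nu>s \<mu> \<in>
            ops P (length ys + Suc (length zs))"
          "map2 (act A) \<nu>1 pre \<in> lists (carrier A)" "map2 (act A) \<nu>2 post \<in> lists (carrier A)"
          "length (map2 (act A) \<nu>1 pre) = length pre" "length (map2 (act A) \<nu>2 post) = length post"
          "p \<in> lists (carrier A)" "q \<in> lists (carrier A)" "length \<nu>1 = length pre" by blast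
        \<comment> \<open>Exchanging the varied entry keeps all block lengths, hence the composite
          operation is the same for every summand, and the inner and the outer action can be
          expanded one after the other.\<close>
        have e: "act A (op_comp P (map length ass) \<nu>s \<mu>) (ys @ x # zs) =
           act A \<mu> (map2 (act A) \<nu>1 pre @ act A \<nu> (p @ x # q) # map2 (act A) \<nu>2 post)"
          if "\<forall>yss. concat yss = ys @ x # zs \<longrightarrow> E yss" for x
          using that[rule_format, of "pre @ (p @ x # q) # post"] * ass(2)
          by (simp add: E_def list_all2_appendI)
        note ea = e[OF add(6)] and eb = e[OF add(7)]
        have "act A (op_comp P (map length ass) \<nu>s \<mu>) (ys @ (a \<oplus>\<^bsub>A\<^esub> b) # zs) =
          act A \<mu> (map2 (act A) \<nu>1 pre @ act A \<nu> (p @ (a \<oplus>\<^bsub>A\<^esub> b) # q) # map2 (act A) \<nu>2 post)"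
          using *(1,6,8-14) ass(2) add(1-5) ea eb by (simp add: act_split_add act_closed)
        then show "act A (op_comp P (map length ass) \<nu>s \<mu>) (concat ass) = act A \<mu> (map2 (act A) \<nu>s ass)"
          using * by simp
      qed
    next
      case (smult ys zs a r)
      show ?case unfolding E_def
      proof (intro allI impI)
        fix ass assume ass: "concat ass = ys @ (r \<odot>\<^bsub>A\<^esub> a) # zs" "\<mu> \<in> ops P (length ass)"
          "list_all2 (\<lambda>as \<nu>. \<nu> \<in> ops P (length as)) ass \<nu>s"
        from split[OF ass(1) smult(1,2) ass(2,3)] obtain pre p q post \<nu>1 \<nu> \<nu>2 where *:
          "ass = pre @ (p @ (r \<odot>\<^bsub>A\<^esub> a) # q) # post" "ys = concat pre @ p"
          "zs = q @ concat post" "\<nu>s = \<nu>1 @ \<nu> # \<nu>2"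
          "list_all2 (\<lambda>as \<nu>. \<nu> \<in> ops P (length as)) pre \<nu>1" "\<nu> \<in> ops P (length p + Suc (length q))"
          "list_all2 (\<lambda>as \<nu>. \<nu> \<in> ops P (length as)) post \<nu>2"
          "op_comp P (map length pre @ Suc (length p + length q) # map length post) \<nu>s \<mu> \<in>
            ops P (length ys + Suc (length zs))"
          "map2 (act A) \<nu>1 pre \<in> lists (carrier A)" "map2 (act A) \<nu>2 post \<in> lists (carrier A)"
          "length (map2 (act A) \<nu>1 pre) = length pre" "length (map2 (act A) \<nu>2 post) = length post"
          "p \<in> lists (carrier A)" "q \<in> lists (carrier A)" "length \<nu>1 = length pre" by blast
        have e: "act A (op_comp P (map length ass) \<nu>s \<mu>) (ys @ a # zs) =
           act A \<mu> (map2 (act A) \<nu>1 pre @ act A \<nu> (p @ a # q) # map2 (act A) \<nu>2 post)"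
          using smult(6)[rule_format, of "pre @ (p @ a # q) # post"] * ass(2)
          by (simp add: E_def list_all2_appendI)
        have "act A (op_comp P (map length ass) \<nu>s \<mu>) (ys @ (r \<odot>\<^bsub>A\<^esub> a) # zs) =
          act A \<mu> (map2 (act A) \<nu>1 pre @ act A \<nu> (p @ (r \<odot>\<^bsub>A\<^esub> a) # q) # map2 (act A) \<nu>2 post)"
          using *(1,6,8-14) ass(2) smult(1-5) e by (simp add: act_split_smult act_closed)
        then show "act A (op_comp P (map length ass) \<nu>s \<mu>) (concat ass) = act A \<mu> (map2 (act A) \<nu>s ass)"
          using * by simp
      qed
    qed
    then show ?thesis using \<mu> \<nu>s by (simp add: E_def)
  qed
  have 5: "act A (op_sym P (length as) \<mu> \<sigma>) (permute_list \<sigma> as) = act A \<mu> as"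
    if as: "as \<in> lists (carrier A)" and \<mu>: "\<mu> \<in> ops P (length as)"
      and \<sigma>: "\<sigma> permutes {..<length as}" for as \<mu> \<sigma>
  proof -
    have cl: "permute_list \<sigma> (ys @ \<zero>\<^bsub>A\<^esub> # zs) \<in> lists (carrier A)"
      if "length ys + Suc (length zs) = length as" "ys \<in> lists (carrier A)" "zs \<in> lists (carrier A)" for ys zs
      using that set_permute_list[of \<sigma> "ys @ \<zero>\<^bsub>A\<^esub> # zs"] \<sigma> by (auto simp: in_lists_conv_set)
    \<comment> \<open>After the permutation the varied entry appears only at the place
      \<open>i\<close> with \<open>\<sigma> i = length ys\<close>. The list \<open>ws\<close> is the
      permuted list with a zero as filler at that place.\<close>
    have perm: "\<exists>i ws. i < length as \<and> length ws = length as \<and> ws \<in> lists (carrier A) \<and>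
        (\<forall>x. permute_list \<sigma> (ys @ x # zs) = ws[i := x])"
      if "length ys + Suc (length zs) = length as" "ys \<in> lists (carrier A)" "zs \<in> lists (carrier A)" for ys zs
    proof -
      have "length ys \<in> {..<length as}" using that by simp
      then obtain i where i: "\<sigma> i = length ys" "i < length as"
        using permutes_image[OF \<sigma>] by (metis image_iff lessThan_iff)
      have "permute_list \<sigma> ((ys @ \<zero>\<^bsub>A\<^esub> # zs)[\<sigma> i := x]) = (permute_list \<sigma> (ys @ \<zero>\<^bsub>A\<^esub> # zs))[i := x]" for x
        using \<sigma> i that by (intro list_update_permute) auto
      then have e: "permute_list \<sigma> (ys @ x # zs) = (permute_list \<sigma> (ys @ \<zero>\<^bsub>A\<^esub> # zs))[i := x]" for x
        unfolding i(1) list_update_length .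
      have "length (permute_list \<sigma> (ys @ \<zero>\<^bsub>A\<^esub> # zs)) = length as" using that(1) by simp
      with i(2) cl[OF that] e show ?thesis by blast
    qed
    have \<mu>\<sigma>: "op_sym P (length as) \<mu> \<sigma> \<in> ops P (length as)" by (rule sym_closed) fact+
    show ?thesis using as
    proof (induction rule: indct)
      case (gen xs)
      then show ?case using sym[of xs \<mu> \<sigma>] \<mu> \<sigma> by simp
    next
      case (zero ys zs)
      have "\<zero>\<^bsub>A\<^esub> \<in> set (permute_list \<sigma> (ys @ \<zero>\<^bsub>A\<^esub> # zs))"
        using set_permute_list[of \<sigma> "ys @ \<zero>\<^bsub>A\<^esub> # zs"] \<sigma> zero(3) by simp
      then have "act A (op_sym P (length as) \<mu> \<sigma>) (permute_list \<sigma> (ys @ \<zero>\<^bsub>A\<^esub> # zs)) = \<zero>\<^bsub>A\<^esub>"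
        using cl[OF zero(3,1,2)] \<mu>\<sigma> zero(3) by (intro act_zero_mem) simp_all
      moreover have "act A \<mu> (ys @ \<zero>\<^bsub>A\<^esub> # zs) = \<zero>\<^bsub>A\<^esub>"
        using \<mu> zero by (intro act_zero_mem) simp_all
      ultimately show ?case using zero(3) by simp
    next
      case (add ys zs a b)
      obtain i ws where i: "i < length as" "length ws = length as" "ws \<in> lists (carrier A)"
          "\<And>x. permute_list \<sigma> (ys @ x # zs) = ws[i := x]"
        using perm[OF add(3,1,2)] by blast
      show ?case using add \<mu> \<mu>\<sigma> i by (simp add: act_args_add act_split_add)
    next
      case (smult ys zs a r)
      obtain i ws where i: "i < length as" "length ws = length as" "ws \<in> lists (carrier A)"
          "\<And>x. permute_list \<sigma> (ys @ x # zs) = ws[i := x]"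
        using perm[OF smult(3,1,2)] by blast
      show ?case using smult \<mu> \<mu>\<sigma> i by (simp add: act_args_smult act_split_smult)
    qed
  qed
  show ?thesis
    by (intro operad_algebra.intro operad_axioms module_axioms operad_algebra_axioms.intro)
      (fact 1 2 3 4 5 act_closed act_args_add act_args_smult)+
qed

section \<open>Homomorphisms and quotients\<close>

lemma (in module) minus_eq_zero_iff:
  "x \<in> carrier M \<Longrightarrow> y \<in> carrier M \<Longrightarrow> x \<ominus>\<^bsub>M\<^esub> y = \<zero>\<^bsub>M\<^esub> \<longleftrightarrow> x = y"
  using M.minus_equality[of x "\<ominus>\<^bsub>M\<^esub> y"] by (auto simp: M.minus_eq M.r_neg)

text \<open>Members of \<open>alg_hom\<close> are undefined off the carrier, hence the
  \<open>restrict\<close>. In return, morphisms that agree on the carrier are equal, on which the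
  definite descriptions and the uniqueness in the pushout rely.\<close>

lemma alg_homI:
  assumes "f \<in> mod_hom R A B"
    and "\<And>xs \<mu>. xs \<in> lists (carrier A) \<Longrightarrow> \<mu> \<in> ops P (length xs) \<Longrightarrow> f (act A \<mu> xs) = act B \<mu> (map f xs)"
    and "module R A" "\<And>xs \<mu>. xs \<in> lists (carrier A) \<Longrightarrow> \<mu> \<in> ops P (length xs) \<Longrightarrow> act A \<mu> xs \<in> carrier A"
  shows "restrict f (carrier A) \<in> alg_hom R P A B"
proof -
  interpret module R A by fact
  show ?thesis
    unfolding alg_hom_def using mod_homD[OF assms(1)] assms(2,4)
    by (auto intro!: arg_cong[where f="act B _"])
qed

lemma alg_hom_mod_hom: "f \<in> alg_hom R P A B \<Longrightarrow> f \<in> mod_hom R A B"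
  by (auto simp: alg_hom_def mod_hom_def)

lemma alg_hom_closed: "f \<in> alg_hom R P A B \<Longrightarrow> x \<in> carrier A \<Longrightarrow> f x \<in> carrier B"
  by (auto simp: alg_hom_def)

lemma alg_hom_act:
  "f \<in> alg_hom R P A B \<Longrightarrow> xs \<in> lists (carrier A) \<Longrightarrow> \<mu> \<in> ops P (length xs) \<Longrightarrow>
    f (act A \<mu> xs) = act B \<mu> (map f xs)"
  unfolding alg_hom_def by blast

lemma alg_hom_eqI:
  assumes "f \<in> alg_hom R P A B" "g \<in> alg_hom R P A B" "\<And>x. x \<in> carrier A \<Longrightarrow> f x = g x"
  shows "f = g"
  using assms by (auto simp: alg_hom_def intro: PiE_ext)

lemma alg_hom_compose:
  assumes f: "f \<in> alg_hom R P A B" and g: "g \<in> alg_hom R P B C" and A: "multilinear_act R P A"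
  shows "compose (carrier A) g f \<in> alg_hom R P A C"
proof -
  interpret A: multilinear_act R P A by fact
  have "restrict (\<lambda>x. g (f x)) (carrier A) \<in> alg_hom R P A C"
  proof (rule alg_homI)
    show "(\<lambda>x. g (f x)) \<in> mod_hom R A C"
      using mod_homD[OF alg_hom_mod_hom[OF f]] mod_homD[OF alg_hom_mod_hom[OF g]]
      by (intro mod_homI) simp_all
    fix xs \<mu> assume xs: "xs \<in> lists (carrier A)" "\<mu> \<in> ops P (length xs)"
    then have "map f xs \<in> lists (carrier B)" using alg_hom_closed[OF f] by auto
    then show "g (f (act A \<mu> xs)) = act C \<mu> (map (\<lambda>x. g (f x)) xs)"
      using alg_hom_act[OF f xs] alg_hom_act[OF g, of "map f xs" \<mu>] xs by (simp add: comp_def)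
  qed (use A.module_axioms A.act_closed in auto)
  then show ?thesis by (simp add: compose_def)
qed

lemma compose_apply [simp]: "x \<in> A \<Longrightarrow> compose A g f x = g (f x)"
  by (rule compose_eq)

lemma id_alg_hom:
  assumes "multilinear_act R P A"
  shows "restrict (\<lambda>x. x) (carrier A) \<in> alg_hom R P A A"
proof -
  interpret A: multilinear_act R P A by fact
  show ?thesis by (rule alg_homI) (use A.module_axioms A.act_closed in \<open>auto simp: mod_hom_def\<close>)
qed

lemma in_listset_iff: "ys \<in> listset Xs \<longleftrightarrow> list_all2 (\<in>) ys Xs"
  by (induction Xs arbitrary: ys) (auto simp: set_Cons_def list_all2_Cons2)

lemma lists_image_ex: "xs \<in> lists (f ` S) \<Longrightarrow> \<exists>ys\<in>lists S. xs = map f ys"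
  by (metis image_iff lists_image)

section \<open>Ideals and the action on quotients\<close>

lemma alg_idealD:
  assumes "alg_ideal R P A I"
  shows "submodule I R A"
    and "xs \<in> lists (carrier A) \<Longrightarrow> \<mu> \<in> ops P (length xs) \<Longrightarrow> x \<in> set xs \<Longrightarrow> x \<in> I \<Longrightarrow> act A \<mu> xs \<in> I"
  using assms unfolding alg_ideal_def by blast+

lemma quot_alg_simps [simp]:
  "carrier (quot_alg A I) = (\<lambda>x. I +>\<^bsub>A\<^esub> x) ` carrier A"
  "zero (quot_alg A I) = I"
  "add (quot_alg A I) = set_add A"
  by (auto simp: quot_alg_def A_RCOSETS_def')

context multilinear_act
begin

text \<open>Representatives are exchanged one at a time, with \<open>zs\<close> as the part already
  exchanged. By linearity the two values differ by the value at the difference of \<open>x\<close>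
  and \<open>y\<close>; that argument lies in the ideal, and ideals absorb the action.\<close>

lemma act_coset_cong:
  assumes I: "alg_ideal R P A I"
    and "list_all2 (\<lambda>x y. x \<in> carrier A \<and> y \<in> carrier A \<and> I +>\<^bsub>A\<^esub> x = I +>\<^bsub>A\<^esub> y) xs ys"
    and "zs \<in> lists (carrier A)" "\<mu> \<in> ops P (length zs + length xs)"
  shows "I +>\<^bsub>A\<^esub> act A \<mu> (zs @ xs) = I +>\<^bsub>A\<^esub> act A \<mu> (zs @ ys)"
  using assms(2-)
proof (induction arbitrary: zs rule: list_all2_induct)
  case Nil
  then show ?case by simp
next
  case (Cons x xs y ys)
  note sub = alg_idealD(1)[OF I]
  have xs: "xs \<in> lists (carrier A)" "length ys = length xs"
    using Cons.hyps(2) by (auto simp: list_all2_conv_all_nth in_set_conv_nth)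
  have as: "zs @ x # xs \<in> lists (carrier A)" "\<mu> \<in> ops P (length (zs @ x # xs))" "length zs < length (zs @ x # xs)"
    using Cons xs by auto
  note h = act_arg_hom[OF as, simplified]
  have "x \<ominus>\<^bsub>A\<^esub> y \<in> I" using Cons.hyps(1) coset_eq_iff[OF sub] by blast
  moreover have c: "x \<ominus>\<^bsub>A\<^esub> y \<in> carrier A" using Cons.hyps(1) by simp
  ultimately have "act A \<mu> (zs @ (x \<ominus>\<^bsub>A\<^esub> y) # xs) \<in> I"
    using alg_idealD(2)[OF I, of "zs @ (x \<ominus>\<^bsub>A\<^esub> y) # xs" \<mu> "x \<ominus>\<^bsub>A\<^esub> y"] as by simp
  then have "act A \<mu> (zs @ x # xs) \<ominus>\<^bsub>A\<^esub> act A \<mu> (zs @ y # xs) \<in> I"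
    using mod_hom_minus[OF module_axioms module_axioms h, of x y] Cons.hyps(1) by simp
  then have "I +>\<^bsub>A\<^esub> act A \<mu> (zs @ x # xs) = I +>\<^bsub>A\<^esub> act A \<mu> (zs @ y # xs)"
    using mod_homD(1)[OF h, of x] mod_homD(1)[OF h, of y] Cons.hyps(1) coset_eq_iff[OF sub] by simp
  also have "\<dots> = I +>\<^bsub>A\<^esub> act A \<mu> (zs @ y # ys)"
    using Cons.IH[of "zs @ [y]"] Cons.hyps(1) Cons.prems by simp
  finally show ?case .
qed

text \<open>By the preceding congruence all choices of representatives lead to the same coset, so
  the union that defines the action on the quotient is this coset.\<close>

lemma quot_act:
  assumes I: "alg_ideal R P A I" and xs: "xs \<in> lists (carrier A)" "\<mu> \<in> ops P (length xs)"
  shows "act (quot_alg A I) \<mu> (map (\<lambda>x. I +>\<^bsub>A\<^esub> x) xs) = I +>\<^bsub>A\<^esub> act A \<mu> xs"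
proof -
  note sub = alg_idealD(1)[OF I]
  have "I +>\<^bsub>A\<^esub> act A \<mu> ys = I +>\<^bsub>A\<^esub> act A \<mu> xs" if "ys \<in> listset (map (\<lambda>x. I +>\<^bsub>A\<^esub> x) xs)" for ys
  proof -
    have "list_all2 (\<lambda>x y. x \<in> carrier A \<and> y \<in> carrier A \<and> I +>\<^bsub>A\<^esub> x = I +>\<^bsub>A\<^esub> y) xs ys"
    proof (rule list_all2_all_nthI)
      show "length xs = length ys" using that by (simp add: in_listset_iff list_all2_lengthD)
      fix i assume i: "i < length xs"
      then have "xs ! i \<in> carrier A" "ys ! i \<in> I +>\<^bsub>A\<^esub> (xs ! i)"
        using that xs(1) by (auto simp: in_listset_iff in_lists_conv_set list_all2_conv_all_nth)
      then show "xs ! i \<in> carrier A \<and> ys ! i \<in> carrier A \<and> I +>\<^bsub>A\<^esub> xs ! i = I +>\<^bsub>A\<^esub> ys ! i"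
        using coset_memD[OF sub, of "xs ! i" "ys ! i"] by simp
    qed
    from act_coset_cong[OF I this, of "[]"] show ?thesis using xs by simp
  qed
  moreover have "xs \<in> listset (map (\<lambda>x. I +>\<^bsub>A\<^esub> x) xs)"
    using xs(1) coset_mem_self[OF sub]
    by (auto simp: in_listset_iff list_all2_conv_all_nth in_lists_conv_set)
  ultimately have "(\<Union>ys\<in>listset (map (\<lambda>x. I +>\<^bsub>A\<^esub> x) xs). I +>\<^bsub>A\<^esub> act A \<mu> ys) = I +>\<^bsub>A\<^esub> act A \<mu> xs"
    by blast
  then show ?thesis by (simp add: quot_alg_def)
qed

lemma quot_add:
  assumes "submodule I R A" "x \<in> carrier A" "y \<in> carrier A"
  shows "(I +>\<^bsub>A\<^esub> x) \<oplus>\<^bsub>quot_alg A I\<^esub> (I +>\<^bsub>A\<^esub> y) = I +>\<^bsub>A\<^esub> (x \<oplus>\<^bsub>A\<^esub> y)"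
  using coset_add[OF assms] by simp

lemma quot_smult:
  assumes "submodule I R A" "x \<in> carrier A" "r \<in> carrier R"
  shows "r \<odot>\<^bsub>quot_alg A I\<^esub> (I +>\<^bsub>A\<^esub> x) = I +>\<^bsub>A\<^esub> (r \<odot>\<^bsub>A\<^esub> x)"
  using coset_smult[OF assms] by (simp add: quot_alg_def)

lemma quot_zero: "submodule I R A \<Longrightarrow> \<zero>\<^bsub>quot_alg A I\<^esub> = I +>\<^bsub>A\<^esub> \<zero>\<^bsub>A\<^esub>"
  using coset_eq_zero_iff[of I "\<zero>\<^bsub>A\<^esub>"] submodule_mem(2) by simp

lemma quot_module: "submodule I R A \<Longrightarrow> module R (quot_alg A I)"
  by (rule module_surj_image[OF module_axioms])
    (simp_all only: quot_zero quot_alg_simps(1), (rule quot_add quot_smult; assumption)+)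

lemma quot_proj_hom: "submodule I R A \<Longrightarrow> (\<lambda>x. I +>\<^bsub>A\<^esub> x) \<in> mod_hom R A (quot_alg A I)"
  by (rule mod_homI) (simp only: quot_alg_simps(1) imageI, (rule quot_add[symmetric] quot_smult[symmetric]; assumption)+)

lemma quot_multilinear_act:
  assumes I: "alg_ideal R P A I"
  shows "multilinear_act R P (quot_alg A I)"
proof -
  note sub = alg_idealD(1)[OF I]
  let ?Q = "quot_alg A I" and ?\<pi> = "\<lambda>x. I +>\<^bsub>A\<^esub> x"
  have l: "\<exists>ys\<in>lists (carrier A). xs = map ?\<pi> ys" if "xs \<in> lists (carrier ?Q)" for xs
    using lists_image_ex that by simp
  have upd: "xs[i := x] \<in> lists (carrier A)" if "xs \<in> lists (carrier A)" "x \<in> carrier A" for xs i x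
    using that set_update_subset_insert[of xs i x] by auto
  show ?thesis
  proof (intro multilinear_act.intro quot_module sub operad_axioms multilinear_act_axioms.intro)
    fix as \<mu> assume as: "as \<in> lists (carrier ?Q)" "\<mu> \<in> ops P (length as)"
    then obtain xs where xs: "xs \<in> lists (carrier A)" "as = map ?\<pi> xs" using l by blast
    then show "act ?Q \<mu> as \<in> carrier ?Q" using as(2) quot_act[OF I xs(1)] act_closed by simp
    fix i assume i: "i < length as"
    { fix a b assume "a \<in> carrier ?Q" "b \<in> carrier ?Q"
      then obtain x y where xy: "x \<in> carrier A" "y \<in> carrier A" "a = ?\<pi> x" "b = ?\<pi> y" by auto
      have "act ?Q \<mu> (as[i := a \<oplus>\<^bsub>?Q\<^esub> b]) = act ?Q \<mu> (map ?\<pi> (xs[i := x \<oplus>\<^bsub>A\<^esub> y]))"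
        using xs(2) xy quot_add[OF sub xy(1,2)] by (simp only: map_update)
      also have "\<dots> = ?\<pi> (act A \<mu> (xs[i := x \<oplus>\<^bsub>A\<^esub> y]))"
        using xs as(2) xy by (intro quot_act[OF I] upd) auto
      also have "\<dots> = ?\<pi> (act A \<mu> (xs[i := x]) \<oplus>\<^bsub>A\<^esub> act A \<mu> (xs[i := y]))"
        using xs as(2) xy i by (subst act_args_add) auto
      also have "\<dots> = ?\<pi> (act A \<mu> (xs[i := x])) \<oplus>\<^bsub>?Q\<^esub> ?\<pi> (act A \<mu> (xs[i := y]))"
        using xs as(2) xy by (intro quot_add[OF sub, symmetric] act_closed upd) auto
      also have "\<dots> = act ?Q \<mu> (map ?\<pi> (xs[i := x])) \<oplus>\<^bsub>?Q\<^esub> act ?Q \<mu> (map ?\<pi> (xs[i := y]))"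
        using xs as(2) xy by (intro arg_cong2[where f="add ?Q"] quot_act[OF I, symmetric] upd) auto
      finally show "act ?Q \<mu> (as[i := a \<oplus>\<^bsub>?Q\<^esub> b]) = act ?Q \<mu> (as[i := a]) \<oplus>\<^bsub>?Q\<^esub> act ?Q \<mu> (as[i := b])"
        using xs(2) xy by (simp only: map_update)
    }
    { fix a r assume "a \<in> carrier ?Q" and r: "r \<in> carrier R"
      then obtain x where xy: "x \<in> carrier A" "a = ?\<pi> x" by auto
      have "act ?Q \<mu> (as[i := r \<odot>\<^bsub>?Q\<^esub> a]) = act ?Q \<mu> (map ?\<pi> (xs[i := r \<odot>\<^bsub>A\<^esub> x]))"
        using xs(2) xy quot_smult[OF sub xy(1) r] by (simp only: map_update)
      also have "\<dots> = ?\<pi> (act A \<mu> (xs[i := r \<odot>\<^bsub>A\<^esub> x]))"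
        using xs as(2) xy r by (intro quot_act[OF I] upd) auto
      also have "\<dots> = ?\<pi> (r \<odot>\<^bsub>A\<^esub> act A \<mu> (xs[i := x]))"
        using xs as(2) xy i r by (subst act_args_smult) auto
      also have "\<dots> = r \<odot>\<^bsub>?Q\<^esub> ?\<pi> (act A \<mu> (xs[i := x]))"
        using xs as(2) xy r by (intro quot_smult[OF sub, symmetric] act_closed upd) auto
      also have "\<dots> = r \<odot>\<^bsub>?Q\<^esub> act ?Q \<mu> (map ?\<pi> (xs[i := x]))"
        using xs as(2) xy by (intro arg_cong2[where f="smult ?Q"] quot_act[OF I, symmetric] upd refl) auto
      finally show "act ?Q \<mu> (as[i := r \<odot>\<^bsub>?Q\<^esub> a]) = r \<odot>\<^bsub>?Q\<^esub> act ?Q \<mu> (as[i := a])"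
        using xs(2) xy by (simp only: map_update)
    }
  qed
qed

lemma quot_lift:
  assumes I: "alg_ideal R P A I" and E: "multilinear_act R P E" and F: "F \<in> mod_hom R A E"
    and act: "\<And>xs \<mu>. xs \<in> lists (carrier A) \<Longrightarrow> \<mu> \<in> ops P (length xs) \<Longrightarrow> F (act A \<mu> xs) = act E \<mu> (map F xs)"
    and null: "\<And>x. x \<in> I \<Longrightarrow> F x = \<zero>\<^bsub>E\<^esub>"
  shows "\<exists>G\<in>alg_hom R P (quot_alg A I) E. \<forall>x\<in>carrier A. G (I +>\<^bsub>A\<^esub> x) = F x"
proof -
  interpret E: multilinear_act R P E by fact
  note sub = alg_idealD(1)[OF I]
  let ?Q = "quot_alg A I" and ?\<pi> = "\<lambda>x. I +>\<^bsub>A\<^esub> x"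
  interpret Q: multilinear_act R P ?Q by (rule quot_multilinear_act) fact
  \<comment> \<open>A member of the quotient is a set, so the induced map evaluates \<open>F\<close>
    at a chosen element of it. The choice is immaterial because \<open>F\<close> vanishes on
    \<open>I\<close>.\<close>
  define G where "G X = F (SOME x. x \<in> X)" for X
  have G: "G (?\<pi> x) = F x" if x: "x \<in> carrier A" for x
  proof -
    define y where "y = (SOME y. y \<in> ?\<pi> x)"
    have "y \<in> ?\<pi> x" unfolding y_def using coset_mem_self[OF sub x] by (rule someI)
    note y = coset_memD[OF sub x this]
    have "F (y \<ominus>\<^bsub>A\<^esub> x) = \<zero>\<^bsub>E\<^esub>" using y coset_eq_iff[OF sub y(1) x] null by simp
    then have "F y \<ominus>\<^bsub>E\<^esub> F x = \<zero>\<^bsub>E\<^esub>"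
      using mod_hom_minus[OF module_axioms E.module_axioms F y(1) x] by simp
    then have "F y = F x" using mod_homD(1)[OF F] x y(1) E.minus_eq_zero_iff by simp
    then show ?thesis by (simp add: G_def y_def)
  qed
  have "restrict G (carrier ?Q) \<in> alg_hom R P ?Q E"
  proof (rule alg_homI)
    show "G \<in> mod_hom R ?Q E"
    proof (rule mod_homI)
      fix X Y r assume "X \<in> carrier ?Q" "Y \<in> carrier ?Q"
      then obtain x y where xy: "x \<in> carrier A" "y \<in> carrier A" "X = ?\<pi> x" "Y = ?\<pi> y" by auto
      then show "G (X \<oplus>\<^bsub>?Q\<^esub> Y) = G X \<oplus>\<^bsub>E\<^esub> G Y"
        using G mod_homD[OF F] quot_add[OF sub xy(1,2)] by (simp del: quot_alg_simps(3))
    next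
      fix X r assume r: "r \<in> carrier R" "X \<in> carrier ?Q"
      then obtain x where xy: "x \<in> carrier A" "X = ?\<pi> x" by auto
      then show "G (r \<odot>\<^bsub>?Q\<^esub> X) = r \<odot>\<^bsub>E\<^esub> G X"
        using G mod_homD[OF F] quot_smult[OF sub xy(1) r(1)] r by simp
    qed (use G mod_homD[OF F] in auto)
    fix Xs \<mu> assume "Xs \<in> lists (carrier ?Q)" "\<mu> \<in> ops P (length Xs)"
    moreover then obtain xs where xs: "xs \<in> lists (carrier A)" "Xs = map ?\<pi> xs"
      using lists_image_ex[of Xs ?\<pi> "carrier A"] unfolding quot_alg_simps(1) by blast
    moreover have m: "map G Xs = map F xs" using xs G by auto
    ultimately show "G (act ?Q \<mu> Xs) = act E \<mu> (map G Xs)"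
      unfolding m using G act quot_act[OF I xs(1)] act_closed by simp
  qed (use Q.act_closed Q.module_axioms in auto)
  then show ?thesis using G by (intro bexI[of _ "restrict G (carrier ?Q)"]) auto
qed

text \<open>One zero argument makes a multilinear action vanish, so the kernel absorbs every action
  with one argument in it.\<close>

lemma hom_kernel_ideal:
  assumes E: "multilinear_act R P E" and F: "F \<in> alg_hom R P A E"
  shows "alg_ideal R P A {x \<in> carrier A. F x = \<zero>\<^bsub>E\<^esub>}"
proof -
  interpret E: multilinear_act R P E by fact
  have "act E \<mu> (map F xs) = \<zero>\<^bsub>E\<^esub>"
    if "xs \<in> lists (carrier A)" "\<mu> \<in> ops P (length xs)" "x \<in> set xs" "F x = \<zero>\<^bsub>E\<^esub>" for x xs \<mu>
  proof (rule E.act_zero_mem)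
    show "\<zero>\<^bsub>E\<^esub> \<in> set (map F xs)" using that by (metis image_eqI set_map)
  qed (use that alg_hom_closed[OF F] in auto)
  then show ?thesis
    unfolding alg_ideal_def
    using mod_hom_kernel_submodule[OF module_axioms E.module_axioms alg_hom_mod_hom[OF F]]
      alg_hom_act[OF F] act_closed by auto
qed

lemma gen_ideal_ideal:
  assumes "\<And>x y. (x, y) \<in> E \<Longrightarrow> x \<in> carrier A \<and> y \<in> carrier A"
  shows "alg_ideal R P A (gen_ideal R P A E)"
proof -
  have c: "alg_ideal R P A (carrier A) \<and> (\<forall>(x, y)\<in>E. x \<ominus>\<^bsub>A\<^esub> y \<in> carrier A)"
    using assms carrier_is_submodule act_closed by (auto simp: alg_ideal_def)
  then have sub: "gen_ideal R P A E \<subseteq> carrier A"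
    unfolding gen_ideal_def by (intro Inter_lower) simp
  have s: "submodule I R A" if "alg_ideal R P A I" for I using that by (simp add: alg_ideal_def)
  have "submodule (gen_ideal R P A E) R A"
    using sub by (intro submoduleI) (auto simp: gen_ideal_def submodule_mem(2-5)[OF s])
  moreover have "act A \<mu> xs \<in> gen_ideal R P A E"
    if "xs \<in> lists (carrier A)" "\<mu> \<in> ops P (length xs)" "x \<in> set xs" "x \<in> gen_ideal R P A E" for xs \<mu> x
    unfolding gen_ideal_def
  proof (rule InterI)
    fix I assume I: "I \<in> {I. alg_ideal R P A I \<and> (\<forall>(x, y)\<in>E. x \<ominus>\<^bsub>A\<^esub> y \<in> I)}"
    then have "alg_ideal R P A I" by simp
    moreover have "x \<in> I" using that(4) I unfolding gen_ideal_def by (rule InterD)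
    ultimately show "act A \<mu> xs \<in> I" using that(1-3) alg_idealD(2)[of R P A I xs \<mu> x] by simp
  qed
  ultimately show ?thesis unfolding alg_ideal_def by blast
qed

end

lemma gen_ideal_gen: "(x, y) \<in> E \<Longrightarrow> x \<ominus>\<^bsub>A\<^esub> y \<in> gen_ideal R P A E"
  unfolding gen_ideal_def by blast

lemma gen_ideal_least:
  assumes "alg_ideal R P A I" "\<And>x y. (x, y) \<in> E \<Longrightarrow> x \<ominus>\<^bsub>A\<^esub> y \<in> I"
  shows "gen_ideal R P A E \<subseteq> I"
  using assms unfolding gen_ideal_def by blast

lemma quot_operad_algebra:
  assumes A: "operad_algebra R P A" and I: "alg_ideal R P A I"
  shows "operad_algebra R P (quot_alg A I)"
proof -
  interpret A: operad_algebra R P A by fact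
  interpret M: multilinear_act R P A by (rule operad_algebra_imp_multilinear) fact
  let ?Q = "quot_alg A I" and ?\<pi> = "\<lambda>x. I +>\<^bsub>A\<^esub> x"
  interpret Q: multilinear_act R P ?Q by (rule M.quot_multilinear_act) fact
  note sub = alg_idealD(1)[OF I]
  note q = M.quot_act[OF I]
  have l: "\<exists>ys\<in>lists (carrier A). xs = map ?\<pi> ys" if "xs \<in> lists (carrier ?Q)" for xs
    using lists_image_ex that by simp
  show ?thesis
  \<comment> \<open>The spanning set is the whole carrier: lists of cosets are lifted to lists of
    representatives, where the laws of \<open>A\<close> apply.\<close>
  proof (rule Q.operad_algebraI[OF spans_carrier[OF Q.module_axioms]])
    fix Xs \<mu> \<mu>' assume X: "Xs \<in> lists (carrier ?Q)" "\<mu> \<in> ops P (length Xs)" "\<mu>' \<in> ops P (length Xs)"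
    then obtain xs where xs: "xs \<in> lists (carrier A)" "Xs = map ?\<pi> xs" using l by blast
    have \<mu>: "\<mu> \<in> ops P (length xs)" "\<mu>' \<in> ops P (length xs)" using X xs by auto
    then have "\<mu> \<oplus>\<^bsub>op_mod P (length xs)\<^esub> \<mu>' \<in> ops P (length xs)"
      using module.axioms(2)[OF A.op_module[of "length xs"]]
      by (auto simp: abelian_group_def intro: abelian_monoid.a_closed)
    then have "act ?Q (\<mu> \<oplus>\<^bsub>op_mod P (length xs)\<^esub> \<mu>') (map ?\<pi> xs) = ?\<pi> (act A \<mu> xs \<oplus>\<^bsub>A\<^esub> act A \<mu>' xs)"
      using q[OF xs(1)] A.act_add[OF xs(1) \<mu>] by simp
    then show "act ?Q (\<mu> \<oplus>\<^bsub>op_mod P (length Xs)\<^esub> \<mu>') Xs = act ?Q \<mu> Xs \<oplus>\<^bsub>?Q\<^esub> act ?Q \<mu>' Xs"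
      using M.quot_add[OF sub A.act_closed[OF xs(1) \<mu>(1)] A.act_closed[OF xs(1) \<mu>(2)]]
        q[OF xs(1) \<mu>(1)] q[OF xs(1) \<mu>(2)] xs(2) by simp
  next
    fix Xs \<mu> r assume X: "Xs \<in> lists (carrier ?Q)" "\<mu> \<in> ops P (length Xs)" "r \<in> carrier R"
    then obtain xs where xs: "xs \<in> lists (carrier A)" "Xs = map ?\<pi> xs" using l by blast
    have \<mu>: "\<mu> \<in> ops P (length xs)" using X xs by auto
    then have "r \<odot>\<^bsub>op_mod P (length xs)\<^esub> \<mu> \<in> ops P (length xs)"
      using module.smult_closed[OF A.op_module[of "length xs"]] X(3) by auto
    then have "act ?Q (r \<odot>\<^bsub>op_mod P (length xs)\<^esub> \<mu>) (map ?\<pi> xs) = ?\<pi> (r \<odot>\<^bsub>A\<^esub> act A \<mu> xs)"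
      using q[OF xs(1)] A.act_smult[OF xs(1) \<mu> X(3)] by simp
    then show "act ?Q (r \<odot>\<^bsub>op_mod P (length Xs)\<^esub> \<mu>) Xs = r \<odot>\<^bsub>?Q\<^esub> act ?Q \<mu> Xs"
      using M.quot_smult[OF sub A.act_closed[OF xs(1) \<mu>(1)] X(3)] q[OF xs(1) \<mu>(1)] xs(2) by simp
  next
    fix X assume "X \<in> carrier ?Q"
    then obtain x where x: "x \<in> carrier A" "X = ?\<pi> x" by auto
    then show "act ?Q (op_unit P) [X] = X"
      using q[of "[x]" "op_unit P"] A.act_unit[OF x(1)] A.unit_closed by simp
  next
    fix Xss \<mu> \<nu>s assume X: "Xss \<in> lists (lists (carrier ?Q))" "\<mu> \<in> ops P (length Xss)"
        "list_all2 (\<lambda>xs \<nu>. \<nu> \<in> ops P (length xs)) Xss \<nu>s"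
    have "Xss \<in> lists ((\<lambda>xs. map ?\<pi> xs) ` lists (carrier A))" using X(1) l by fastforce
    from lists_image_ex[OF this] obtain xss where
      xss: "xss \<in> lists (lists (carrier A))" "Xss = map (map ?\<pi>) xss" by blast
    have \<nu>s: "list_all2 (\<lambda>xs \<nu>. \<nu> \<in> ops P (length xs)) xss \<nu>s"
      using X(3) xss(2) by (simp add: list_all2_map1)
    have m: "map2 (act ?Q) \<nu>s (map (map ?\<pi>) xss) = map ?\<pi> (map2 (act A) \<nu>s xss) \<and> map2 (act A) \<nu>s xss \<in> lists (carrier A)"
      using \<nu>s xss(1) by induction (auto simp: q intro: A.act_closed)
    have \<mu>: "op_comp P (map length xss) \<nu>s \<mu> \<in> ops P (length (concat xss))"
      using A.comp_closed[of \<mu> "map length xss" \<nu>s] X(2) xss(2) \<nu>s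
      by (simp add: length_concat list_all2_map1)
    have cc: "concat xss \<in> lists (carrier A)" using xss(1) by fastforce
    have "act ?Q (op_comp P (map length xss) \<nu>s \<mu>) (map ?\<pi> (concat xss)) = ?\<pi> (act A \<mu> (map2 (act A) \<nu>s xss))"
      using q[OF cc \<mu>] A.act_comp[OF xss(1) _ \<nu>s] X(2) xss(2) by simp
    also have "\<dots> = act ?Q \<mu> (map2 (act ?Q) \<nu>s Xss)"
      using m X(2) xss(2) q[of "map2 (act A) \<nu>s xss" \<mu>] list_all2_lengthD[OF \<nu>s] by simp
    finally show "act ?Q (op_comp P (map length Xss) \<nu>s \<mu>) (concat Xss) = act ?Q \<mu> (map2 (act ?Q) \<nu>s Xss)"
      by (simp add: xss(2) map_concat comp_def)
  next
    fix Xs \<mu> \<sigma> assume X: "Xs \<in> lists (carrier ?Q)" "\<mu> \<in> ops P (length Xs)" "\<sigma> permutes {..<length Xs}"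
    then obtain xs where xs: "xs \<in> lists (carrier A)" "Xs = map ?\<pi> xs" using l by blast
    have \<mu>: "\<mu> \<in> ops P (length xs)" and \<sigma>: "\<sigma> permutes {..<length xs}" using X xs by auto
    have p: "permute_list \<sigma> xs \<in> lists (carrier A)" "op_sym P (length xs) \<mu> \<sigma> \<in> ops P (length xs)"
      using xs(1) set_permute_list[OF \<sigma>] A.sym_closed[OF \<sigma> \<mu>] by (auto simp: in_lists_conv_set)
    have "act ?Q (op_sym P (length xs) \<mu> \<sigma>) (map ?\<pi> (permute_list \<sigma> xs)) = ?\<pi> (act A \<mu> xs)"
      using q[OF p(1)] p(2) A.act_sym[OF xs(1) \<mu> \<sigma>] by simp
    then show "act ?Q (op_sym P (length Xs) \<mu> \<sigma>) (permute_list \<sigma> Xs) = act ?Q \<mu> Xs"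
      unfolding xs(2) permute_list_map[OF \<sigma>] length_map using q[OF xs(1) \<mu>] by simp
  qed
qed

section \<open>Block permutations\<close>

text \<open>The condition is put in terms of multisets because rearranging blocks, or entries within
  blocks, visibly preserves the multiset of a concatenation.\<close>

lemma perm_of_list_permutes:
  assumes "mset js = mset [0..<n]"
  shows "perm_of_list js permutes {..<n}"
proof -
  have l: "length js = n" using mset_eq_length[OF assms] by simp
  have "set js = {..<n}" using mset_eq_setD[OF assms] by (simp add: lessThan_atLeast0)
  moreover have "distinct js" using mset_eq_imp_distinct_iff[OF assms] by (simp only: distinct_upt)
  ultimately have "bij_betw (\<lambda>i. js ! i) {..<n} {..<n}"
    using l by (intro bij_betw_nth) simp_all
  then have "bij_betw (perm_of_list js) {..<n} {..<n}"
    by (subst bij_betw_cong[where g = "\<lambda>i. js ! i"]) (auto simp: perm_of_list_def l)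
  then show ?thesis by (rule bij_imp_permutes) (auto simp: perm_of_list_def l)
qed

lemma permute_perm_of_list:
  "length js = length xs \<Longrightarrow> permute_list (perm_of_list js) xs = map (\<lambda>j. xs ! j) js"
  by (rule nth_equalityI) (simp_all add: permute_list_def perm_of_list_def)

lemma length_index_blocks [simp]: "length (index_blocks m ks) = length ks"
  by (induction ks arbitrary: m) auto

lemma map_length_index_blocks [simp]: "map length (index_blocks m ks) = ks"
  by (induction ks arbitrary: m) auto

lemma concat_index_blocks: "concat (index_blocks m ks) = [m..<m + sum_list ks]"
proof (induction ks arbitrary: m)
  case (Cons k ks)
  then show ?case using upt_add_eq_append[of m "m + k" "sum_list ks"] by (simp add: add_ac)
qed simp

text \<open>The prefix \<open>pre\<close> absorbs the offset at which the later index blocks start,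
  which makes the induction possible.\<close>

lemma map_nth_index_blocks:
  "map (map (\<lambda>j. (pre @ concat xss) ! j)) (index_blocks (length pre) (map length xss)) = xss"
proof (induction xss arbitrary: pre)
  case (Cons xs xss)
  have "map (\<lambda>j. (pre @ xs @ concat xss) ! j) [length pre..<length pre + length xs] = xs"
    by (rule nth_equalityI) (auto simp: nth_append)
  then show ?case using Cons[of "pre @ xs"] by simp
qed simp

lemma mset_concat_cong: "mset xss = mset yss \<Longrightarrow> mset (concat xss) = mset (concat yss)"
  by (simp add: mset_concat sum_mset_sum_list[symmetric])

lemma block_perm_permutes:
  assumes "\<sigma> permutes {..<length ks}"
  shows "block_perm \<sigma> ks permutes {..<sum_list ks}"
  unfolding block_perm_def
proof (rule perm_of_list_permutes)
  have "mset (permute_list \<sigma> (index_blocks 0 ks)) = mset (index_blocks 0 ks)"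
    using assms by simp
  then show "mset (concat (permute_list \<sigma> (index_blocks 0 ks))) = mset [0..<sum_list ks]"
    using mset_concat_cong[of "permute_list \<sigma> (index_blocks 0 ks)"] by (simp add: concat_index_blocks)
qed

text \<open>Reading \<open>concat xss\<close> along an index block returns the corresponding block,
  so reading along the rearranged index blocks returns the rearranged blocks.\<close>

lemma permute_block_perm:
  assumes "\<sigma> permutes {..<length xss}"
  shows "permute_list (block_perm \<sigma> (map length xss)) (concat xss) = concat (permute_list \<sigma> xss)"
proof -
  let ?b = "index_blocks 0 (map length xss)"
  have \<sigma>: "\<sigma> permutes {..<length ?b}" using assms by simp
  have "mset (concat (permute_list \<sigma> ?b)) = mset (concat ?b)"
    using \<sigma> by (intro mset_concat_cong) simp
  from mset_eq_length[OF this] have l: "length (concat (permute_list \<sigma> ?b)) = length (concat xss)"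
    by (simp add: concat_index_blocks length_concat)
  have "permute_list (block_perm \<sigma> (map length xss)) (concat xss) =
      concat (map (map (\<lambda>j. concat xss ! j)) (permute_list \<sigma> ?b))"
    unfolding block_perm_def permute_perm_of_list[OF l] map_concat ..
  also have "\<dots> = concat (permute_list \<sigma> xss)"
    using permute_list_map[OF \<sigma>, of "map (\<lambda>j. concat xss ! j)"] map_nth_index_blocks[of "[]" xss] by simp
  finally show ?thesis .
qed

lemma mset_concat_map2_permute:
  assumes "list_all2 (\<lambda>xs \<tau>. \<tau> permutes {..<length xs}) xss \<tau>s"
  shows "mset (concat (map2 permute_list \<tau>s xss)) = mset (concat xss)"
  using assms by induction auto

lemma sum_perm_permutes:
  assumes "list_all2 (\<lambda>k \<tau>. \<tau> permutes {..<k}) ks \<tau>s"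
  shows "sum_perm \<tau>s ks permutes {..<sum_list ks}"
proof -
  have "list_all2 (\<lambda>xs \<tau>. \<tau> permutes {..<length xs}) (index_blocks 0 ks) \<tau>s"
  proof -
    have "list_all2 (\<lambda>k \<tau>. \<tau> permutes {..<k}) (map length (index_blocks 0 ks)) \<tau>s"
      unfolding map_length_index_blocks by (rule assms)
    then show ?thesis unfolding list_all2_map1 .
  qed
  from mset_concat_map2_permute[OF this] show ?thesis
    unfolding sum_perm_def using concat_index_blocks[of 0 ks] by (intro perm_of_list_permutes) simp
qed

text \<open>The same reading argument, with each index block rearranged internally. The two
  identities match the permutations in the axioms \<open>comp_sym\<close> and
  \<open>comp_args_sym\<close> with rearrangements of concatenated argument lists.\<close>

lemma permute_sum_perm:
  assumes "list_all2 (\<lambda>xs \<tau>. \<tau> permutes {..<length xs}) xss \<tau>s"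
  shows "permute_list (sum_perm \<tau>s (map length xss)) (concat xss) = concat (map2 permute_list \<tau>s xss)"
proof -
  let ?b = "index_blocks 0 (map length xss)"
  have "list_all2 (\<lambda>k \<tau>. \<tau> permutes {..<k}) (map length xss) \<tau>s"
    unfolding list_all2_map1 by (rule assms)
  then have "list_all2 (\<lambda>k \<tau>. \<tau> permutes {..<k}) (map length ?b) \<tau>s"
    unfolding map_length_index_blocks .
  then have p: "list_all2 (\<lambda>xs \<tau>. \<tau> permutes {..<length xs}) ?b \<tau>s"
    unfolding list_all2_map1 .
  have l: "length (concat (map2 permute_list \<tau>s ?b)) = length (concat xss)"
    using mset_eq_length[OF mset_concat_map2_permute[OF p]] by (simp add: concat_index_blocks length_concat)
  have m: "map (map g) (map2 permute_list \<tau>s bs) = map2 permute_list \<tau>s (map (map g) bs)"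
    if "list_all2 (\<lambda>xs \<tau>. \<tau> permutes {..<length xs}) bs \<tau>s" for g :: "nat \<Rightarrow> 'a" and bs
    using that by induction (auto simp: permute_list_map)
  have "permute_list (sum_perm \<tau>s (map length xss)) (concat xss) =
      concat (map (map (\<lambda>j. concat xss ! j)) (map2 permute_list \<tau>s ?b))"
    unfolding sum_perm_def permute_perm_of_list[OF l] map_concat ..
  also have "\<dots> = concat (map2 permute_list \<tau>s xss)"
    unfolding m[OF p] using map_nth_index_blocks[of "[]" xss] by simp
  finally show ?thesis .
qed

section \<open>Formal combinations of symbols\<close>

locale operad_module = module R V + operad R P
  for R (structure) and P :: "('r, 'p, 'n) operad_scheme" and V :: "('r, 'v, 'm) module_scheme"
begin

abbreviation "FF \<equiv> formal_alg R P V"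

text \<open>Uncurried \<open>symb\<close>: the spanning set becomes an image, and lists of basis
  elements become \<open>map sy ss\<close>.\<close>

definition sy :: "'p \<times> 'v list \<Rightarrow> ('r, 'p, 'v) formal" where
  "sy s = symb R (fst s) (snd s)"

lemma sy_apply: "sy s t = (if t = s then \<one> else \<zero>)"
  by (simp add: sy_def symb_def)

lemma symbolsD: "s \<in> symbols P V \<Longrightarrow> fst s \<in> ops P (length (snd s)) \<and> snd s \<in> lists (carrier V)"
  by (auto simp: symbols_def)

lemma formal_simps:
  "f \<in> carrier FF \<longleftrightarrow> (\<forall>s. f s \<in> carrier R) \<and> finite (supp R f) \<and> supp R f \<subseteq> symbols P V"
  "\<zero>\<^bsub>FF\<^esub> = (\<lambda>_. \<zero>)"
  "f \<oplus>\<^bsub>FF\<^esub> g = (\<lambda>s. f s \<oplus> g s)"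
  "r \<odot>\<^bsub>FF\<^esub> f = (\<lambda>s. r \<otimes> f s)"
  by (auto simp: formal_alg_def)

lemma formal_carrierI:
  assumes "\<And>s. f s \<in> carrier R" "\<And>s. s \<notin> S \<Longrightarrow> f s = \<zero>" "finite S" "S \<subseteq> symbols P V"
  shows "f \<in> carrier FF"
proof -
  have "supp R f \<subseteq> S" using assms(2) by (auto simp: supp_def)
  then show ?thesis using assms finite_subset by (auto simp: formal_simps)
qed

lemma formal_carrierD:
  assumes "f \<in> carrier FF"
  shows "f s \<in> carrier R" "finite (supp R f)" "supp R f \<subseteq> symbols P V" "s \<notin> supp R f \<Longrightarrow> f s = \<zero>"
  using assms unfolding formal_simps(1) supp_def by blast+

lemma sy_closed: "s \<in> symbols P V \<Longrightarrow> sy s \<in> carrier FF"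
  by (rule formal_carrierI[of _ "{s}"]) (auto simp: sy_apply)

lemma formal_module: "module R FF"
proof (rule moduleI)
  show "abelian_group FF"
  proof (rule abelian_groupI)
    fix f g assume "f \<in> carrier FF" "g \<in> carrier FF"
    note f = formal_carrierD[OF this(1)] and g = formal_carrierD[OF this(2)]
    show "f \<oplus>\<^bsub>FF\<^esub> g \<in> carrier FF"
      using f g by (intro formal_carrierI[of _ "supp R f \<union> supp R g"]) (auto simp: formal_simps)
  next
    fix f assume "f \<in> carrier FF"
    note f = formal_carrierD[OF this]
    have "(\<lambda>s. \<ominus> f s) \<in> carrier FF"
      using f by (intro formal_carrierI[of _ "supp R f"]) auto
    moreover have "(\<lambda>s. \<ominus> f s) \<oplus>\<^bsub>FF\<^esub> f = \<zero>\<^bsub>FF\<^esub>"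
      using f(1) by (simp add: formal_simps R.l_neg)
    ultimately show "\<exists>g\<in>carrier FF. g \<oplus>\<^bsub>FF\<^esub> f = \<zero>\<^bsub>FF\<^esub>" by blast
  next
    show "\<zero>\<^bsub>FF\<^esub> \<in> carrier FF"
      by (rule formal_carrierI[of _ "{}"]) (auto simp: formal_simps(2-))
  next
    fix f g h assume "f \<in> carrier FF" "g \<in> carrier FF" "h \<in> carrier FF"
    then show "f \<oplus>\<^bsub>FF\<^esub> g \<oplus>\<^bsub>FF\<^esub> h = f \<oplus>\<^bsub>FF\<^esub> (g \<oplus>\<^bsub>FF\<^esub> h)"
      by (simp add: formal_simps(2-) R.a_assoc formal_carrierD(1))
  next
    fix f g assume "f \<in> carrier FF" "g \<in> carrier FF"
    then show "f \<oplus>\<^bsub>FF\<^esub> g = g \<oplus>\<^bsub>FF\<^esub> f"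
      by (simp add: formal_simps(2-) R.a_comm formal_carrierD(1))
  next
    fix f assume "f \<in> carrier FF"
    then show "\<zero>\<^bsub>FF\<^esub> \<oplus>\<^bsub>FF\<^esub> f = f"
      by (simp add: formal_simps(2-) formal_carrierD(1))
  qed
next
  fix r f assume r: "r \<in> carrier R" and "f \<in> carrier FF"
  note f = formal_carrierD[OF this(2)]
  show "r \<odot>\<^bsub>FF\<^esub> f \<in> carrier FF"
    using r f by (intro formal_carrierI[of _ "supp R f"]) (auto simp: formal_simps)
next
  fix r q f assume "r \<in> carrier R" "q \<in> carrier R" "f \<in> carrier FF"
  then show "(r \<oplus> q) \<odot>\<^bsub>FF\<^esub> f = r \<odot>\<^bsub>FF\<^esub> f \<oplus>\<^bsub>FF\<^esub> q \<odot>\<^bsub>FF\<^esub> f"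
    and "(r \<otimes> q) \<odot>\<^bsub>FF\<^esub> f = r \<odot>\<^bsub>FF\<^esub> (q \<odot>\<^bsub>FF\<^esub> f)"
    by (simp_all add: formal_simps(2-) R.l_distr R.m_assoc formal_carrierD(1))
next
  fix r f g assume "r \<in> carrier R" "f \<in> carrier FF" "g \<in> carrier FF"
  then show "r \<odot>\<^bsub>FF\<^esub> (f \<oplus>\<^bsub>FF\<^esub> g) = r \<odot>\<^bsub>FF\<^esub> f \<oplus>\<^bsub>FF\<^esub> r \<odot>\<^bsub>FF\<^esub> g"
    by (simp add: formal_simps(2-) R.r_distr formal_carrierD(1))
next
  fix f assume "f \<in> carrier FF"
  then show "\<one> \<odot>\<^bsub>FF\<^esub> f = f" by (simp add: formal_simps(2-) formal_carrierD(1))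
qed (rule R.cring_axioms)

text \<open>Induction over a finite set that contains the support, with the term at one symbol split
  off in each step; a superset leaves room for coefficients that happen to be zero.\<close>

lemma formal_spans: "spans R FF (sy ` symbols P V)"
proof -
  interpret FF: module R FF by (rule formal_module)
  have 1: "f \<in> mod_span R FF (sy ` symbols P V)" if "finite U" "f \<in> carrier FF" "supp R f \<subseteq> U" for f U
    using that
  proof (induction U arbitrary: f)
    case empty
    then have "f = \<zero>\<^bsub>FF\<^esub>" by (auto simp: formal_simps supp_def)
    then show ?case by (simp add: mod_span.zero)
  next
    case (insert s U)
    note f = formal_carrierD[OF insert.prems(1)]
    show ?case
    proof (cases "s \<in> symbols P V")
      case False
      then have "s \<notin> supp R f" using f(3) by blast
      then show ?thesis using insert by blast
    next
      case True
      have "f(s := \<zero>) \<in> carrier FF"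
        using f by (intro formal_carrierI[of _ "supp R f"]) auto
      moreover have "supp R (f(s := \<zero>)) \<subseteq> U" using insert.prems(2) by (auto simp: supp_def)
      ultimately have "f(s := \<zero>) \<in> mod_span R FF (sy ` symbols P V)" by (rule insert.IH)
      then have "f(s := \<zero>) \<oplus>\<^bsub>FF\<^esub> f s \<odot>\<^bsub>FF\<^esub> sy s \<in> mod_span R FF (sy ` symbols P V)"
        by (rule mod_span.add) (rule mod_span.smult[OF f(1)], rule mod_span.gen, rule imageI, rule True)
      moreover have "f(s := \<zero>) \<oplus>\<^bsub>FF\<^esub> f s \<odot>\<^bsub>FF\<^esub> sy s = f"
      proof (rule ext)
        fix t show "(f(s := \<zero>) \<oplus>\<^bsub>FF\<^esub> f s \<odot>\<^bsub>FF\<^esub> sy s) t = f t"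
          using f(1) by (cases "t = s") (simp_all add: formal_simps(3,4) sy_apply)
      qed
      ultimately show ?thesis by simp
    qed
  qed
  have 2: "f \<in> carrier FF" if "f \<in> mod_span R FF (sy ` symbols P V)" for f
    using that by induction (auto intro: sy_closed)
  show ?thesis unfolding spans_def using 1 2 formal_carrierD(2) by blast
qed

text \<open>Formal combinations are the free module on the symbols. It will be applied with
  \<open>h\<close> evaluating a symbol in an algebra.\<close>

lemma formal_ext:
  assumes "module R M" "\<And>s. s \<in> symbols P V \<Longrightarrow> h s \<in> carrier M"
  shows "\<exists>F\<in>mod_hom R FF M. \<forall>s\<in>symbols P V. F (sy s) = h s"
proof -
  interpret M: module R M by fact
  define F where "F f = (\<Oplus>\<^bsub>M\<^esub>s\<in>supp R f. f s \<odot>\<^bsub>M\<^esub> h s)" for f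
  \<comment> \<open>Any finite set of symbols around the support may serve as index set, so
    \<open>f\<close>, \<open>g\<close> and their sum can be evaluated over the same set.\<close>
  have F: "F f = (\<Oplus>\<^bsub>M\<^esub>s\<in>U. f s \<odot>\<^bsub>M\<^esub> h s)"
    if "f \<in> carrier FF" "finite U" "supp R f \<subseteq> U" "U \<subseteq> symbols P V" for f U
    unfolding F_def using that assms(2) formal_carrierD[OF that(1)]
    by (intro M.add.finprod_mono_neutral_cong_left) (auto simp: subset_iff)
  have hU: "(\<lambda>s. f s \<odot>\<^bsub>M\<^esub> h s) \<in> U \<rightarrow> carrier M" if "f \<in> carrier FF" "U \<subseteq> symbols P V" for f U
    using that assms(2) formal_carrierD[OF that(1)] by auto
  interpret FF: module R FF by (rule formal_module)
  have "F \<in> mod_hom R FF M"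
  proof (rule mod_homI)
    fix f assume f: "f \<in> carrier FF"
    then show "F f \<in> carrier M"
      unfolding F_def using hU formal_carrierD(3) by (intro M.finsum_closed) auto
    fix r assume r: "r \<in> carrier R"
    have s: "supp R (r \<odot>\<^bsub>FF\<^esub> f) \<subseteq> supp R f" using r by (auto simp: supp_def formal_simps)
    note fD = formal_carrierD[OF f]
    have "F (r \<odot>\<^bsub>FF\<^esub> f) = (\<Oplus>\<^bsub>M\<^esub>s\<in>supp R f. (r \<odot>\<^bsub>FF\<^esub> f) s \<odot>\<^bsub>M\<^esub> h s)"
      by (rule F[OF FF.smult_closed[OF r f] fD(2) s fD(3)])
    also have "\<dots> = (\<Oplus>\<^bsub>M\<^esub>s\<in>supp R f. r \<odot>\<^bsub>M\<^esub> (f s \<odot>\<^bsub>M\<^esub> h s))"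
    proof (rule M.finsum_cong'[OF refl])
      fix s assume "s \<in> supp R f"
      then have "s \<in> symbols P V" using fD(3) by blast
      then show "(r \<odot>\<^bsub>FF\<^esub> f) s \<odot>\<^bsub>M\<^esub> h s = r \<odot>\<^bsub>M\<^esub> (f s \<odot>\<^bsub>M\<^esub> h s)"
        using r fD(1) assms(2) by (simp add: formal_simps(4) M.smult_assoc1)
    qed (use r hU[OF f fD(3)] in auto)
    finally have "F (r \<odot>\<^bsub>FF\<^esub> f) = (\<Oplus>\<^bsub>M\<^esub>s\<in>supp R f. r \<odot>\<^bsub>M\<^esub> (f s \<odot>\<^bsub>M\<^esub> h s))" .
    then show "F (r \<odot>\<^bsub>FF\<^esub> f) = r \<odot>\<^bsub>M\<^esub> F f"
      unfolding F_def using M.finsum_smult_ldistr[of "supp R f" r] hU[OF f] formal_carrierD(2,3)[OF f] r by simp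
  next
    fix f g assume f: "f \<in> carrier FF" and g: "g \<in> carrier FF"
    let ?U = "supp R f \<union> supp R g"
    have U: "finite ?U" "?U \<subseteq> symbols P V" using formal_carrierD[OF f] formal_carrierD[OF g] by auto
    have s: "supp R (f \<oplus>\<^bsub>FF\<^esub> g) \<subseteq> ?U" using formal_carrierD(1)[OF f] by (auto simp: supp_def formal_simps)
    have "F (f \<oplus>\<^bsub>FF\<^esub> g) = (\<Oplus>\<^bsub>M\<^esub>s\<in>?U. (f \<oplus>\<^bsub>FF\<^esub> g) s \<odot>\<^bsub>M\<^esub> h s)"
      by (rule F[OF FF.M.a_closed[OF f g] U(1) s U(2)])
    also have "\<dots> = (\<Oplus>\<^bsub>M\<^esub>s\<in>?U. f s \<odot>\<^bsub>M\<^esub> h s \<oplus>\<^bsub>M\<^esub> g s \<odot>\<^bsub>M\<^esub> h s)"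
    proof (rule M.finsum_cong'[OF refl])
      fix s assume "s \<in> ?U"
      then have "s \<in> symbols P V" using U(2) by blast
      then show "(f \<oplus>\<^bsub>FF\<^esub> g) s \<odot>\<^bsub>M\<^esub> h s = f s \<odot>\<^bsub>M\<^esub> h s \<oplus>\<^bsub>M\<^esub> g s \<odot>\<^bsub>M\<^esub> h s"
        using formal_carrierD(1)[OF f] formal_carrierD(1)[OF g] assms(2)
        by (simp add: formal_simps(3) M.smult_l_distr)
    qed (use hU[OF f U(2)] hU[OF g U(2)] in auto)
    also have "\<dots> = F f \<oplus>\<^bsub>M\<^esub> F g"
      using F[OF f U(1) _ U(2)] F[OF g U(1) _ U(2)] hU[OF f U(2)] hU[OF g U(2)]
      by (simp add: M.finsum_addf)
    finally show "F (f \<oplus>\<^bsub>FF\<^esub> g) = F f \<oplus>\<^bsub>M\<^esub> F g" .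
  qed
  moreover have "F (sy s) = h s" if s: "s \<in> symbols P V" for s
  proof -
    have "F (sy s) = (\<Oplus>\<^bsub>M\<^esub>t\<in>{s}. sy s t \<odot>\<^bsub>M\<^esub> h t)"
      using s by (intro F sy_closed) (auto simp: supp_def sy_apply split: if_splits)
    then show ?thesis using s assms(2) by (simp add: sy_apply)
  qed
  ultimately show ?thesis by blast
qed

text \<open>The coefficient with which the choice \<open>ss\<close> of one symbol per argument
  enters the expansion of an action on formal combinations.\<close>

definition weight :: "('p \<times> 'v list \<Rightarrow> 'r) list \<Rightarrow> ('p \<times> 'v list) list \<Rightarrow> 'r" where
  "weight fs ss = foldr (\<otimes>) (map2 (\<lambda>f s. f s) fs ss) \<one>"

lemma weight_simps [simp]:
  "weight [] [] = \<one>" "weight (f # fs) (s # ss) = f s \<otimes> weight fs ss"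
  by (simp_all add: weight_def)

lemma weight_closed:
  "length fs = length ss \<Longrightarrow> (\<And>f s. f \<in> set fs \<Longrightarrow> f s \<in> carrier R) \<Longrightarrow> weight fs ss \<in> carrier R"
  by (induction rule: list_induct2) auto

text \<open>The constant function \<open>\<one>\<close> at place \<open>i\<close> encodes the
  product of the other factors. It does not depend on \<open>f\<close>, which exhibits the weight as
  linear in the \<open>i\<close>-th argument.\<close>

lemma weight_update:
  assumes "length fs = length ss" "i < length fs" "\<And>g s. g \<in> set fs \<Longrightarrow> g s \<in> carrier R" "\<And>s. f s \<in> carrier R"
  shows "weight (fs[i := f]) ss = f (ss ! i) \<otimes> weight (fs[i := \<lambda>_. \<one>]) ss"
  using assms(1-3)
proof (induction arbitrary: i rule: list_induct2)
  case (Cons g gs s ss)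
  have c: "weight gs ss \<in> carrier R" "g s \<in> carrier R"
    using Cons by (auto intro: weight_closed)
  show ?case
  proof (cases i)
    case 0
    then show ?thesis using c assms(4) by simp
  next
    case (Suc j)
    have "weight (gs[j := \<lambda>_. \<one>]) ss \<in> carrier R"
      using Cons set_update_subset_insert[of gs j "\<lambda>_. \<one>"] by (intro weight_closed) auto
    then show ?thesis using Suc Cons c assms(4) by (simp add: R.m_lcomm)
  qed
qed simp

lemma weight_zero:
  assumes "length fs = length ss" "i < length fs" "\<And>g s. g \<in> set fs \<Longrightarrow> g s \<in> carrier R" "(fs ! i) (ss ! i) = \<zero>"
  shows "weight fs ss = \<zero>"
proof -
  have "weight (fs[i := \<lambda>_. \<one>]) ss \<in> carrier R"
    using assms set_update_subset_insert[of fs i "\<lambda>_. \<one>"] by (intro weight_closed) auto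
  then show ?thesis
    using weight_update[of fs ss i "fs ! i"] assms by (simp add: nth_mem)
qed

lemma weight_sy:
  "length ss = length ss' \<Longrightarrow> weight (map sy ss) ss' = (if ss' = ss then \<one> else \<zero>)"
  by (induction rule: list_induct2) (auto simp: sy_apply)

text \<open>An index set depending on a common finite set \<open>U\<close> instead of the supports
  of the arguments, so that sums belonging to different arguments can be compared term by
  term.\<close>

definition fibre :: "('p \<times> 'v list) set \<Rightarrow> nat \<Rightarrow> 'p \<Rightarrow> 'p \<times> 'v list \<Rightarrow> ('p \<times> 'v list) list set" where
  "fibre U n \<mu> t = {ss. set ss \<subseteq> U \<and> length ss = n \<and> comp_symbols P \<mu> ss = t}"

lemma fibre_finite: "finite U \<Longrightarrow> finite (fibre U n \<mu> t)"
  by (rule finite_subset[OF _ finite_lists_length_eq[of U n]]) (auto simp: fibre_def)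

text \<open>A list in the fibre that is missing from the original index set leaves the support at
  some place, where its weight acquires a zero factor.\<close>

lemma formal_act:
  assumes "finite U" "\<And>f. f \<in> set fs \<Longrightarrow> f \<in> carrier FF \<and> supp R f \<subseteq> U"
  shows "act FF \<mu> fs t = (\<Oplus>ss\<in>fibre U (length fs) \<mu> t. weight fs ss)"
proof -
  have c: "g s \<in> carrier R" if "g \<in> set fs" for g s
    using assms(2)[OF that] formal_carrierD(1) by blast
  have "act FF \<mu> fs t = (\<Oplus>ss\<in>{ss \<in> listset (map (supp R) fs). comp_symbols P \<mu> ss = t}. weight fs ss)"
    by (simp add: formal_alg_def weight_def)
  also have "\<dots> = (\<Oplus>ss\<in>fibre U (length fs) \<mu> t. weight fs ss)"
  proof (rule R.add.finprod_mono_neutral_cong_left)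
    show "{ss \<in> listset (map (supp R) fs). comp_symbols P \<mu> ss = t} \<subseteq> fibre U (length fs) \<mu> t"
    proof
      fix ss assume "ss \<in> {ss \<in> listset (map (supp R) fs). comp_symbols P \<mu> ss = t}"
      then have ss: "length ss = length fs" "\<And>i. i < length fs \<Longrightarrow> ss ! i \<in> supp R (fs ! i)" "comp_symbols P \<mu> ss = t"
        by (auto simp: in_listset_iff list_all2_conv_all_nth)
      have "s \<in> U" if s: "s \<in> set ss" for s
      proof -
        from s obtain i where "i < length ss" "s = ss ! i" unfolding in_set_conv_nth by blast
        then have i: "i < length fs" "s = ss ! i" using ss(1) by simp_all
        then have "s \<in> supp R (fs ! i)" "fs ! i \<in> set fs" using ss(2)[OF i(1)] by simp_all
        then show ?thesis using assms(2) by blast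
      qed
      then have "set ss \<subseteq> U" by blast
      then show "ss \<in> fibre U (length fs) \<mu> t" using ss by (simp add: fibre_def)
    qed
  next
    fix ss assume "ss \<in> fibre U (length fs) \<mu> t - {ss \<in> listset (map (supp R) fs). comp_symbols P \<mu> ss = t}"
    then have l: "length ss = length fs" and "ss \<notin> listset (map (supp R) fs)"
      by (auto simp: fibre_def)
    then obtain i where i: "i < length fs" "ss ! i \<notin> supp R (fs ! i)"
      using l by (auto simp: in_listset_iff list_all2_conv_all_nth)
    have "(fs ! i) (ss ! i) = \<zero>" using i assms(2)[of "fs ! i"] formal_carrierD(4) by simp
    then show "weight fs ss = \<zero>"
      using l i(1) c by (intro weight_zero[of fs ss i]) simp_all
  next
    show "weight fs \<in> fibre U (length fs) \<mu> t \<rightarrow> carrier R"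
      using c by (intro Pi_I weight_closed) (simp_all add: fibre_def)
  qed (rule fibre_finite[OF assms(1)], rule refl)
  finally show ?thesis .
qed

lemma comp_symbols_closed:
  assumes "set ss \<subseteq> symbols P V" "\<mu> \<in> ops P (length ss)"
  shows "comp_symbols P \<mu> ss \<in> symbols P V"
proof -
  have "list_all2 (\<lambda>k \<nu>. \<nu> \<in> ops P k) (map (length \<circ> snd) ss) (map fst ss)"
    unfolding list_all2_map1 list_all2_map2 list_all2_same comp_def using assms(1) symbolsD by blast
  from comp_closed[OF _ this] assms(2)
  have "op_comp P (map (length \<circ> snd) ss) (map fst ss) \<mu> \<in> ops P (length (concat (map snd ss)))"
    by (simp add: length_concat comp_def)
  moreover have "concat (map snd ss) \<in> lists (carrier V)"
    using assms(1) symbolsD by (fastforce simp: in_lists_conv_set)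
  ultimately show ?thesis by (simp add: comp_symbols_def symbols_def)
qed

lemma formal_multilinear_act: "multilinear_act R P FF"
proof (intro multilinear_act.intro formal_module operad_axioms multilinear_act_axioms.intro)
  interpret FF: module R FF by (rule formal_module)
  fix fs \<mu> assume fs: "fs \<in> lists (carrier FF)" and \<mu>: "\<mu> \<in> ops P (length fs)"
  define U where "U = (\<Union>f\<in>set fs. supp R f)"
  have U: "finite U" "U \<subseteq> symbols P V" "\<And>f. f \<in> set fs \<Longrightarrow> f \<in> carrier FF \<and> supp R f \<subseteq> U"
    using fs formal_carrierD(2,3) by (fastforce simp: U_def)+
  show "act FF \<mu> fs \<in> carrier FF"
  proof (rule formal_carrierI)
    \<comment> \<open>All composites of symbols from \<open>U\<close>: a finite set that contains
      the support of the result.\<close>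
    let ?S = "comp_symbols P \<mu> ` {ss. set ss \<subseteq> U \<and> length ss = length fs}"
    show "finite ?S" using U(1) finite_lists_length_eq by blast
    show "?S \<subseteq> symbols P V" using U(2) \<mu> comp_symbols_closed by fastforce
    fix t
    have fa: "act FF \<mu> fs t = (\<Oplus>ss\<in>fibre U (length fs) \<mu> t. weight fs ss)"
      using U(1,3) by (rule formal_act)
    have "(\<lambda>ss. weight fs ss) \<in> fibre U (length fs) \<mu> t \<rightarrow> carrier R"
      using U(3) formal_carrierD(1) by (auto simp: fibre_def intro!: weight_closed)
    then show "act FF \<mu> fs t \<in> carrier R"
      unfolding fa by (rule R.finsum_closed)
    assume "t \<notin> ?S"
    then have "fibre U (length fs) \<mu> t = {}" by (auto simp: fibre_def)
    then show "act FF \<mu> fs t = \<zero>" unfolding fa by simp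
  qed
  fix i assume i: "i < length fs"
  \<comment> \<open>The factor of the \<open>i\<close>-th argument \<open>h\<close> is isolated. The
    remaining weight and, once \<open>W\<close> is fixed, the index set are independent of
    \<open>h\<close>, so linearity reduces to distributivity in \<open>R\<close>.\<close>
  have upd: "act FF \<mu> (fs[i := h]) t = (\<Oplus>ss\<in>fibre (W \<union> U) (length fs) \<mu> t. h (ss ! i) \<otimes> weight (fs[i := \<lambda>_. \<one>]) ss)"
    "(\<lambda>ss. weight (fs[i := \<lambda>_. \<one>]) ss) \<in> fibre (W \<union> U) (length fs) \<mu> t \<rightarrow> carrier R"
    if h: "h \<in> carrier FF" and W: "supp R h \<subseteq> W" "finite W" for h t W
  proof -
    have f: "f \<in> carrier FF \<and> supp R f \<subseteq> W \<union> U" if "f \<in> set (fs[i := h])" for f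
      using that U(3) h W set_update_subset_insert[of fs i h] by auto
    show cl: "(\<lambda>ss. weight (fs[i := \<lambda>_. \<one>]) ss) \<in> fibre (W \<union> U) (length fs) \<mu> t \<rightarrow> carrier R"
      using U(3) formal_carrierD(1) set_update_subset_insert[of fs i "\<lambda>_. \<one>"]
      by (auto simp: fibre_def intro!: weight_closed)
    have "act FF \<mu> (fs[i := h]) t = (\<Oplus>ss\<in>fibre (W \<union> U) (length (fs[i := h])) \<mu> t. weight (fs[i := h]) ss)"
      using U(1) W(2) f by (intro formal_act) auto
    also have "\<dots> = (\<Oplus>ss\<in>fibre (W \<union> U) (length fs) \<mu> t. h (ss ! i) \<otimes> weight (fs[i := \<lambda>_. \<one>]) ss)"
    proof (rule R.finsum_cong')
      show "(\<lambda>ss. h (ss ! i) \<otimes> weight (fs[i := \<lambda>_. \<one>]) ss) \<in> fibre (W \<union> U) (length fs) \<mu> t \<rightarrow> carrier R"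
        using cl formal_carrierD(1)[OF h] by (simp add: Pi_def)
      fix ss assume "ss \<in> fibre (W \<union> U) (length fs) \<mu> t"
      then have "length fs = length ss" by (simp add: fibre_def)
      then show "weight (fs[i := h]) ss = h (ss ! i) \<otimes> weight (fs[i := \<lambda>_. \<one>]) ss"
        using i U(3) formal_carrierD(1) h by (intro weight_update) blast+
    qed simp
    finally show "act FF \<mu> (fs[i := h]) t = (\<Oplus>ss\<in>fibre (W \<union> U) (length fs) \<mu> t. h (ss ! i) \<otimes> weight (fs[i := \<lambda>_. \<one>]) ss)" .
  qed
  { fix f g assume f: "f \<in> carrier FF" and g: "g \<in> carrier FF"
    show "act FF \<mu> (fs[i := f \<oplus>\<^bsub>FF\<^esub> g]) = act FF \<mu> (fs[i := f]) \<oplus>\<^bsub>FF\<^esub> act FF \<mu> (fs[i := g])"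
    proof
      fix t
      \<comment> \<open>Large enough for both summands and for their sum, so that all three values
        are sums over one fibre.\<close>
      define W where "W = supp R f \<union> supp R g \<union> supp R (f \<oplus>\<^bsub>FF\<^esub> g)"
      have W: "supp R f \<subseteq> W" "supp R g \<subseteq> W" "supp R (f \<oplus>\<^bsub>FF\<^esub> g) \<subseteq> W" "finite W"
        using formal_carrierD(2) f g FF.M.a_closed[OF f g] by (auto simp: W_def)
      let ?w = "\<lambda>ss. weight (fs[i := \<lambda>_. \<one>]) ss" and ?B = "fibre (W \<union> U) (length fs) \<mu> t"
      note cl = upd(2)[OF f W(1,4), of t]
      have "act FF \<mu> (fs[i := f \<oplus>\<^bsub>FF\<^esub> g]) t = (\<Oplus>ss\<in>?B. f (ss ! i) \<otimes> ?w ss \<oplus> g (ss ! i) \<otimes> ?w ss)"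
        unfolding upd(1)[OF FF.M.a_closed[OF f g] W(3,4)]
        using cl formal_carrierD(1)[OF f] formal_carrierD(1)[OF g]
        by (intro R.finsum_cong' refl) (simp_all add: formal_simps(3) R.l_distr Pi_def)
      also have "\<dots> = act FF \<mu> (fs[i := f]) t \<oplus> act FF \<mu> (fs[i := g]) t"
        unfolding upd(1)[OF f W(1,4)] upd(1)[OF g W(2,4)]
        using cl formal_carrierD(1)[OF f] formal_carrierD(1)[OF g] by (intro R.finsum_addf) (simp_all add: Pi_def)
      finally show "act FF \<mu> (fs[i := f \<oplus>\<^bsub>FF\<^esub> g]) t = (act FF \<mu> (fs[i := f]) \<oplus>\<^bsub>FF\<^esub> act FF \<mu> (fs[i := g])) t"
        by (simp add: formal_simps(3))
    qed
  }
  { fix f r assume f: "f \<in> carrier FF" and r: "r \<in> carrier R"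
    show "act FF \<mu> (fs[i := r \<odot>\<^bsub>FF\<^esub> f]) = r \<odot>\<^bsub>FF\<^esub> act FF \<mu> (fs[i := f])"
    proof
      fix t
      define W where "W = supp R f \<union> supp R (r \<odot>\<^bsub>FF\<^esub> f)"
      have W: "supp R f \<subseteq> W" "supp R (r \<odot>\<^bsub>FF\<^esub> f) \<subseteq> W" "finite W"
        using formal_carrierD(2) f FF.smult_closed[OF r f] by (auto simp: W_def)
      let ?w = "\<lambda>ss. weight (fs[i := \<lambda>_. \<one>]) ss" and ?B = "fibre (W \<union> U) (length fs) \<mu> t"
      note cl = upd(2)[OF f W(1,3), of t]
      have "act FF \<mu> (fs[i := r \<odot>\<^bsub>FF\<^esub> f]) t = (\<Oplus>ss\<in>?B. r \<otimes> (f (ss ! i) \<otimes> ?w ss))"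
        unfolding upd(1)[OF FF.smult_closed[OF r f] W(2,3)]
        using cl formal_carrierD(1)[OF f] r
        by (intro R.finsum_cong' refl) (simp_all add: formal_simps(4) R.m_assoc Pi_def)
      also have "\<dots> = r \<otimes> act FF \<mu> (fs[i := f]) t"
        unfolding upd(1)[OF f W(1,3)]
        using cl formal_carrierD(1)[OF f] r fibre_finite[of "W \<union> U"] W U(1)
        by (intro R.finsum_rdistr[symmetric]) (simp_all add: Pi_def)
      finally show "act FF \<mu> (fs[i := r \<odot>\<^bsub>FF\<^esub> f]) t = (r \<odot>\<^bsub>FF\<^esub> act FF \<mu> (fs[i := f])) t"
        by (simp add: formal_simps(4))
    qed
  }
qed

text \<open>The list \<open>ss\<close> has weight one and every other list has weight zero, so the
  sum is one exactly when \<open>ss\<close> lies in the fibre of \<open>t\<close>, that is, when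
  \<open>t\<close> is its composite.\<close>

lemma formal_act_sy:
  assumes "set ss \<subseteq> symbols P V"
  shows "act FF \<mu> (map sy ss) = sy (comp_symbols P \<mu> ss)"
proof
  fix t
  let ?B = "fibre (set ss) (length ss) \<mu> t"
  have "act FF \<mu> (map sy ss) t = (\<Oplus>ss'\<in>fibre (set ss) (length (map sy ss)) \<mu> t. weight (map sy ss) ss')"
    using assms sy_closed by (intro formal_act) (auto simp: supp_def sy_apply split: if_splits)
  also have "\<dots> = (\<Oplus>ss'\<in>?B. if ss' = ss then \<one> else \<zero>)"
    by (intro R.finsum_cong') (auto simp: fibre_def weight_sy)
  also have "\<dots> = sy (comp_symbols P \<mu> ss) t"
  proof (cases "ss \<in> ?B")
    case True
    then have "(\<Oplus>ss'\<in>?B. if ss' = ss then \<one> else \<zero>) = \<one>"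
      using fibre_finite[of "set ss"] by (intro R.add.finprod_singleton_swap) auto
    then show ?thesis using True by (auto simp: sy_apply fibre_def)
  next
    case False
    then have "(\<Oplus>ss'\<in>?B. if ss' = ss then \<one> else \<zero>) = \<zero>"
      by (intro R.add.finprod_one_eqI) auto
    then show ?thesis using False by (auto simp: sy_apply fibre_def)
  qed
  finally show "act FF \<mu> (map sy ss) t = sy (comp_symbols P \<mu> ss) t" .
qed

end

section \<open>The free algebra\<close>

text \<open>Both sides are multilinear in the arguments. For the universal property of the free
  algebra, the spanning set will consist of the single symbols.\<close>

lemma act_preserving_on_span:
  assumes "multilinear_act R P A" "multilinear_act R P B" "f \<in> mod_hom R A B" "spans R A G"
    and gen: "\<And>xs \<mu>. xs \<in> lists G \<Longrightarrow> \<mu> \<in> ops P (length xs) \<Longrightarrow> f (act A \<mu> xs) = act B \<mu> (map f xs)"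
    and xs: "xs \<in> lists (carrier A)" "\<mu> \<in> ops P (length xs)"
  shows "f (act A \<mu> xs) = act B \<mu> (map f xs)"
proof -
  interpret A: multilinear_act R P A by fact
  interpret B: multilinear_act R P B by fact
  note f = mod_homD[OF assms(3)]
  have fl: "map f ys \<in> lists (carrier B)" if "ys \<in> lists (carrier A)" for ys using that f(1) by auto
  have z: "f \<zero>\<^bsub>A\<^esub> = \<zero>\<^bsub>B\<^esub>" by (rule mod_hom_zero[OF A.module_axioms B.module_axioms assms(3)])
  define n where "n = length xs"
  have \<mu>: "\<mu> \<in> ops P n" using xs(2) by (simp add: n_def)
  show ?thesis
    using A.module_axioms assms(4) xs(1) n_def[symmetric]
  proof (induction rule: multilinear_induct)
    case (gen xs)
    then show ?case using assms(5) \<mu> by simp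
  next
    case (zero ys zs)
    have "act A \<mu> (ys @ \<zero>\<^bsub>A\<^esub> # zs) = \<zero>\<^bsub>A\<^esub>" using zero \<mu> by (intro A.act_zero_mem) simp_all
    moreover have "act B \<mu> (map f (ys @ \<zero>\<^bsub>A\<^esub> # zs)) = \<zero>\<^bsub>B\<^esub>"
      using zero \<mu> z fl[of ys] fl[of zs] by (intro B.act_zero_mem) simp_all
    ultimately show ?case using z by simp
  next
    case (add ys zs a b)
    have \<mu>': "\<mu> \<in> ops P (length ys + Suc (length zs))" using \<mu> add(3) by simp
    have \<mu>'': "\<mu> \<in> ops P (length (map f ys) + Suc (length (map f zs)))" using \<mu>' by simp
    have "act A \<mu> (ys @ a # zs) \<in> carrier A" "act A \<mu> (ys @ b # zs) \<in> carrier A"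
      using \<mu>' add by (auto intro!: A.act_closed)
    then have "f (act A \<mu> (ys @ (a \<oplus>\<^bsub>A\<^esub> b) # zs)) = act B \<mu> (map f ys @ f a # map f zs) \<oplus>\<^bsub>B\<^esub> act B \<mu> (map f ys @ f b # map f zs)"
      using A.act_split_add[OF add(1,2,4,5) \<mu>'] f(2) add(6,7) by simp
    then show ?case
      using B.act_split_add[OF fl[OF add(1)] fl[OF add(2)] f(1)[OF add(4)] f(1)[OF add(5)] \<mu>''] f(2)[OF add(4,5)] by simp
  next
    case (smult ys zs a r)
    have \<mu>': "\<mu> \<in> ops P (length ys + Suc (length zs))" using \<mu> smult(3) by simp
    have \<mu>'': "\<mu> \<in> ops P (length (map f ys) + Suc (length (map f zs)))" using \<mu>' by simp
    have "act A \<mu> (ys @ a # zs) \<in> carrier A"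
      using \<mu>' smult by (auto intro!: A.act_closed)
    then have "f (act A \<mu> (ys @ (r \<odot>\<^bsub>A\<^esub> a) # zs)) = r \<odot>\<^bsub>B\<^esub> act B \<mu> (map f ys @ f a # map f zs)"
      using A.act_split_smult[OF smult(1,2,4,5) \<mu>'] f(3) smult(5,6) by simp
    then show ?case
      using B.act_split_smult[OF fl[OF smult(1)] fl[OF smult(2)] f(1)[OF smult(4)] smult(5) \<mu>''] f(3)[OF smult(5,4)] by simp
  qed
qed

section \<open>The submodule of relations is an ideal\<close>

context operad_module
begin

lemma op_mod_closed:
  assumes "\<mu> \<in> ops P n"
  shows "\<mu>' \<in> ops P n \<Longrightarrow> \<mu> \<oplus>\<^bsub>op_mod P n\<^esub> \<mu>' \<in> ops P n"
    and "r \<in> carrier R \<Longrightarrow> r \<odot>\<^bsub>op_mod P n\<^esub> \<mu> \<in> ops P n"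
  using module.axioms(2)[OF op_module[of n]] module.smult_closed[OF op_module[of n]] assms
  by (auto simp: abelian_group_def intro: abelian_monoid.a_closed)

interpretation FF: multilinear_act R P FF by (rule formal_multilinear_act)

abbreviation "NN \<equiv> free_null R P V"

lemma symb_closed: "vs \<in> lists (carrier V) \<Longrightarrow> \<mu> \<in> ops P (length vs) \<Longrightarrow> symb R \<mu> vs \<in> carrier FF"
  using sy_closed[of "(\<mu>, vs)"] by (simp add: sy_def symbols_def)

lemma permute_closed: "vs \<in> lists (carrier V) \<Longrightarrow> \<sigma> permutes {..<length vs} \<Longrightarrow> permute_list \<sigma> vs \<in> lists (carrier V)"
  using set_permute_list[of \<sigma> vs] by (simp add: in_lists_conv_set)

lemma free_rels_closed:
  assumes "(x, y) \<in> free_rels R P V" shows "x \<in> carrier FF \<and> y \<in> carrier FF"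
  using assms
proof cases
  case (vec_add vs \<mu> i v w)
  have "v \<oplus>\<^bsub>V\<^esub> w \<in> carrier V" using vec_add by simp
  then show ?thesis unfolding vec_add(1,2) using update_lists_closed[OF vec_add(3)] vec_add(4-)
    by (intro conjI FF.M.a_closed symb_closed) simp_all
next
  case (vec_smult vs \<mu> i v r)
  have "r \<odot>\<^bsub>V\<^esub> v \<in> carrier V" using vec_smult by simp
  then show ?thesis unfolding vec_smult(1,2) using update_lists_closed[OF vec_smult(3)] vec_smult(4-)
    by (intro conjI FF.smult_closed symb_closed) simp_all
qed (auto intro!: symb_closed FF.M.a_closed FF.smult_closed op_mod_closed permute_closed sym_closed
      simp del: in_lists_conv_set)

lemma map_sy_closed: "set ss \<subseteq> symbols P V \<Longrightarrow> map sy ss \<in> lists (carrier FF)"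
  using sy_closed by (metis (no_types, lifting) image_subset_iff list.set_map lists_eq_set mem_Collect_eq subset_iff)

lemma free_null_submodule: "submodule NN R FF"
  unfolding free_null_def by (rule FF.gen_submodule_submodule) (rule free_rels_closed)

lemma free_rel_mem: "(x, y) \<in> free_rels R P V \<Longrightarrow> x \<ominus>\<^bsub>FF\<^esub> y \<in> NN"
  unfolding free_null_def by (rule gen_submodule_gen)

lemma act_symb_context:
  assumes "set ss \<subseteq> symbols P V" "set ss' \<subseteq> symbols P V" "(\<nu>, vs) \<in> symbols P V"
  shows "act FF \<mu> (map sy ss @ symb R \<nu> vs # map sy ss') =
    symb R (op_comp P (map (length \<circ> snd) ss @ length vs # map (length \<circ> snd) ss')
        (map fst ss @ \<nu> # map fst ss') \<mu>)
      (concat (map snd ss) @ vs @ concat (map snd ss'))"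
  using formal_act_sy[of "ss @ (\<nu>, vs) # ss'" \<mu>] assms by (simp add: sy_def comp_symbols_def comp_def)

text \<open>Inserting the two sides of a relation next to symbols produces a relation of the same
  kind between composites, because composition in the operad is linear and equivariant in its inner
  operations and the vectors are just concatenated.\<close>

lemma act_free_rel:
  assumes rel: "(x, y) \<in> free_rels R P V"
    and ss: "set ss \<subseteq> symbols P V" "set ss' \<subseteq> symbols P V" and \<mu>: "\<mu> \<in> ops P (length ss + Suc (length ss'))"
  shows "act FF \<mu> (map sy ss @ x # map sy ss') \<ominus>\<^bsub>FF\<^esub> act FF \<mu> (map sy ss @ y # map sy ss') \<in> NN"
proof -
  let ?k1 = "map (length \<circ> snd) ss" and ?k2 = "map (length \<circ> snd) ss'"
  let ?n1 = "map fst ss" and ?n2 = "map fst ss'"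
  let ?c1 = "concat (map snd ss)" and ?c2 = "concat (map snd ss')"
  note ctx = act_symb_context[OF ss]
  have sl: "map sy ss \<in> lists (carrier FF)" "map sy ss' \<in> lists (carrier FF)"
    using ss map_sy_closed by blast+
  have \<mu>': "\<mu> \<in> ops P (length (map sy ss) + Suc (length (map sy ss')))" using \<mu> by simp
  note add = FF.act_split_add[OF sl _ _ \<mu>'] and smul = FF.act_split_smult[OF sl _ _ \<mu>']
  have kn: "list_all2 (\<lambda>k \<nu>. \<nu> \<in> ops P k) (map (length \<circ> snd) ss) (map fst ss)" if "set ss \<subseteq> symbols P V" for ss
    unfolding list_all2_map1 list_all2_map2 list_all2_same comp_def using that symbolsD by blast
  have ks: "\<mu> \<in> ops P (length (?k1 @ k # ?k2))" for k using \<mu> by simp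
  have ns: "list_all2 (\<lambda>k \<nu>. \<nu> \<in> ops P k) (?k1 @ k # ?k2) (?n1 @ \<nu> # ?n2)" if "\<nu> \<in> ops P k" for k \<nu>
    using that kn[OF ss(1)] kn[OF ss(2)] by (intro list_all2_appendI) simp_all
  have sum: "sum_list (?k1 @ k # ?k2) = length (?c1 @ vs @ ?c2)" if "length vs = k" for k and vs :: "'v list"
    using that by (simp add: length_concat comp_def)
  have cc: "?c1 \<in> lists (carrier V)" "?c2 \<in> lists (carrier V)"
    using ss symbolsD by (fastforce simp: in_lists_conv_set)+
  have oc: "op_comp P (?k1 @ length vs # ?k2) (?n1 @ \<nu> # ?n2) \<mu> \<in> ops P (length (?c1 @ vs @ ?c2))"
    if "\<nu> \<in> ops P (length vs)" for \<nu> and vs :: "'v list"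
    using comp_closed[OF ks ns[OF that]] unfolding sum[OF refl] .
  show ?thesis
    using rel
  proof cases
    case (op_add vs \<nu> \<nu>')
    have v: "?c1 @ vs @ ?c2 \<in> lists (carrier V)" using cc op_add by simp
    have s: "(\<nu>, vs) \<in> symbols P V" "(\<nu>', vs) \<in> symbols P V" "(\<nu> \<oplus>\<^bsub>op_mod P (length vs)\<^esub> \<nu>', vs) \<in> symbols P V"
      using op_add by (auto simp: symbols_def op_mod_closed)
    have e: "op_comp P (?k1 @ length vs # ?k2) (?n1 @ (\<nu> \<oplus>\<^bsub>op_mod P (length vs)\<^esub> \<nu>') # ?n2) \<mu> =
        op_comp P (?k1 @ length vs # ?k2) (?n1 @ \<nu> # ?n2) \<mu>
        \<oplus>\<^bsub>op_mod P (length (?c1 @ vs @ ?c2))\<^esub> op_comp P (?k1 @ length vs # ?k2) (?n1 @ \<nu>' # ?n2) \<mu>"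
      using comp_args_add[OF ks ns[OF op_add(4)], of "length ss" \<nu> \<nu>'] op_add(4,5)
      unfolding sum[OF refl] by (simp add: nth_append list_update_append)
    show ?thesis
      unfolding op_add(1,2) add[OF symb_closed[OF op_add(3,4)] symb_closed[OF op_add(3,5)]]
        ctx[OF s(1)] ctx[OF s(2)] ctx[OF s(3)] e
      by (intro free_rel_mem free_rels.op_add v oc op_add)
  next
    case (op_smult vs \<nu> r)
    have v: "?c1 @ vs @ ?c2 \<in> lists (carrier V)" using cc op_smult by simp
    have s: "(\<nu>, vs) \<in> symbols P V" "(r \<odot>\<^bsub>op_mod P (length vs)\<^esub> \<nu>, vs) \<in> symbols P V"
      using op_smult by (auto simp: symbols_def op_mod_closed)
    have e: "op_comp P (?k1 @ length vs # ?k2) (?n1 @ (r \<odot>\<^bsub>op_mod P (length vs)\<^esub> \<nu>) # ?n2) \<mu> =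
        r \<odot>\<^bsub>op_mod P (length (?c1 @ vs @ ?c2))\<^esub> op_comp P (?k1 @ length vs # ?k2) (?n1 @ \<nu> # ?n2) \<mu>"
      using comp_args_smult[OF ks ns[OF op_smult(4)], of "length ss" \<nu> r] op_smult(4,5)
      unfolding sum[OF refl] by (simp add: nth_append list_update_append)
    show ?thesis
      unfolding op_smult(1,2) smul[OF symb_closed[OF op_smult(3,4)] op_smult(5)]
        ctx[OF s(1)] ctx[OF s(2)] e
      by (intro free_rel_mem free_rels.op_smult v oc op_smult)
  next
    case (vec_add vs \<nu> i v w)
    let ?u = "\<lambda>v. vs[i := v]"
    have u: "?u z \<in> lists (carrier V)" "length (?u z) = length vs" "\<nu> \<in> ops P (length (?u z))"
      "(\<nu>, ?u z) \<in> symbols P V" if "z \<in> carrier V" for z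
      using vec_add(3,4) update_lists_closed[OF _ that] by (simp_all add: symbols_def)
    \<comment> \<open>The varied vector keeps its place within its block, and this block begins
      after the \<open>length ?c1\<close> vectors of the earlier ones.\<close>
    have e: "?c1 @ ?u z @ ?c2 = (?c1 @ vs @ ?c2)[length ?c1 + i := z]" for z
      using vec_add(5) by (simp add: list_update_append)
    have vw: "v \<oplus>\<^bsub>V\<^esub> w \<in> carrier V" using vec_add by simp
    have v': "?c1 @ vs @ ?c2 \<in> lists (carrier V)" using cc vec_add by simp
    show ?thesis
      unfolding vec_add(1,2) add[OF symb_closed[OF u(1,3)[OF vec_add(6)]] symb_closed[OF u(1,3)[OF vec_add(7)]]]
        ctx[OF u(4)[OF vec_add(6)]] ctx[OF u(4)[OF vec_add(7)]] ctx[OF u(4)[OF vw]] e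
        length_list_update
      by (intro free_rel_mem free_rels.vec_add v' oc vec_add) (use vec_add(5) in simp)
  next
    case (vec_smult vs \<nu> i v r)
    let ?u = "\<lambda>v. vs[i := v]"
    have u: "?u z \<in> lists (carrier V)" "length (?u z) = length vs" "\<nu> \<in> ops P (length (?u z))"
      "(\<nu>, ?u z) \<in> symbols P V" if "z \<in> carrier V" for z
      using vec_smult(3,4) update_lists_closed[OF _ that] by (simp_all add: symbols_def)
    have e: "?c1 @ ?u z @ ?c2 = (?c1 @ vs @ ?c2)[length ?c1 + i := z]" for z
      using vec_smult(5) by (simp add: list_update_append)
    have vw: "r \<odot>\<^bsub>V\<^esub> v \<in> carrier V" using vec_smult by simp
    have v': "?c1 @ vs @ ?c2 \<in> lists (carrier V)" using cc vec_smult by simp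
    show ?thesis
      unfolding vec_smult(1,2) smul[OF symb_closed[OF u(1,3)[OF vec_smult(6)]] vec_smult(7)]
        ctx[OF u(4)[OF vec_smult(6)]] ctx[OF u(4)[OF vw]] e length_list_update
      by (intro free_rel_mem free_rels.vec_smult v' oc vec_smult) (use vec_smult(5) in simp)
  next
    case (coinv vs \<nu> \<sigma>)
    have v: "?c1 @ vs @ ?c2 \<in> lists (carrier V)" using cc coinv by simp
    have s: "(\<nu>, vs) \<in> symbols P V" "(op_sym P (length vs) \<nu> \<sigma>, permute_list \<sigma> vs) \<in> symbols P V"
      using coinv(3-5) permute_closed[OF coinv(3,5)] sym_closed[OF coinv(5,4)] by (simp_all add: symbols_def)
    \<comment> \<open>Identities on all other blocks: permuting inside one argument is a block sum
      of \<open>\<sigma>\<close> with identities, and \<open>comp_args_sym\<close> turns the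
      relation into one for the permutation \<open>sum_perm \<tau>s ?ks\<close> of the
      composite.\<close>
    define \<tau>s :: "(nat \<Rightarrow> nat) list" where "\<tau>s = map (\<lambda>_. id) ss @ \<sigma> # map (\<lambda>_. id) ss'"
    let ?ks = "?k1 @ length vs # ?k2" and ?xss = "map snd ss @ vs # map snd ss'"
    have kx: "?ks = map length ?xss" by simp
    have \<tau>1: "list_all2 (\<lambda>k \<tau>. \<tau> permutes {..<k}) ?ks \<tau>s"
      using coinv(5) by (auto simp: \<tau>s_def list_all2_append list_all2_map1 list_all2_map2 list_all2_same permutes_id
          intro!: list_all2_appendI)
    then have \<tau>2: "list_all2 (\<lambda>xs \<tau>. \<tau> permutes {..<length xs}) ?xss \<tau>s"
      unfolding kx list_all2_map1 .
    have m1: "map2 permute_list (map (\<lambda>_. id) ss) (map snd ss) = map snd ss" for ss :: "('p \<times> 'v list) list"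
      by (induction ss) auto
    have m2: "map (\<lambda>(k, \<nu>, \<tau>). op_sym P k \<nu> \<tau>) (zip (map (length \<circ> snd) ss) (zip (map fst ss) (map (\<lambda>_. id) ss))) = map fst ss"
      if "set ss \<subseteq> symbols P V" for ss
      using that by (induction ss) (auto simp: sym_id dest: symbolsD)
    have e1: "op_comp P ?ks (?n1 @ op_sym P (length vs) \<nu> \<sigma> # ?n2) \<mu> =
        op_sym P (length (?c1 @ vs @ ?c2)) (op_comp P ?ks (?n1 @ \<nu> # ?n2) \<mu>) (sum_perm \<tau>s ?ks)"
      using comp_args_sym[OF ks ns[OF coinv(4)] \<tau>1] m2[OF ss(1)] m2[OF ss(2)]
      unfolding sum[OF refl] by (simp add: \<tau>s_def)
    have e2: "permute_list (sum_perm \<tau>s ?ks) (?c1 @ vs @ ?c2) = ?c1 @ permute_list \<sigma> vs @ ?c2"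
      using permute_sum_perm[OF \<tau>2] unfolding kx[symmetric] by (simp add: \<tau>s_def m1)
    have p: "sum_perm \<tau>s ?ks permutes {..<length (?c1 @ vs @ ?c2)}"
      using sum_perm_permutes[OF \<tau>1] unfolding sum[OF refl] .
    show ?thesis
      unfolding coinv(1,2) ctx[OF s(1)] ctx[OF s(2)] length_permute_list e1 e2[symmetric]
      by (intro free_rel_mem free_rels.coinv v oc coinv p)
  qed
qed

text \<open>The action is linear in the distinguished argument, so the elements that it sends into
  \<open>NN\<close> form a submodule; this submodule contains the generating relations.\<close>

lemma act_free_null:
  assumes x: "x \<in> NN" and ss: "set ss \<subseteq> symbols P V" "set ss' \<subseteq> symbols P V"
    and \<mu>: "\<mu> \<in> ops P (length ss + Suc (length ss'))"
  shows "act FF \<mu> (map sy ss @ x # map sy ss') \<in> NN"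
proof -
  let ?g = "\<lambda>x. act FF \<mu> (map sy ss @ x # map sy ss')"
  note N = free_null_submodule
  have sl: "map sy ss @ \<zero>\<^bsub>FF\<^esub> # map sy ss' \<in> lists (carrier FF)"
    using map_sy_closed[OF ss(1)] map_sy_closed[OF ss(2)] by simp
  have g: "?g \<in> mod_hom R FF FF"
    using FF.act_arg_hom[OF sl, of \<mu> "length ss"] \<mu> by (simp add: list_update_append)
  note gD = mod_homD[OF g]
  have neg: "?g (\<ominus>\<^bsub>FF\<^esub> a) = \<ominus>\<^bsub>FF\<^esub> ?g a" if "a \<in> carrier FF" for a
  proof -
    have "?g ((\<ominus> \<one>) \<odot>\<^bsub>FF\<^esub> a) = (\<ominus> \<one>) \<odot>\<^bsub>FF\<^esub> ?g a" using that by (intro gD) simp_all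
    then show ?thesis using that gD(1)[OF that] by (simp add: FF.smult_l_minus)
  qed
  have "submodule {x \<in> carrier FF. ?g x \<in> NN} R FF"
    by (rule FF.submoduleI)
      (auto simp: gD(2,3) neg mod_hom_zero[OF formal_module formal_module g] FF.submodule_mem[OF N])
  moreover have "x \<ominus>\<^bsub>FF\<^esub> y \<in> {x \<in> carrier FF. ?g x \<in> NN}" if r: "(x, y) \<in> free_rels R P V" for x y
    using free_rels_closed[OF r] act_free_rel[OF r ss \<mu>] mod_hom_minus[OF formal_module formal_module g, of x y]
    by simp
  ultimately have "NN \<subseteq> {x \<in> carrier FF. ?g x \<in> NN}"
    unfolding free_null_def by (rule FF.gen_submodule_least)
  then show ?thesis using x by blast
qed

text \<open>\<open>free_null\<close> is generated as a submodule only; absorption of the action is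
  what lets the operations descend. The other arguments are symbols in \<open>act_free_null\<close>
  and are now extended to arbitrary combinations.\<close>

lemma free_null_ideal: "alg_ideal R P FF NN"
proof -
  note N = free_null_submodule
  have "act FF \<mu> (ys @ x # zs) \<in> NN"
    if x: "x \<in> NN" and ys: "ys \<in> lists (carrier FF)" and zs: "zs \<in> lists (carrier FF)"
      and \<mu>: "\<mu> \<in> ops P (length ys + Suc (length zs))" for x ys zs \<mu>
  proof -
    define k where "k = length ys"
    define n where "n = length (ys @ zs)"
    have kn: "k \<le> n" and \<mu>: "\<mu> \<in> ops P (Suc n)" using \<mu> by (simp_all add: k_def n_def)
    have xc: "x \<in> carrier FF" using x FF.submodule_mem(1)[OF N] by blast
    \<comment> \<open>The list \<open>ws\<close> holds the \<open>n\<close> other arguments and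
      \<open>x\<close> is inserted at place \<open>k\<close>, so the multilinear induction never
      touches \<open>x\<close>.\<close>
    let ?Q = "\<lambda>ws. act FF \<mu> (take k ws @ x # drop k ws) \<in> NN"
    \<comment> \<open>An entry of \<open>ws\<close> is also an entry of the full list, to the left
      or to the right of \<open>x\<close>, depending on how it compares with
      \<open>k\<close>.\<close>
    have split: "\<exists>ps qs. ps \<in> lists (carrier FF) \<and> qs \<in> lists (carrier FF) \<and> length ps + Suc (length qs) = Suc n \<and>
        x \<in> set ps \<union> set qs \<and> (\<forall>a. take k (us @ a # vs) @ x # drop k (us @ a # vs) = ps @ a # qs)"
      if "us \<in> lists (carrier FF)" "vs \<in> lists (carrier FF)" "length us + Suc (length vs) = n" for us vs
    proof (cases "k \<le> length us")
      case True
      then show ?thesis using that xc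
        by (intro exI[of _ "take k us @ x # drop k us"] exI[of _ vs]) (auto dest: in_set_takeD in_set_dropD)
    next
      case False
      then obtain j where j: "k = Suc (length us + j)" using less_imp_Suc_add[of "length us" k] by auto
      then show ?thesis using that xc kn
        by (intro exI[of _ us] exI[of _ "take j vs @ x # drop j vs"]) (auto dest: in_set_takeD in_set_dropD)
    qed
    have "ys @ zs \<in> lists (carrier FF)" using ys zs by simp
    from formal_module formal_spans this n_def[symmetric] have "?Q (ys @ zs)"
    proof (induction rule: multilinear_induct)
      case (gen ws)
      then obtain ss where "ss \<in> lists (symbols P V)" and ss: "ws = map sy ss" using lists_image_ex[OF gen(1)] by blast
      then have "set ss \<subseteq> symbols P V" by auto
      then have "set (take k ss) \<subseteq> symbols P V" "set (drop k ss) \<subseteq> symbols P V"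
        by (meson order_trans set_take_subset set_drop_subset)+
      then show ?case
        using act_free_null[OF x, of "take k ss" "drop k ss" \<mu>] \<mu> gen(2) kn ss by (simp add: take_map drop_map)
    next
      case (zero us vs)
      from split[OF zero] obtain ps qs where pq: "ps \<in> lists (carrier FF)" "qs \<in> lists (carrier FF)"
        "length ps + Suc (length qs) = Suc n" "\<And>a. take k (us @ a # vs) @ x # drop k (us @ a # vs) = ps @ a # qs" by blast
      have "act FF \<mu> (ps @ \<zero>\<^bsub>FF\<^esub> # qs) = \<zero>\<^bsub>FF\<^esub>"
        using pq(1-3) \<mu> by (intro FF.act_zero_mem) simp_all
      then show ?case unfolding pq(4) using FF.submodule_mem(2)[OF N] by simp
    next
      case (add us vs a b)
      from split[OF add(1-3)] obtain ps qs where pq: "ps \<in> lists (carrier FF)" "qs \<in> lists (carrier FF)"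
        "length ps + Suc (length qs) = Suc n" "\<And>a. take k (us @ a # vs) @ x # drop k (us @ a # vs) = ps @ a # qs" by blast
      have "act FF \<mu> (ps @ (a \<oplus>\<^bsub>FF\<^esub> b) # qs) = act FF \<mu> (ps @ a # qs) \<oplus>\<^bsub>FF\<^esub> act FF \<mu> (ps @ b # qs)"
        using pq(3) \<mu> by (intro FF.act_split_add pq(1,2) add(4,5)) simp
      then show ?case using add(6,7) unfolding pq(4) by (simp add: FF.submodule_mem(3)[OF N])
    next
      case (smult us vs a r)
      from split[OF smult(1-3)] obtain ps qs where pq: "ps \<in> lists (carrier FF)" "qs \<in> lists (carrier FF)"
        "length ps + Suc (length qs) = Suc n" "\<And>a. take k (us @ a # vs) @ x # drop k (us @ a # vs) = ps @ a # qs" by blast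
      have "act FF \<mu> (ps @ (r \<odot>\<^bsub>FF\<^esub> a) # qs) = r \<odot>\<^bsub>FF\<^esub> act FF \<mu> (ps @ a # qs)"
        using pq(3) \<mu> by (intro FF.act_split_smult pq(1,2) smult(4,5)) simp
      then show ?case using smult(5,6) unfolding pq(4) by (simp add: FF.submodule_mem(5)[OF N])
    qed
    then show ?thesis by (simp add: k_def)
  qed
  note * = this
  have "act FF \<mu> xs \<in> NN" if xs: "xs \<in> lists (carrier FF)" "\<mu> \<in> ops P (length xs)" "x \<in> set xs" "x \<in> NN" for xs \<mu> x
  proof -
    obtain ys zs where e: "xs = ys @ x # zs" using xs(3) by (metis split_list)
    show ?thesis using xs(1,2) unfolding e by (intro *[OF xs(4)]) simp_all
  qed
  then show ?thesis unfolding alg_ideal_def using N by blast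
qed

end

section \<open>The free algebra satisfies the laws of an algebra\<close>

context operad_module
begin

interpretation FF: multilinear_act R P FF by (rule formal_multilinear_act)

abbreviation "SS \<equiv> free_alg R P V"

definition fe :: "'p \<times> 'v list \<Rightarrow> ('r, 'p, 'v) free" where
  "fe s = free_elem R P V (fst s) (snd s)"

lemma fe_eq: "fe s = NN +>\<^bsub>FF\<^esub> sy s"
  by (simp add: fe_def free_elem_def sy_def)

lemma free_multilinear_act: "multilinear_act R P SS"
  unfolding free_alg_def by (rule FF.quot_multilinear_act) (rule free_null_ideal)

interpretation SS: multilinear_act R P SS by (rule free_multilinear_act)

lemma free_proj_hom: "(\<lambda>x. NN +>\<^bsub>FF\<^esub> x) \<in> mod_hom R FF SS"
  unfolding free_alg_def by (rule FF.quot_proj_hom) (rule free_null_submodule)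

lemma fe_closed: "s \<in> symbols P V \<Longrightarrow> fe s \<in> carrier SS"
  unfolding fe_eq using mod_homD(1)[OF free_proj_hom] sy_closed by blast

lemma free_spans: "spans R SS (fe ` symbols P V)"
proof -
  have "(\<lambda>x. NN +>\<^bsub>FF\<^esub> x) ` carrier FF = carrier SS" by (simp add: free_alg_def)
  from spans_image[OF formal_module SS.module_axioms free_proj_hom this formal_spans]
  show ?thesis by (simp add: fe_eq image_image)
qed

lemma free_act: "set ss \<subseteq> symbols P V \<Longrightarrow> \<mu> \<in> ops P (length ss) \<Longrightarrow>
    act SS \<mu> (map fe ss) = fe (comp_symbols P \<mu> ss)"
  using FF.quot_act[OF free_null_ideal map_sy_closed[of ss], of \<mu>] formal_act_sy[of ss \<mu>]
  by (simp add: free_alg_def fe_eq[abs_def] comp_def)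

lemma free_rel_eq:
  assumes "(x, y) \<in> free_rels R P V"
  shows "NN +>\<^bsub>FF\<^esub> x = NN +>\<^bsub>FF\<^esub> y"
  using FF.coset_eq_iff[OF free_null_submodule] free_rels_closed[OF assms] free_rel_mem[OF assms] by blast

lemma fe_add:
  assumes "vs \<in> lists (carrier V)" "\<mu> \<in> ops P (length vs)" "\<mu>' \<in> ops P (length vs)"
  shows "fe (\<mu> \<oplus>\<^bsub>op_mod P (length vs)\<^esub> \<mu>', vs) = fe (\<mu>, vs) \<oplus>\<^bsub>SS\<^esub> fe (\<mu>', vs)"
  using free_rel_eq[OF free_rels.op_add[OF assms]]
    mod_homD(2)[OF free_proj_hom symb_closed[OF assms(1,2)] symb_closed[OF assms(1,3)]]
  by (simp add: fe_eq sy_def)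

lemma fe_smult:
  assumes "vs \<in> lists (carrier V)" "\<mu> \<in> ops P (length vs)" "r \<in> carrier R"
  shows "fe (r \<odot>\<^bsub>op_mod P (length vs)\<^esub> \<mu>, vs) = r \<odot>\<^bsub>SS\<^esub> fe (\<mu>, vs)"
  using free_rel_eq[OF free_rels.op_smult[OF assms]]
    mod_homD(3)[OF free_proj_hom assms(3) symb_closed[OF assms(1,2)]]
  by (simp add: fe_eq sy_def)

lemma fe_sym:
  assumes "vs \<in> lists (carrier V)" "\<mu> \<in> ops P (length vs)" "\<sigma> permutes {..<length vs}"
  shows "fe (op_sym P (length vs) \<mu> \<sigma>, permute_list \<sigma> vs) = fe (\<mu>, vs)"
  using free_rel_eq[OF free_rels.coinv[OF assms]] by (simp add: fe_eq sy_def)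

lemma symbols_blocks:
  assumes "set ss \<subseteq> symbols P V"
  shows "list_all2 (\<lambda>k \<nu>. \<nu> \<in> ops P k) (map (length \<circ> snd) ss) (map fst ss)"
    and "concat (map snd ss) \<in> lists (carrier V)"
    and "length (concat (map snd ss)) = sum_list (map (length \<circ> snd) ss)"
proof -
  show "list_all2 (\<lambda>k \<nu>. \<nu> \<in> ops P k) (map (length \<circ> snd) ss) (map fst ss)"
    unfolding list_all2_map1 list_all2_map2 list_all2_same comp_def using assms symbolsD by blast
  show "concat (map snd ss) \<in> lists (carrier V)"
    using assms symbolsD by (fastforce simp: in_lists_conv_set)
qed (simp add: length_concat comp_def)

text \<open>On classes of symbols each law is an axiom for composition in the operad. Linearity in
  the operation and symmetry also use the relations of the same kind, while unit and composition
  already hold for the symbols themselves.\<close>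

theorem free_operad_algebra: "operad_algebra R P SS"
proof (rule SS.operad_algebraI[OF free_spans])
  fix xs \<mu> \<mu>' assume xs: "xs \<in> lists (fe ` symbols P V)" "\<mu> \<in> ops P (length xs)" "\<mu>' \<in> ops P (length xs)"
  obtain ss where "ss \<in> lists (symbols P V)" and e: "xs = map fe ss" using lists_image_ex[OF xs(1)] by blast
  then have ss: "set ss \<subseteq> symbols P V" by auto
  let ?ks = "map (length \<circ> snd) ss" and ?ns = "map fst ss"
  note b = symbols_blocks[OF ss]
  have \<mu>: "\<mu> \<in> ops P (length ss)" "\<mu>' \<in> ops P (length ss)" using xs e by simp_all
  then have \<mu>k: "\<mu> \<in> ops P (length ?ks)" "\<mu>' \<in> ops P (length ?ks)" by simp_all
  have "act SS (\<mu> \<oplus>\<^bsub>op_mod P (length ss)\<^esub> \<mu>') (map fe ss) = fe (comp_symbols P \<mu> ss) \<oplus>\<^bsub>SS\<^esub> fe (comp_symbols P \<mu>' ss)"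
    using comp_add[OF \<mu>k b(1)] comp_closed[OF \<mu>k(1) b(1)] comp_closed[OF \<mu>k(2) b(1)] b(3)
      fe_add[OF b(2), of "op_comp P ?ks ?ns \<mu>" "op_comp P ?ks ?ns \<mu>'"]
      free_act[OF ss op_mod_closed(1)[OF \<mu>]]
    by (simp add: comp_symbols_def)
  then show "act SS (\<mu> \<oplus>\<^bsub>op_mod P (length xs)\<^esub> \<mu>') xs = act SS \<mu> xs \<oplus>\<^bsub>SS\<^esub> act SS \<mu>' xs"
    using free_act[OF ss \<mu>(1)] free_act[OF ss \<mu>(2)] e by simp
next
  fix xs \<mu> r assume xs: "xs \<in> lists (fe ` symbols P V)" "\<mu> \<in> ops P (length xs)" "r \<in> carrier R"
  obtain ss where "ss \<in> lists (symbols P V)" and e: "xs = map fe ss" using lists_image_ex[OF xs(1)] by blast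
  then have ss: "set ss \<subseteq> symbols P V" by auto
  let ?ks = "map (length \<circ> snd) ss" and ?ns = "map fst ss"
  note b = symbols_blocks[OF ss]
  have \<mu>: "\<mu> \<in> ops P (length ss)" using xs e by simp_all
  then have \<mu>k: "\<mu> \<in> ops P (length ?ks)" by simp_all
  have "act SS (r \<odot>\<^bsub>op_mod P (length ss)\<^esub> \<mu>) (map fe ss) = r \<odot>\<^bsub>SS\<^esub> fe (comp_symbols P \<mu> ss)"
    using comp_smult[OF \<mu>k xs(3) b(1)] comp_closed[OF \<mu>k(1) b(1)] b(3)
      fe_smult[OF b(2), of "op_comp P ?ks ?ns \<mu>" r] xs(3)
      free_act[OF ss op_mod_closed(2)[OF \<mu> xs(3)]]
    by (simp add: comp_symbols_def)
  then show "act SS (r \<odot>\<^bsub>op_mod P (length xs)\<^esub> \<mu>) xs = r \<odot>\<^bsub>SS\<^esub> act SS \<mu> xs"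
    using free_act[OF ss \<mu>(1)] e by simp
next
  fix x assume "x \<in> fe ` symbols P V"
  then obtain s where s: "s \<in> symbols P V" "x = fe s" by blast
  have "comp_symbols P (op_unit P) [s] = s"
    using symbolsD[OF s(1)] comp_unit_left[of "fst s" "length (snd s)"] by (simp add: comp_symbols_def)
  then show "act SS (op_unit P) [x] = x"
    using free_act[of "[s]" "op_unit P"] unit_closed s by simp
next
  fix xss \<mu> \<nu>s assume xss: "xss \<in> lists (lists (fe ` symbols P V))" "\<mu> \<in> ops P (length xss)"
    and "list_all2 (\<lambda>xs \<nu>. \<nu> \<in> ops P (length xs)) xss \<nu>s"
  have "xss \<in> lists (map fe ` lists (symbols P V))" using xss(1) by (simp add: lists_image)
  from lists_image_ex[OF this] obtain sss where "sss \<in> lists (lists (symbols P V))" and e: "xss = map (map fe) sss"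
    by blast
  then have sss: "\<And>ss. ss \<in> set sss \<Longrightarrow> set ss \<subseteq> symbols P V" by auto
  then have cs: "set (concat sss) \<subseteq> symbols P V" by auto
  have \<nu>s: "list_all2 (\<lambda>ss \<nu>. \<nu> \<in> ops P (length ss)) sss \<nu>s"
    using \<open>list_all2 _ xss \<nu>s\<close> by (simp add: e list_all2_map1)
  have \<mu>: "\<mu> \<in> ops P (length sss)" using xss(2) e by simp
  let ?lss = "map (map (length \<circ> snd)) sss" and ?xss = "map (map fst) sss"
  have "op_comp P (map length sss) \<nu>s \<mu> \<in> ops P (length (concat sss))"
    using comp_closed[of \<mu> "map length sss" \<nu>s] \<mu> \<nu>s by (simp add: list_all2_map1 length_concat)
  then have l: "act SS (op_comp P (map length sss) \<nu>s \<mu>) (map fe (concat sss)) =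
      fe (comp_symbols P (op_comp P (map length sss) \<nu>s \<mu>) (concat sss))"
    by (rule free_act[OF cs])
  have r1: "map2 (act SS) \<nu>s (map (map fe) sss) = map fe (map2 (comp_symbols P) \<nu>s sss) \<and>
      set (map2 (comp_symbols P) \<nu>s sss) \<subseteq> symbols P V"
    using \<nu>s sss by induction (auto simp: free_act intro!: subsetD[OF _ comp_symbols_closed] comp_symbols_closed)
  have len: "length \<nu>s = length sss" using list_all2_lengthD[OF \<nu>s] by simp
  have r: "act SS \<mu> (map2 (act SS) \<nu>s (map (map fe) sss)) = fe (comp_symbols P \<mu> (map2 (comp_symbols P) \<nu>s sss))"
    using r1 \<mu> len free_act[of "map2 (comp_symbols P) \<nu>s sss" \<mu>] by simp
  \<comment> \<open>Associativity in the operad, with the numbers of vectors in the symbols as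
    innermost arities. On the vectors it is matched by the associativity of concatenation.\<close>
  have as: "op_comp P (concat ?lss) (concat ?xss) (op_comp P (map length ?lss) \<nu>s \<mu>) =
      op_comp P (map sum_list ?lss)
        (map (\<lambda>(ls, \<xi>s, \<nu>). op_comp P ls \<xi>s \<nu>) (zip ?lss (zip ?xss \<nu>s))) \<mu>"
  proof (rule comp_assoc)
    show "list_all2 (\<lambda>ls \<nu>. \<nu> \<in> ops P (length ls)) ?lss \<nu>s" using \<nu>s by (simp add: list_all2_map1)
    show "list_all2 (list_all2 (\<lambda>l \<xi>. \<xi> \<in> ops P l)) ?lss ?xss"
      unfolding list_all2_map1[of _ "map (length \<circ> snd)"] list_all2_map2[of _ _ "map fst"] list_all2_same
      using symbols_blocks(1) sss by blast
  qed (use \<mu> in simp)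
  have m: "map (length \<circ> snd) (map2 (comp_symbols P) \<nu>s sss) = map sum_list ?lss \<and>
     map fst (map2 (comp_symbols P) \<nu>s sss) = map (\<lambda>(ls, \<xi>s, \<nu>). op_comp P ls \<xi>s \<nu>) (zip ?lss (zip ?xss \<nu>s)) \<and>
     map snd (map2 (comp_symbols P) \<nu>s sss) = map (\<lambda>ss. concat (map snd ss)) sss"
    using len by (induction rule: list_induct2) (auto simp: comp_symbols_def length_concat comp_def)
  have cm: "concat (map snd (concat sss)) = concat (map (\<lambda>ss. concat (map snd ss)) sss)"
    by (induction sss) simp_all
  have "comp_symbols P (op_comp P (map length sss) \<nu>s \<mu>) (concat sss) = comp_symbols P \<mu> (map2 (comp_symbols P) \<nu>s sss)"
    using as m cm by (simp add: comp_symbols_def map_concat comp_def)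
  then show "act SS (op_comp P (map length xss) \<nu>s \<mu>) (concat xss) = act SS \<mu> (map2 (act SS) \<nu>s xss)"
    using l r e by (simp add: map_concat comp_def)
next
  fix xs \<mu> \<sigma> assume xs: "xs \<in> lists (fe ` symbols P V)" "\<mu> \<in> ops P (length xs)" "\<sigma> permutes {..<length xs}"
  obtain ss where "ss \<in> lists (symbols P V)" and e: "xs = map fe ss" using lists_image_ex[OF xs(1)] by blast
  then have ss: "set ss \<subseteq> symbols P V" by auto
  let ?ks = "map (length \<circ> snd) ss" and ?ns = "map fst ss" and ?c = "concat (map snd ss)"
  note b = symbols_blocks[OF ss]
  have \<mu>: "\<mu> \<in> ops P (length ss)" and \<sigma>: "\<sigma> permutes {..<length ss}" using xs e by simp_all
  then have \<mu>k: "\<mu> \<in> ops P (length ?ks)" and \<sigma>k: "\<sigma> permutes {..<length ?ks}"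
      and \<sigma>s: "\<sigma> permutes {..<length (map snd ss)}" by simp_all
  have pss: "set (permute_list \<sigma> ss) \<subseteq> symbols P V" using ss \<sigma> by simp
  have p: "op_sym P (length ss) \<mu> \<sigma> \<in> ops P (length (permute_list \<sigma> ss))" using sym_closed[OF \<sigma> \<mu>] by simp
  have kk: "map length (map snd ss) = ?ks" by simp
  \<comment> \<open>Permuting arguments permutes whole blocks of vectors. By \<open>comp_sym\<close>
    the same block permutation acts on the composite operation, so one instance of
    \<open>coinv\<close> removes both.\<close>
  have "comp_symbols P (op_sym P (length ss) \<mu> \<sigma>) (permute_list \<sigma> ss) =
      (op_sym P (length ?c) (op_comp P ?ks ?ns \<mu>) (block_perm \<sigma> ?ks), permute_list (block_perm \<sigma> ?ks) ?c)"
    using comp_sym[OF \<mu>k b(1) \<sigma>k] permute_block_perm[OF \<sigma>s] b(3)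
    unfolding kk by (simp add: comp_symbols_def permute_list_map[OF \<sigma>])
  moreover have "fe (op_sym P (length ?c) (op_comp P ?ks ?ns \<mu>) (block_perm \<sigma> ?ks), permute_list (block_perm \<sigma> ?ks) ?c) =
      fe (op_comp P ?ks ?ns \<mu>, ?c)"
    using comp_closed[OF \<mu>k b(1)] block_perm_permutes[OF \<sigma>k] b(3) by (intro fe_sym b(2)) simp_all
  ultimately have "act SS (op_sym P (length ss) \<mu> \<sigma>) (map fe (permute_list \<sigma> ss)) = fe (comp_symbols P \<mu> ss)"
    using free_act[OF pss p] by (simp add: comp_symbols_def)
  then show "act SS (op_sym P (length xs) \<mu> \<sigma>) (permute_list \<sigma> xs) = act SS \<mu> xs"
    using free_act[OF ss \<mu>] e permute_list_map[OF \<sigma>, of fe] by simp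
qed

section \<open>Universal property of the free algebra\<close>

definition fgen :: "'v \<Rightarrow> ('r, 'p, 'v) free" where
  "fgen v = free_elem R P V (op_unit P) [v]"

lemma fgen_eq: "fgen v = fe (op_unit P, [v])"
  by (simp add: fgen_def fe_def)

lemma unit_symbol: "v \<in> carrier V \<Longrightarrow> (op_unit P, [v]) \<in> symbols P V"
  using unit_closed by (simp add: symbols_def)

text \<open>The right unit law of the operad absorbs the units inserted by \<open>fgen\<close>.
  Classes of symbols thereby become expressions in the generators, on which morphisms can be
  computed.\<close>

lemma free_elem_eq_act:
  assumes "vs \<in> lists (carrier V)" "\<mu> \<in> ops P (length vs)"
  shows "free_elem R P V \<mu> vs = act SS \<mu> (map fgen vs)"
proof -
  let ?ss = "map (\<lambda>v. (op_unit P, [v])) vs"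
  have ss: "set ?ss \<subseteq> symbols P V" using assms(1) unit_symbol by auto
  have 1: "map (length \<circ> snd) ?ss = replicate (length vs) 1" "map fst ?ss = replicate (length vs) (op_unit P)"
    "concat (map snd ?ss) = vs" by (induction vs) auto
  have "comp_symbols P \<mu> ?ss = (\<mu>, vs)"
    unfolding comp_symbols_def 1 using comp_unit_right[OF assms(2)] by simp
  then show ?thesis using free_act[OF ss, of \<mu>] assms(2) by (simp add: fgen_eq[abs_def] fe_def comp_def)
qed

lemma fgen_hom: "fgen \<in> mod_hom R V SS"
proof (rule mod_homI)
  have u: "op_unit P \<in> ops P (length [v])" for v :: 'v using unit_closed by simp
  fix v assume v: "v \<in> carrier V"
  show "fgen v \<in> carrier SS" unfolding fgen_eq by (rule fe_closed[OF unit_symbol]) fact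
  have s: "symb R (op_unit P) [v] \<in> carrier FF" if "v \<in> carrier V" for v
    using that u by (intro symb_closed) simp_all
  { fix w assume w: "w \<in> carrier V"
    have "NN +>\<^bsub>FF\<^esub> symb R (op_unit P) ([v][0 := v \<oplus>\<^bsub>V\<^esub> w]) =
        NN +>\<^bsub>FF\<^esub> (symb R (op_unit P) ([v][0 := v]) \<oplus>\<^bsub>FF\<^esub> symb R (op_unit P) ([v][0 := w]))"
      using v w u by (intro free_rel_eq free_rels.vec_add) simp_all
    then show "fgen (v \<oplus>\<^bsub>V\<^esub> w) = fgen v \<oplus>\<^bsub>SS\<^esub> fgen w"
      using mod_homD(2)[OF free_proj_hom s[OF v] s[OF w]] by (simp add: fgen_def free_elem_def)
  }
  { fix r assume r: "r \<in> carrier R"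
    have "NN +>\<^bsub>FF\<^esub> symb R (op_unit P) ([v][0 := r \<odot>\<^bsub>V\<^esub> v]) =
        NN +>\<^bsub>FF\<^esub> (r \<odot>\<^bsub>FF\<^esub> symb R (op_unit P) ([v][0 := v]))"
      using v r u by (intro free_rel_eq free_rels.vec_smult) simp_all
    then show "fgen (r \<odot>\<^bsub>V\<^esub> v) = r \<odot>\<^bsub>SS\<^esub> fgen v"
      using mod_homD(3)[OF free_proj_hom r s[OF v]] by (simp add: fgen_def free_elem_def)
  }
qed

lemma fgen_closed: "v \<in> carrier V \<Longrightarrow> fgen v \<in> carrier SS"
  using mod_homD(1)[OF fgen_hom] .

text \<open>Classes of symbols span, and each is an operation applied to generators.\<close>

lemma free_ext:
  assumes E: "multilinear_act R P E" and f: "f \<in> alg_hom R P SS E" and g: "g \<in> alg_hom R P SS E"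
    and eq: "\<And>v. v \<in> carrier V \<Longrightarrow> f (fgen v) = g (fgen v)"
  shows "f = g"
proof (rule alg_hom_eqI[OF f g])
  interpret E: multilinear_act R P E by fact
  fix x assume x: "x \<in> carrier SS"
  show "f x = g x"
  proof (rule mod_hom_eq_on_span[OF SS.module_axioms E.module_axioms alg_hom_mod_hom[OF f] alg_hom_mod_hom[OF g]
        free_spans _ x])
    fix y assume "y \<in> fe ` symbols P V"
    then obtain s where s: "s \<in> symbols P V" "y = fe s" by blast
    note sD = symbolsD[OF s(1)]
    have l: "map fgen (snd s) \<in> lists (carrier SS)" using sD fgen_closed by auto
    have y: "y = act SS (fst s) (map fgen (snd s))" using free_elem_eq_act sD s(2) by (simp add: fe_def)
    have m: "map f (map fgen (snd s)) = map g (map fgen (snd s))" using eq sD by auto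
    have o: "fst s \<in> ops P (length (map fgen (snd s)))" using sD by simp
    show "f y = g y" unfolding y alg_hom_act[OF f l o] alg_hom_act[OF g l o] m ..
  qed
qed

text \<open>The value on a symbol is forced: its operation applied to the images of its vectors. The
  relations of the free algebra then hold in \<open>E\<close> by linearity and symmetry, and respect
  for operations on symbols is the composition law of \<open>E\<close>.\<close>

theorem free_lift:
  assumes E: "operad_algebra R P E" and \<phi>: "\<phi> \<in> mod_hom R V E"
  shows "\<exists>G\<in>alg_hom R P SS E. \<forall>v\<in>carrier V. G (fgen v) = \<phi> v"
proof -
  interpret M: multilinear_act R P E by (rule operad_algebra_imp_multilinear) fact
  interpret E: operad_algebra R P E by fact
  note \<phi>D = mod_homD[OF \<phi>]
  define h where "h s = act E (fst s) (map \<phi> (snd s))" for s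
  have \<phi>l: "map \<phi> vs \<in> lists (carrier E)" if "vs \<in> lists (carrier V)" for vs using that \<phi>D(1) by auto
  have hc: "h s \<in> carrier E" if "s \<in> symbols P V" for s
    unfolding h_def using symbolsD[OF that] \<phi>l by (intro M.act_closed) auto
  obtain F where F: "F \<in> mod_hom R FF E" and Fs: "\<And>s. s \<in> symbols P V \<Longrightarrow> F (sy s) = h s"
    using formal_ext[of E h] hc M.module_axioms by blast
  note FD = mod_homD[OF F]
  have Fsy: "F (symb R \<mu> vs) = act E \<mu> (map \<phi> vs)" if "vs \<in> lists (carrier V)" "\<mu> \<in> ops P (length vs)" for \<mu> vs
    using Fs[of "(\<mu>, vs)"] that by (simp add: sy_def symbols_def h_def)
  have upd: "F (symb R \<mu> (vs[i := v])) = act E \<mu> ((map \<phi> vs)[i := \<phi> v])"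
    if "vs \<in> lists (carrier V)" "\<mu> \<in> ops P (length vs)" "v \<in> carrier V" for \<mu> vs i v
    using Fsy[OF update_lists_closed[OF that(1,3), of i], of \<mu>] that(2) by (simp add: map_update)
  have us: "symb R \<mu> (vs[i := v]) \<in> carrier FF"
    if "vs \<in> lists (carrier V)" "\<mu> \<in> ops P (length vs)" "v \<in> carrier V" for \<mu> vs i v
    using update_lists_closed[OF that(1,3)] that(2) by (intro symb_closed) simp_all
  have rel: "F x = F y" if "(x, y) \<in> free_rels R P V" for x y
    using that
  proof cases
    case (op_add vs \<mu> \<mu>')
    have l: "map \<phi> vs \<in> lists (carrier E)" "\<mu> \<in> ops P (length (map \<phi> vs))" "\<mu>' \<in> ops P (length (map \<phi> vs))"
      using op_add \<phi>l by simp_all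
    show ?thesis
      unfolding op_add(1,2) FD(2)[OF symb_closed[OF op_add(3,4)] symb_closed[OF op_add(3,5)]]
        Fsy[OF op_add(3,4)] Fsy[OF op_add(3,5)] Fsy[OF op_add(3) op_mod_closed(1)[OF op_add(4,5)]]
      using E.act_add[OF l] by simp
  next
    case (op_smult vs \<mu> r)
    have l: "map \<phi> vs \<in> lists (carrier E)" "\<mu> \<in> ops P (length (map \<phi> vs))"
      using op_smult \<phi>l by simp_all
    show ?thesis
      unfolding op_smult(1,2) FD(3)[OF op_smult(5) symb_closed[OF op_smult(3,4)]]
        Fsy[OF op_smult(3,4)] Fsy[OF op_smult(3) op_mod_closed(2)[OF op_smult(4,5)]]
      using E.act_smult[OF l op_smult(5)] by simp
  next
    case (vec_add vs \<mu> i v w)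
    have l: "map \<phi> vs \<in> lists (carrier E)" "\<mu> \<in> ops P (length (map \<phi> vs))" "i < length (map \<phi> vs)"
      using vec_add \<phi>l by simp_all
    have vw: "v \<oplus>\<^bsub>V\<^esub> w \<in> carrier V" using vec_add by simp
    show ?thesis
      unfolding vec_add(1,2) FD(2)[OF us[OF vec_add(3,4,6)] us[OF vec_add(3,4,7)]]
        upd[OF vec_add(3,4,6)] upd[OF vec_add(3,4,7)] upd[OF vec_add(3,4) vw] \<phi>D(2)[OF vec_add(6,7)]
      using \<phi>D(1) vec_add by (intro E.act_args_add[OF l]) simp_all
  next
    case (vec_smult vs \<mu> i v r)
    have l: "map \<phi> vs \<in> lists (carrier E)" "\<mu> \<in> ops P (length (map \<phi> vs))" "i < length (map \<phi> vs)"
      using vec_smult \<phi>l by simp_all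
    have vw: "r \<odot>\<^bsub>V\<^esub> v \<in> carrier V" using vec_smult by simp
    show ?thesis
      unfolding vec_smult(1,2) FD(3)[OF vec_smult(7) us[OF vec_smult(3,4,6)]]
        upd[OF vec_smult(3,4,6)] upd[OF vec_smult(3,4) vw] \<phi>D(3)[OF vec_smult(7,6)]
      using \<phi>D(1) vec_smult by (intro E.act_args_smult[OF l]) simp_all
  next
    case (coinv vs \<mu> \<sigma>)
    have l: "map \<phi> vs \<in> lists (carrier E)" "\<mu> \<in> ops P (length (map \<phi> vs))" "\<sigma> permutes {..<length (map \<phi> vs)}"
      using coinv \<phi>l by simp_all
    have "op_sym P (length vs) \<mu> \<sigma> \<in> ops P (length (permute_list \<sigma> vs))" using sym_closed[OF coinv(5,4)] by simp
    then show ?thesis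
      unfolding coinv(1,2) Fsy[OF coinv(3,4)] using Fsy[OF permute_closed[OF coinv(3,5)]] E.act_sym[OF l]
        permute_list_map[OF coinv(5), of \<phi>] by simp
  qed
  have "NN \<subseteq> {x \<in> carrier FF. F x = \<zero>\<^bsub>E\<^esub>}"
    unfolding free_null_def
  proof (rule FF.gen_submodule_least[OF mod_hom_kernel_submodule[OF formal_module M.module_axioms F]])
    fix x y assume r: "(x, y) \<in> free_rels R P V"
    note c = free_rels_closed[OF r]
    then show "x \<ominus>\<^bsub>FF\<^esub> y \<in> {x \<in> carrier FF. F x = \<zero>\<^bsub>E\<^esub>}"
      using mod_hom_minus[OF formal_module M.module_axioms F, of x y] rel[OF r] M.minus_eq_zero_iff FD(1) by simp
  qed
  then have null: "\<And>x. x \<in> NN \<Longrightarrow> F x = \<zero>\<^bsub>E\<^esub>" by blast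
  have Fact: "F (act FF \<mu> xs) = act E \<mu> (map F xs)" if "xs \<in> lists (carrier FF)" "\<mu> \<in> ops P (length xs)" for xs \<mu>
  proof (rule act_preserving_on_span[OF FF.multilinear_act_axioms M.multilinear_act_axioms F formal_spans _ that])
    fix xs \<mu> assume xs: "xs \<in> lists (sy ` symbols P V)" and \<mu>: "\<mu> \<in> ops P (length xs)"
    obtain ss where "ss \<in> lists (symbols P V)" and e: "xs = map sy ss" using lists_image_ex[OF xs(1)] by blast
    then have ss: "set ss \<subseteq> symbols P V" by auto
    have \<mu>': "\<mu> \<in> ops P (length ss)" using \<mu> e by simp
    have al: "list_all2 (\<lambda>as \<nu>. \<nu> \<in> ops P (length as)) (map (map \<phi>) (map snd ss)) (map fst ss)"
      unfolding list_all2_map1 list_all2_map2 list_all2_same using ss symbolsD by fastforce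
    have ll: "map (map \<phi>) (map snd ss) \<in> lists (lists (carrier E))"
      using ss symbolsD \<phi>l by (fastforce simp: in_lists_conv_set)
    have "F (act FF \<mu> xs) = h (comp_symbols P \<mu> ss)"
      unfolding e formal_act_sy[OF ss] by (rule Fs[OF comp_symbols_closed[OF ss \<mu>']])
    also have "\<dots> = act E (op_comp P (map length (map (map \<phi>) (map snd ss))) (map fst ss) \<mu>)
        (concat (map (map \<phi>) (map snd ss)))"
      by (simp add: h_def comp_symbols_def map_concat comp_def)
    also have "\<dots> = act E \<mu> (map2 (act E) (map fst ss) (map (map \<phi>) (map snd ss)))"
      using \<mu>' by (intro E.act_comp[OF ll _ al]) simp
    also have "map2 (act E) (map fst ss) (map (map \<phi>) (map snd ss)) = map h ss"
      by (induction ss) (auto simp: h_def)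
    also have "map h ss = map F xs" using ss Fs e by auto
    finally show "F (act FF \<mu> xs) = act E \<mu> (map F xs)" .
  qed
  from FF.quot_lift[OF free_null_ideal M.multilinear_act_axioms F Fact null]
  obtain G where G: "G \<in> alg_hom R P SS E" "\<And>x. x \<in> carrier FF \<Longrightarrow> G (NN +>\<^bsub>FF\<^esub> x) = F x"
    unfolding free_alg_def by blast
  have "G (fgen v) = \<phi> v" if v: "v \<in> carrier V" for v
  proof -
    have "G (fgen v) = F (sy (op_unit P, [v]))"
      unfolding fgen_eq fe_eq by (rule G(2)[OF sy_closed[OF unit_symbol[OF v]]])
    also have "\<dots> = act E (op_unit P) [\<phi> v]" using Fs[OF unit_symbol[OF v]] by (simp add: h_def)
    also have "\<dots> = \<phi> v" by (rule E.act_unit[OF \<phi>D(1)[OF v]])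
    finally show ?thesis .
  qed
  then show ?thesis using G(1) by blast
qed

end

section \<open>Dual numbers over an algebra\<close>

lemma prod_mod_simps [simp]:
  "carrier (prod_mod M N) = carrier M \<times> carrier N"
  "\<zero>\<^bsub>prod_mod M N\<^esub> = (\<zero>\<^bsub>M\<^esub>, \<zero>\<^bsub>N\<^esub>)"
  "(a, b) \<oplus>\<^bsub>prod_mod M N\<^esub> (c, d) = (a \<oplus>\<^bsub>M\<^esub> c, b \<oplus>\<^bsub>N\<^esub> d)"
  "r \<odot>\<^bsub>prod_mod M N\<^esub> (a, b) = (r \<odot>\<^bsub>M\<^esub> a, r \<odot>\<^bsub>N\<^esub> b)"
  by (simp_all add: prod_mod_def)

lemma prod_mod_module:
  assumes "module R M" "module R N"
  shows "module R (prod_mod M N)"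
proof -
  interpret M: module R M by fact
  interpret N: module R N by fact
  have "abelian_group (prod_mod M N)"
  proof (rule abelian_groupI)
    fix x assume "x \<in> carrier (prod_mod M N)"
    then show "\<exists>y\<in>carrier (prod_mod M N). y \<oplus>\<^bsub>prod_mod M N\<^esub> x = \<zero>\<^bsub>prod_mod M N\<^esub>"
      by (intro bexI[of _ "(\<ominus>\<^bsub>M\<^esub> fst x, \<ominus>\<^bsub>N\<^esub> snd x)"]) (auto simp: M.M.l_neg N.M.l_neg)
  qed (auto simp: M.M.a_ac N.M.a_ac)
  then show ?thesis
    by (intro moduleI M.cring_axioms)
      (auto simp: M.smult_l_distr N.smult_l_distr M.smult_r_distr N.smult_r_distr M.smult_assoc1 N.smult_assoc1)
qed

text \<open>The \<open>\<epsilon>\<close>-coefficient of \<open>h (a1 + \<epsilon> b1, \<dots>, an + \<epsilon> bn)\<close> for a multiadditive \<open>h\<close>.\<close>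

fun der :: "('a, 'm) ring_scheme \<Rightarrow> ('a list \<Rightarrow> 'a) \<Rightarrow> ('a \<times> 'a) list \<Rightarrow> 'a" where
  "der M h [] = \<zero>\<^bsub>M\<^esub>"
| "der M h (x # xs) = h (snd x # map fst xs) \<oplus>\<^bsub>M\<^esub> der M (\<lambda>ys. h (fst x # ys)) xs"

text \<open>The pair \<open>(a, b)\<close> stands for a + \<epsilon> b; the underlying module is
  that of \<open>prod_mod E E\<close>.\<close>

definition dual_alg :: "('r, 'p, 'a, 'm) operad_alg_scheme \<Rightarrow> ('r, 'p, 'a \<times> 'a) operad_alg" where
  "dual_alg E = \<lparr>carrier = carrier E \<times> carrier E, mult = undefined, one = undefined,
     zero = (\<zero>\<^bsub>E\<^esub>, \<zero>\<^bsub>E\<^esub>), add = (\<lambda>(a, b) (c, d). (a \<oplus>\<^bsub>E\<^esub> c, b \<oplus>\<^bsub>E\<^esub> d)),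
     smult = (\<lambda>r (a, b). (r \<odot>\<^bsub>E\<^esub> a, r \<odot>\<^bsub>E\<^esub> b)),
     act = (\<lambda>\<mu> xs. (act E \<mu> (map fst xs), der E (act E \<mu>) xs))\<rparr>"

lemma dual_alg_simps [simp]:
  "carrier (dual_alg E) = carrier E \<times> carrier E"
  "\<zero>\<^bsub>dual_alg E\<^esub> = (\<zero>\<^bsub>E\<^esub>, \<zero>\<^bsub>E\<^esub>)"
  "x \<oplus>\<^bsub>dual_alg E\<^esub> y = (fst x \<oplus>\<^bsub>E\<^esub> fst y, snd x \<oplus>\<^bsub>E\<^esub> snd y)"
  "r \<odot>\<^bsub>dual_alg E\<^esub> x = (r \<odot>\<^bsub>E\<^esub> fst x, r \<odot>\<^bsub>E\<^esub> snd x)"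
  "act (dual_alg E) \<mu> xs = (act E \<mu> (map fst xs), der E (act E \<mu>) xs)"
  by (simp_all add: dual_alg_def case_prod_unfold)

lemma map_fst_closed: "xs \<in> lists (A \<times> B) \<Longrightarrow> map fst xs \<in> lists A"
  by (auto simp: in_lists_conv_set)

lemma finsum_lessThan_Suc_shift:
  assumes "abelian_group M" "g \<in> {..<Suc n} \<rightarrow> carrier M"
  shows "finsum M g {..<Suc n} = g 0 \<oplus>\<^bsub>M\<^esub> finsum M (\<lambda>i. g (Suc i)) {..<n}"
proof -
  interpret abelian_group M by fact
  have "finsum M g {..<Suc n} = g 0 \<oplus>\<^bsub>M\<^esub> finsum M g (Suc ` {..<n})"
    unfolding lessThan_Suc_eq_insert_0 using assms(2) by (intro finsum_insert) auto
  also have "finsum M g (Suc ` {..<n}) = finsum M (\<lambda>i. g (Suc i)) {..<n}"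
    using assms(2) by (intro finsum_reindex) auto
  finally show ?thesis .
qed

section \<open>Calculus of the \<epsilon>-coefficient\<close>

context abelian_group
begin

text \<open>\<open>der\<close> evaluates its function only at lists in the carrier of the given
  length, which is where the laws of an algebra are available.\<close>

lemma der_cong:
  assumes "xs \<in> lists (carrier G \<times> carrier G)"
    and "\<And>ys. ys \<in> lists (carrier G) \<Longrightarrow> length ys = length xs \<Longrightarrow> h ys = g ys"
  shows "der G h xs = der G g xs"
  using assms
proof (induction xs arbitrary: h g rule: list.induct)
  case (Cons x xs)
  have x: "x \<in> carrier G \<times> carrier G" and xs: "xs \<in> lists (carrier G \<times> carrier G)" using Cons.prems(1) by auto
  have "h (snd x # map fst xs) = g (snd x # map fst xs)"
    using x map_fst_closed[OF xs] by (intro Cons.prems(2)) auto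
  moreover have "der G (\<lambda>ys. h (fst x # ys)) xs = der G (\<lambda>ys. g (fst x # ys)) xs"
    using x xs by (intro Cons.IH Cons.prems(2)) auto
  ultimately show ?case by simp
qed simp

lemma der_closed:
  assumes "xs \<in> lists (carrier G \<times> carrier G)"
    and "\<And>ys. ys \<in> lists (carrier G) \<Longrightarrow> length ys = length xs \<Longrightarrow> h ys \<in> carrier G"
  shows "der G h xs \<in> carrier G"
  using assms
proof (induction xs arbitrary: h rule: list.induct)
  case (Cons x xs)
  have x: "x \<in> carrier G \<times> carrier G" and xs: "xs \<in> lists (carrier G \<times> carrier G)" using Cons.prems(1) by auto
  have "h (snd x # map fst xs) \<in> carrier G"
    using x map_fst_closed[OF xs] by (intro Cons.prems(2)) auto
  moreover have "der G (\<lambda>ys. h (fst x # ys)) xs \<in> carrier G"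
    using x xs by (intro Cons.IH Cons.prems(2)) auto
  ultimately show ?case by simp
qed simp

lemma der_add:
  assumes "xs \<in> lists (carrier G \<times> carrier G)"
    and "\<And>ys. ys \<in> lists (carrier G) \<Longrightarrow> length ys = length xs \<Longrightarrow> h ys \<in> carrier G"
    and "\<And>ys. ys \<in> lists (carrier G) \<Longrightarrow> length ys = length xs \<Longrightarrow> g ys \<in> carrier G"
  shows "der G (\<lambda>ys. h ys \<oplus> g ys) xs = der G h xs \<oplus> der G g xs"
  using assms
proof (induction xs arbitrary: h g rule: list.induct)
  case (Cons x xs)
  have x: "x \<in> carrier G \<times> carrier G" and xs: "xs \<in> lists (carrier G \<times> carrier G)" using Cons.prems(1) by auto
  have c: "h (snd x # map fst xs) \<in> carrier G" "g (snd x # map fst xs) \<in> carrier G"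
    using x map_fst_closed[OF xs] Cons.prems(2)[of "snd x # map fst xs"] Cons.prems(3)[of "snd x # map fst xs"] by auto
  have d: "der G (\<lambda>ys. h (fst x # ys)) xs \<in> carrier G"
    using x xs by (intro der_closed Cons.prems(2)) auto
  have d': "der G (\<lambda>ys. g (fst x # ys)) xs \<in> carrier G"
    using x xs by (intro der_closed Cons.prems(3)) auto
  have "der G (\<lambda>ys. h (fst x # ys) \<oplus> g (fst x # ys)) xs = der G (\<lambda>ys. h (fst x # ys)) xs \<oplus> der G (\<lambda>ys. g (fst x # ys)) xs"
    using x xs by (intro Cons.IH Cons.prems(2,3)) auto
  then show ?case using c d d' by (simp add: a_ac)
qed simp

text \<open>\<open>der\<close> is a sum of values of \<open>h\<close>, and \<open>F\<close> is
  additive. Scalar multiplication and the outer operation of a composite, seen in one argument, are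
  the intended \<open>F\<close>.\<close>

lemma der_hom:
  assumes "xs \<in> lists (carrier G \<times> carrier G)"
    and "\<And>ys. ys \<in> lists (carrier G) \<Longrightarrow> length ys = length xs \<Longrightarrow> h ys \<in> carrier G"
    and F: "\<And>x y. x \<in> carrier G \<Longrightarrow> y \<in> carrier G \<Longrightarrow> F (x \<oplus> y) = F x \<oplus> F y" "F \<zero> = \<zero>"
  shows "der G (\<lambda>ys. F (h ys)) xs = F (der G h xs)"
  using assms(1,2)
proof (induction xs arbitrary: h rule: list.induct)
  case Nil
  then show ?case by (simp add: F(2))
next
  case (Cons x xs)
  have x: "x \<in> carrier G \<times> carrier G" and xs: "xs \<in> lists (carrier G \<times> carrier G)" using Cons.prems(1) by auto
  have c: "h (snd x # map fst xs) \<in> carrier G"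
    using x map_fst_closed[OF xs] by (intro Cons.prems(2)) auto
  have d: "der G (\<lambda>ys. h (fst x # ys)) xs \<in> carrier G"
    using x xs by (intro der_closed Cons.prems(2)) auto
  have "der G (\<lambda>ys. F (h (fst x # ys))) xs = F (der G (\<lambda>ys. h (fst x # ys)) xs)"
    using x xs by (intro Cons.IH Cons.prems(2)) auto
  then show ?case using c d by (simp add: F(1))
qed

text \<open>The single \<epsilon> is taken either from an entry of \<open>xs\<close> or from one of
  \<open>ys\<close>; the entries of the other list contribute their constant terms.\<close>

lemma der_append:
  assumes "xs \<in> lists (carrier G \<times> carrier G)" "ys \<in> lists (carrier G \<times> carrier G)"
    and "\<And>zs. zs \<in> lists (carrier G) \<Longrightarrow> length zs = length xs + length ys \<Longrightarrow> h zs \<in> carrier G"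
  shows "der G h (xs @ ys) = der G (\<lambda>u. h (u @ map fst ys)) xs \<oplus> der G (\<lambda>u. h (map fst xs @ u)) ys"
  using assms(1,3)
proof (induction xs arbitrary: h rule: list.induct)
  case Nil
  have "der G h ys \<in> carrier G" using Nil assms(2) by (intro der_closed) auto
  then show ?case by simp
next
  case (Cons x xs)
  have x: "x \<in> carrier G \<times> carrier G" and xs: "xs \<in> lists (carrier G \<times> carrier G)" using Cons.prems(1) by auto
  note l = map_fst_closed[OF xs] map_fst_closed[OF assms(2)]
  have c: "h (snd x # map fst xs @ map fst ys) \<in> carrier G"
    using x l by (intro Cons.prems(2)) auto
  have d: "der G (\<lambda>u. h (fst x # u @ map fst ys)) xs \<in> carrier G" "der G (\<lambda>u. h (fst x # map fst xs @ u)) ys \<in> carrier G"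
    using x xs l assms(2) by (intro der_closed Cons.prems(2); auto)+
  have "der G (\<lambda>u. h (fst x # u)) (xs @ ys) = der G (\<lambda>u. h (fst x # u @ map fst ys)) xs \<oplus> der G (\<lambda>u. h (fst x # map fst xs @ u)) ys"
    using x xs by (intro Cons.IH Cons.prems(2)) auto
  then show ?case using c d by (simp add: a_ac)
qed

text \<open>Bridge between two forms of the Leibniz rule: the recursion suits nested composites,
  while the sum suits permutations and is the form found in the relation
  \<open>diff_act\<close>.\<close>

lemma der_eq_finsum:
  assumes "xs \<in> lists (carrier G \<times> carrier G)"
    and "\<And>ys. ys \<in> lists (carrier G) \<Longrightarrow> length ys = length xs \<Longrightarrow> h ys \<in> carrier G"
  shows "der G h xs = (\<Oplus>i\<in>{..<length xs}. h ((map fst xs)[i := snd (xs ! i)]))"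
  using assms
proof (induction xs arbitrary: h rule: list.induct)
  case (Cons x xs)
  have x: "x \<in> carrier G \<times> carrier G" and xs: "xs \<in> lists (carrier G \<times> carrier G)" using Cons.prems(1) by auto
  let ?g = "\<lambda>i. h ((map fst (x # xs))[i := snd ((x # xs) ! i)])"
  have g: "?g \<in> {..<Suc (length xs)} \<rightarrow> carrier G"
  proof
    fix i assume i: "i \<in> {..<Suc (length xs)}"
    then have "(x # xs) ! i \<in> set (x # xs)" by (intro nth_mem) simp
    then have "snd ((x # xs) ! i) \<in> carrier G" using Cons.prems(1) by (metis in_listsD mem_Times_iff)
    moreover have "map fst (x # xs) \<in> lists (carrier G)" by (rule map_fst_closed) fact
    ultimately show "?g i \<in> carrier G"
      using set_update_subset_insert[of "map fst (x # xs)" i "snd ((x # xs) ! i)"]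
      by (intro Cons.prems(2)) (auto simp: in_lists_conv_set simp del: list.map)
  qed
  have "der G (\<lambda>ys. h (fst x # ys)) xs = (\<Oplus>i\<in>{..<length xs}. h (fst x # (map fst xs)[i := snd (xs ! i)]))"
    using x xs by (intro Cons.IH Cons.prems(2)) auto
  then show ?case using finsum_lessThan_Suc_shift[OF abelian_group_axioms g] by simp
qed simp

end

text \<open>The chain rule, by induction over the blocks. It speaks of general \<open>h\<close> and
  \<open>K\<close> because in the induction step the first block is frozen and what remains is no
  longer of the form \<open>act E \<mu>\<close>.\<close>

lemma dual_comp:
  assumes E: "multilinear_act R P E"
    and "list_all2 (\<lambda>as \<nu>. \<nu> \<in> ops P (length as)) ass \<nu>s" "ass \<in> lists (lists (carrier E \<times> carrier E))"
    and "\<And>zss. list_all2 (\<lambda>as zs. length zs = length as \<and> zs \<in> lists (carrier E)) ass zss \<Longrightarrow>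
        h (concat zss) = K (map2 (act E) \<nu>s zss)"
    and "\<And>ys. ys \<in> lists (carrier E) \<Longrightarrow> length ys = length ass \<Longrightarrow> K ys \<in> carrier E"
    and "\<And>zs. zs \<in> lists (carrier E) \<Longrightarrow> length zs = length (concat ass) \<Longrightarrow> h zs \<in> carrier E"
    and "\<And>ys i. ys \<in> lists (carrier E) \<Longrightarrow> length ys = length ass \<Longrightarrow> i < length ass \<Longrightarrow>
        (\<lambda>a. K (ys[i := a])) \<in> mod_hom R E E"
  shows "der E h (concat ass) = der E K (map2 (act (dual_alg E)) \<nu>s ass)"
  using assms(2-)
proof (induction arbitrary: h K rule: list_all2_induct)
  case Nil
  then show ?case by simp
next
  case (Cons as ass \<nu> \<nu>s)
  interpret E: multilinear_act R P E by fact
  have as: "as \<in> lists (carrier E \<times> carrier E)" and ass: "ass \<in> lists (lists (carrier E \<times> carrier E))"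
    using Cons.prems(1) by auto
  have ca: "concat ass \<in> lists (carrier E \<times> carrier E)" using ass by fastforce
  let ?m = "map (map fst) ass" and ?D = "map2 (act (dual_alg E)) \<nu>s ass"
  have m: "list_all2 (\<lambda>as zs. length zs = length as \<and> zs \<in> lists (carrier E)) ass ?m"
    unfolding list_all2_map2 list_all2_same using ass map_fst_closed by fastforce
  have D: "map fst ?D = map2 (act E) \<nu>s ?m \<and> ?D \<in> lists (carrier E \<times> carrier E)"
    using Cons.hyps(2) ass
  proof (induction rule: list_all2_induct)
    case (Cons bs bss \<xi> \<xi>s)
    have bs: "bs \<in> lists (carrier E \<times> carrier E)" using Cons.prems by simp
    have "act E \<xi> (map fst bs) \<in> carrier E" using map_fst_closed[OF bs] Cons.hyps(1) by (intro E.act_closed) simp_all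
    moreover have "der E (act E \<xi>) bs \<in> carrier E"
      using Cons.hyps(1) by (intro E.M.der_closed bs E.act_closed) simp_all
    ultimately show ?case using Cons by simp
  qed simp
  have len: "length ?D = length ass" using list_all2_lengthD[OF Cons.hyps(2)] by simp
  have wl: "map fst ?D \<in> lists (carrier E)" using D map_fst_closed by blast
  have "(\<lambda>a. K ((\<zero>\<^bsub>E\<^esub> # map fst ?D)[0 := a])) \<in> mod_hom R E E"
    using wl len by (intro Cons.prems(5)) simp_all
  then have K0: "(\<lambda>a. K (a # map fst ?D)) \<in> mod_hom R E E" by simp
  have \<nu>c: "act E \<nu> u \<in> carrier E" if "u \<in> lists (carrier E)" "length u = length as" for u
    using that Cons.hyps(1) by (intro E.act_closed) simp_all
  have as1: "map fst as \<in> lists (carrier E)" by (rule map_fst_closed[OF as])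
  \<comment> \<open>The \<epsilon> comes from the first block or from a later one. For the later
    ones the first block is frozen at its constant terms and the induction hypothesis
    applies.\<close>
  have "der E h (concat (as # ass)) = der E (\<lambda>u. h (u @ map fst (concat ass))) as \<oplus>\<^bsub>E\<^esub> der E (\<lambda>u. h (map fst as @ u)) (concat ass)"
    unfolding concat.simps using as ca by (intro E.M.der_append Cons.prems(4)) simp_all
  also have "der E (\<lambda>u. h (u @ map fst (concat ass))) as = der E (\<lambda>u. K (act E \<nu> u # map fst ?D)) as"
  proof (rule E.M.der_cong[OF as])
    fix u assume u: "u \<in> lists (carrier E)" "length u = length as"
    have "h (concat (u # ?m)) = K (map2 (act E) (\<nu> # \<nu>s) (u # ?m))"
      using u m by (intro Cons.prems(2)) simp
    then show "h (u @ map fst (concat ass)) = K (act E \<nu> u # map fst ?D)" using D by (simp add: map_concat)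
  qed
  \<comment> \<open>\<open>K\<close> is additive in its first argument and so commutes with the sum
    hidden in \<open>der\<close>.\<close>
  also have "\<dots> = K (der E (act E \<nu>) as # map fst ?D)"
    using mod_homD(2)[OF K0] mod_hom_zero[OF E.module_axioms E.module_axioms K0]
    by (intro E.M.der_hom[where F = "\<lambda>a. K (a # map fst ?D)"] as \<nu>c) simp_all
  also have "der E (\<lambda>u. h (map fst as @ u)) (concat ass) = der E (\<lambda>ys. K (act E \<nu> (map fst as) # ys)) ?D"
  proof (rule Cons.IH[OF ass])
    fix zss assume z: "list_all2 (\<lambda>as zs. length zs = length as \<and> zs \<in> lists (carrier E)) ass zss"
    have "h (concat (map fst as # zss)) = K (map2 (act E) (\<nu> # \<nu>s) (map fst as # zss))"
      using as1 z by (intro Cons.prems(2)) simp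
    then show "h (map fst as @ concat zss) = K (act E \<nu> (map fst as) # map2 (act E) \<nu>s zss)" by simp
  next
    fix ys assume ys: "ys \<in> lists (carrier E)" "length ys = length ass"
    then show "K (act E \<nu> (map fst as) # ys) \<in> carrier E"
      using \<nu>c[OF as1] by (intro Cons.prems(3)) simp_all
    fix i assume "i < length ass"
    then have "(\<lambda>a. K ((act E \<nu> (map fst as) # ys)[Suc i := a])) \<in> mod_hom R E E"
      using ys \<nu>c[OF as1] by (intro Cons.prems(5)) simp_all
    then show "(\<lambda>a. K (act E \<nu> (map fst as) # ys[i := a])) \<in> mod_hom R E E" by simp
  next
    fix zs assume "zs \<in> lists (carrier E)" "length zs = length (concat ass)"
    then show "h (map fst as @ zs) \<in> carrier E" using as1 by (intro Cons.prems(4)) simp_all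
  qed
  finally show ?case by simp
qed

text \<open>First components obey the laws of \<open>E\<close>. For second components, linearity in
  the operation is additivity and homogeneity of \<open>der\<close> in its function, the composition
  law is the chain rule, and symmetry is a reindexing of the Leibniz sum.\<close>

theorem dual_operad_algebra:
  assumes E: "operad_algebra R P E"
  shows "operad_algebra R P (dual_alg E)"
proof -
  interpret M: multilinear_act R P E by (rule operad_algebra_imp_multilinear) fact
  interpret E: operad_algebra R P E by fact
  let ?D = "dual_alg E" and ?C = "carrier E \<times> carrier E"
  have ag: "abelian_group E" by (rule M.abelian_group_axioms)
  note der_closed = abelian_group.der_closed[OF ag] and der_cong = abelian_group.der_cong[OF ag]
    and der_append = abelian_group.der_append[OF ag] and der_add = abelian_group.der_add[OF ag]
    and der_hom = abelian_group.der_hom[OF ag] and der_eq_finsum = abelian_group.der_eq_finsum[OF ag]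
  have mod: "module R ?D"
    by (rule module_surj_image[OF prod_mod_module[OF M.module_axioms M.module_axioms], where f = "\<lambda>x. x"])
      (auto simp: image_def)
  have smh: "(\<lambda>x. r \<odot>\<^bsub>E\<^esub> x) \<in> mod_hom R E E" if "r \<in> carrier R" for r
    using that by (intro mod_homI) (simp_all add: M.smult_r_distr M.R.m_comm flip: M.smult_assoc1)
  have derc: "der E (act E \<mu>) xs \<in> carrier E" if "xs \<in> lists ?C" "\<mu> \<in> ops P (length xs)" for xs \<mu>
    using that(2) by (intro der_closed[OF that(1)] M.act_closed) simp_all
  \<comment> \<open>The \<epsilon> is taken before, at, or after the entry \<open>x\<close>. Each of
    the three terms is linear in one component of \<open>x\<close>, which gives linearity in that
    argument.\<close>
  have split: "der E (act E \<mu>) (ys @ x # zs) = der E (\<lambda>u. act E \<mu> (u @ fst x # map fst zs)) ys \<oplus>\<^bsub>E\<^esub>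
      (act E \<mu> (map fst ys @ snd x # map fst zs) \<oplus>\<^bsub>E\<^esub> der E (\<lambda>u. act E \<mu> (map fst ys @ fst x # u)) zs)"
    if "ys \<in> lists ?C" "zs \<in> lists ?C" "x \<in> ?C" "\<mu> \<in> ops P (length ys + Suc (length zs))" for ys zs x \<mu>
    using that by (subst der_append) (auto intro!: M.act_closed)
  have multi: "multilinear_act R P ?D"
  proof (intro multilinear_act.intro mod M.operad_axioms multilinear_act_axioms.intro)
    fix as \<mu> assume as: "as \<in> lists (carrier ?D)" "\<mu> \<in> ops P (length as)"
    then have asC: "as \<in> lists ?C" by simp
    show "act ?D \<mu> as \<in> carrier ?D"
      using derc[OF asC as(2)] M.act_closed[OF map_fst_closed[OF asC], of \<mu>] as(2) by simp
    fix i assume i: "i < length as"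
    define ys zs where "ys = take i as" and "zs = drop (Suc i) as"
    have yz: "ys \<in> lists ?C" "zs \<in> lists ?C" "\<And>x. as[i := x] = ys @ x # zs"
      "\<mu> \<in> ops P (length ys + Suc (length zs))"
    proof -
      have "length ys + Suc (length zs) = length as" using i by (simp add: ys_def zs_def)
      then show "\<mu> \<in> ops P (length ys + Suc (length zs))" using as(2) by simp
    qed (use asC i in \<open>auto simp: ys_def zs_def upd_conv_take_nth_drop dest: in_set_takeD in_set_dropD\<close>)
    note fy = map_fst_closed[OF yz(1)] and fz = map_fst_closed[OF yz(2)]
    note sp = split[OF yz(1,2) _ yz(4)]
    have c1: "act E \<mu> (u @ c # map fst zs) \<in> carrier E"
      if "u \<in> lists (carrier E)" "length u = length ys" "c \<in> carrier E" for u c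
      using that fz yz(4) by (intro M.act_closed) simp_all
    have c2: "act E \<mu> (map fst ys @ c # u) \<in> carrier E"
      if "u \<in> lists (carrier E)" "length u = length zs" "c \<in> carrier E" for u c
      using that fy yz(4) by (intro M.act_closed) simp_all
    have dcy: "der E (\<lambda>u. act E \<mu> (u @ c # map fst zs)) ys \<in> carrier E" if "c \<in> carrier E" for c
      by (intro der_closed[OF yz(1)] c1 that)
    have dcz: "der E (\<lambda>u. act E \<mu> (map fst ys @ c # u)) zs \<in> carrier E" if "c \<in> carrier E" for c
      by (intro der_closed[OF yz(2)] c2 that)
    have acc: "act E \<mu> (map fst ys @ c # map fst zs) \<in> carrier E" if "c \<in> carrier E" for c
      using fy that by (intro c1) simp_all
    have \<mu>y: "\<mu> \<in> ops P (length (map fst ys) + Suc (length (map fst zs)))" using yz(4) by simp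
    { fix a b assume ab: "a \<in> carrier ?D" "b \<in> carrier ?D"
      have abC: "a \<in> ?C" "b \<in> ?C" "a \<oplus>\<^bsub>?D\<^esub> b \<in> ?C" using ab by auto
      have f: "fst a \<in> carrier E" "fst b \<in> carrier E" "snd a \<in> carrier E" "snd b \<in> carrier E" using ab by auto
      have 1: "der E (\<lambda>u. act E \<mu> (u @ fst (a \<oplus>\<^bsub>?D\<^esub> b) # map fst zs)) ys =
          der E (\<lambda>u. act E \<mu> (u @ fst a # map fst zs)) ys \<oplus>\<^bsub>E\<^esub> der E (\<lambda>u. act E \<mu> (u @ fst b # map fst zs)) ys"
      proof (subst der_add[OF yz(1), symmetric])
        show "der E (\<lambda>u. act E \<mu> (u @ fst (a \<oplus>\<^bsub>?D\<^esub> b) # map fst zs)) ys =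
          der E (\<lambda>u. act E \<mu> (u @ fst a # map fst zs) \<oplus>\<^bsub>E\<^esub> act E \<mu> (u @ fst b # map fst zs)) ys"
          using fz f yz(4) by (intro der_cong[OF yz(1)]) (simp add: M.act_split_add)
      qed (use c1 f in blast)+
      have 2: "der E (\<lambda>u. act E \<mu> (map fst ys @ fst (a \<oplus>\<^bsub>?D\<^esub> b) # u)) zs =
          der E (\<lambda>u. act E \<mu> (map fst ys @ fst a # u)) zs \<oplus>\<^bsub>E\<^esub> der E (\<lambda>u. act E \<mu> (map fst ys @ fst b # u)) zs"
      proof (subst der_add[OF yz(2), symmetric])
        show "der E (\<lambda>u. act E \<mu> (map fst ys @ fst (a \<oplus>\<^bsub>?D\<^esub> b) # u)) zs =
          der E (\<lambda>u. act E \<mu> (map fst ys @ fst a # u) \<oplus>\<^bsub>E\<^esub> act E \<mu> (map fst ys @ fst b # u)) zs"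
          using fy f yz(4) by (intro der_cong[OF yz(2)]) (simp add: M.act_split_add)
      qed (use c2 f in blast)+
      have 3: "act E \<mu> (map fst ys @ snd (a \<oplus>\<^bsub>?D\<^esub> b) # map fst zs) =
          act E \<mu> (map fst ys @ snd a # map fst zs) \<oplus>\<^bsub>E\<^esub> act E \<mu> (map fst ys @ snd b # map fst zs)"
        using M.act_split_add[OF fy fz f(3,4) \<mu>y] by simp
      have dc: "der E (\<lambda>u. act E \<mu> (u @ fst a # map fst zs)) ys \<in> carrier E"
        "der E (\<lambda>u. act E \<mu> (u @ fst b # map fst zs)) ys \<in> carrier E"
        "der E (\<lambda>u. act E \<mu> (map fst ys @ fst a # u)) zs \<in> carrier E"
        "der E (\<lambda>u. act E \<mu> (map fst ys @ fst b # u)) zs \<in> carrier E"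
        by (rule dcy dcz f)+
      have ac: "act E \<mu> (map fst ys @ snd a # map fst zs) \<in> carrier E" "act E \<mu> (map fst ys @ snd b # map fst zs) \<in> carrier E"
        by (rule acc f)+
      have s: "der E (act E \<mu>) (ys @ (a \<oplus>\<^bsub>?D\<^esub> b) # zs) = der E (act E \<mu>) (ys @ a # zs) \<oplus>\<^bsub>E\<^esub> der E (act E \<mu>) (ys @ b # zs)"
        unfolding sp[OF abC(3)] sp[OF abC(1)] sp[OF abC(2)] 1 2 3 using dc ac by (simp add: M.M.a_ac)
      show "act ?D \<mu> (as[i := a \<oplus>\<^bsub>?D\<^esub> b]) = act ?D \<mu> (as[i := a]) \<oplus>\<^bsub>?D\<^esub> act ?D \<mu> (as[i := b])"
        unfolding yz(3) using s M.act_split_add[OF fy fz f(1,2) \<mu>y] by simp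
    }
    { fix a r assume ab: "a \<in> carrier ?D" and r: "r \<in> carrier R"
      have abC: "a \<in> ?C" "r \<odot>\<^bsub>?D\<^esub> a \<in> ?C" using ab r by auto
      have f: "fst a \<in> carrier E" "snd a \<in> carrier E" using ab by auto
      note sm = mod_homD(2)[OF smh[OF r]] mod_hom_zero[OF M.module_axioms M.module_axioms smh[OF r]]
      have 1: "der E (\<lambda>u. act E \<mu> (u @ fst (r \<odot>\<^bsub>?D\<^esub> a) # map fst zs)) ys =
          r \<odot>\<^bsub>E\<^esub> der E (\<lambda>u. act E \<mu> (u @ fst a # map fst zs)) ys"
      proof (subst der_hom[OF yz(1) _ sm, symmetric])
        show "der E (\<lambda>u. act E \<mu> (u @ fst (r \<odot>\<^bsub>?D\<^esub> a) # map fst zs)) ys =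
          der E (\<lambda>u. r \<odot>\<^bsub>E\<^esub> act E \<mu> (u @ fst a # map fst zs)) ys"
          using fz f r yz(4) by (intro der_cong[OF yz(1)]) (simp add: M.act_split_smult)
      qed (use c1 f in blast)+
      have 2: "der E (\<lambda>u. act E \<mu> (map fst ys @ fst (r \<odot>\<^bsub>?D\<^esub> a) # u)) zs =
          r \<odot>\<^bsub>E\<^esub> der E (\<lambda>u. act E \<mu> (map fst ys @ fst a # u)) zs"
      proof (subst der_hom[OF yz(2) _ sm, symmetric])
        show "der E (\<lambda>u. act E \<mu> (map fst ys @ fst (r \<odot>\<^bsub>?D\<^esub> a) # u)) zs =
          der E (\<lambda>u. r \<odot>\<^bsub>E\<^esub> act E \<mu> (map fst ys @ fst a # u)) zs"
          using fy f r yz(4) by (intro der_cong[OF yz(2)]) (simp add: M.act_split_smult)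
      qed (use c2 f in blast)+
      have 3: "act E \<mu> (map fst ys @ snd (r \<odot>\<^bsub>?D\<^esub> a) # map fst zs) =
          r \<odot>\<^bsub>E\<^esub> act E \<mu> (map fst ys @ snd a # map fst zs)"
        using M.act_split_smult[OF fy fz f(2) r \<mu>y] by simp
      have dc: "der E (\<lambda>u. act E \<mu> (u @ fst a # map fst zs)) ys \<in> carrier E"
        "der E (\<lambda>u. act E \<mu> (map fst ys @ fst a # u)) zs \<in> carrier E"
        by (rule dcy dcz f)+
      have ac: "act E \<mu> (map fst ys @ snd a # map fst zs) \<in> carrier E"
        by (rule acc f)+
      have s: "der E (act E \<mu>) (ys @ (r \<odot>\<^bsub>?D\<^esub> a) # zs) = r \<odot>\<^bsub>E\<^esub> der E (act E \<mu>) (ys @ a # zs)"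
        unfolding sp[OF abC(2)] sp[OF abC(1)] 1 2 3 using dc ac r by (simp add: M.smult_r_distr)
      show "act ?D \<mu> (as[i := r \<odot>\<^bsub>?D\<^esub> a]) = r \<odot>\<^bsub>?D\<^esub> act ?D \<mu> (as[i := a])"
        unfolding yz(3) using s M.act_split_smult[OF fy fz f(1) r \<mu>y] by simp
    }
  qed
  show ?thesis
  proof (rule multilinear_act.operad_algebraI[OF multi spans_carrier[OF mod]])
    fix xs \<mu> \<mu>' assume "xs \<in> lists (carrier ?D)" and \<mu>: "\<mu> \<in> ops P (length xs)" "\<mu>' \<in> ops P (length xs)"
    then have xs: "xs \<in> lists ?C" by simp
    have "der E (act E (\<mu> \<oplus>\<^bsub>op_mod P (length xs)\<^esub> \<mu>')) xs = der E (\<lambda>u. act E \<mu> u \<oplus>\<^bsub>E\<^esub> act E \<mu>' u) xs"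
    proof (rule der_cong[OF xs])
      fix u assume u: "u \<in> lists (carrier E)" "length u = length xs"
      show "act E (\<mu> \<oplus>\<^bsub>op_mod P (length xs)\<^esub> \<mu>') u = act E \<mu> u \<oplus>\<^bsub>E\<^esub> act E \<mu>' u"
        using E.act_add[OF u(1), of \<mu> \<mu>'] \<mu> u(2) by simp
    qed
    also have "\<dots> = der E (act E \<mu>) xs \<oplus>\<^bsub>E\<^esub> der E (act E \<mu>') xs"
      using \<mu> by (intro der_add[OF xs] M.act_closed) simp_all
    finally show "act ?D (\<mu> \<oplus>\<^bsub>op_mod P (length xs)\<^esub> \<mu>') xs = act ?D \<mu> xs \<oplus>\<^bsub>?D\<^esub> act ?D \<mu>' xs"
      using E.act_add[OF map_fst_closed[OF xs], of \<mu> \<mu>'] \<mu> by simp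
  next
    fix xs \<mu> r assume "xs \<in> lists (carrier ?D)" and \<mu>: "\<mu> \<in> ops P (length xs)" "r \<in> carrier R"
    then have xs: "xs \<in> lists ?C" by simp
    note sm = mod_homD(2)[OF smh[OF \<mu>(2)]] mod_hom_zero[OF M.module_axioms M.module_axioms smh[OF \<mu>(2)]]
    have "der E (act E (r \<odot>\<^bsub>op_mod P (length xs)\<^esub> \<mu>)) xs = der E (\<lambda>u. r \<odot>\<^bsub>E\<^esub> act E \<mu> u) xs"
    proof (rule der_cong[OF xs])
      fix u assume u: "u \<in> lists (carrier E)" "length u = length xs"
      show "act E (r \<odot>\<^bsub>op_mod P (length xs)\<^esub> \<mu>) u = r \<odot>\<^bsub>E\<^esub> act E \<mu> u"
        using E.act_smult[OF u(1), of \<mu> r] \<mu> u(2) by simp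
    qed
    also have "\<dots> = r \<odot>\<^bsub>E\<^esub> der E (act E \<mu>) xs"
      using \<mu> by (intro der_hom[OF xs _ sm] M.act_closed) simp_all
    finally show "act ?D (r \<odot>\<^bsub>op_mod P (length xs)\<^esub> \<mu>) xs = r \<odot>\<^bsub>?D\<^esub> act ?D \<mu> xs"
      using E.act_smult[OF map_fst_closed[OF xs], of \<mu> r] \<mu> by simp
  next
    fix x assume "x \<in> carrier ?D"
    then show "act ?D (op_unit P) [x] = x" by (auto simp: E.act_unit)
  next
    fix xss \<mu> \<nu>s assume "xss \<in> lists (lists (carrier ?D))" and \<mu>: "\<mu> \<in> ops P (length xss)"
      and \<nu>s: "list_all2 (\<lambda>xs \<nu>. \<nu> \<in> ops P (length xs)) xss \<nu>s"
    then have xss: "xss \<in> lists (lists ?C)" by simp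
    let ?\<mu> = "op_comp P (map length xss) \<nu>s \<mu>"
    have \<mu>c: "?\<mu> \<in> ops P (length (concat xss))"
      using M.comp_closed[of \<mu> "map length xss" \<nu>s] \<mu> \<nu>s by (simp add: list_all2_map1 length_concat)
    \<comment> \<open>The composition law of \<open>E\<close> applies to lists cut into blocks whose
      lengths are the arities of the inner operations; this is the shape condition that
      \<open>dual_comp\<close> puts on \<open>zss\<close>.\<close>
    have key: "act E ?\<mu> (concat zss) = act E \<mu> (map2 (act E) \<nu>s zss)"
      if z: "list_all2 (\<lambda>as zs. length zs = length as \<and> zs \<in> lists (carrier E)) xss zss" for zss
    proof -
      have ml: "map length zss = map length xss" and zl: "zss \<in> lists (lists (carrier E))"
        using z by (induction rule: list_all2_induct) auto
      have "list_all2 (\<lambda>k \<nu>. \<nu> \<in> ops P k) (map length xss) \<nu>s" using \<nu>s by (simp add: list_all2_map1)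
      then have "list_all2 (\<lambda>as \<nu>. \<nu> \<in> ops P (length as)) zss \<nu>s"
        unfolding ml[symmetric] by (simp add: list_all2_map1)
      from E.act_comp[OF zl _ this, of \<mu>] show ?thesis
        using \<mu> list_all2_lengthD[OF z] unfolding ml by simp
    qed
    have 1: "der E (act E ?\<mu>) (concat xss) = der E (act E \<mu>) (map2 (act ?D) \<nu>s xss)"
    proof (rule dual_comp[OF M.multilinear_act_axioms \<nu>s xss])
      fix zss assume "list_all2 (\<lambda>as zs. length zs = length as \<and> zs \<in> lists (carrier E)) xss zss"
      then show "act E ?\<mu> (concat zss) = act E \<mu> (map2 (act E) \<nu>s zss)" by (rule key)
    next
      fix zs assume "zs \<in> lists (carrier E)" "length zs = length (concat xss)"
      then show "act E ?\<mu> zs \<in> carrier E" using \<mu>c by (intro M.act_closed) simp_all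
    next
      fix ys assume ys: "ys \<in> lists (carrier E)" "length ys = length xss"
      then show "act E \<mu> ys \<in> carrier E" using \<mu> by (intro M.act_closed) simp_all
      fix i assume "i < length xss"
      then show "(\<lambda>a. act E \<mu> (ys[i := a])) \<in> mod_hom R E E"
        using ys \<mu> by (intro M.act_arg_hom) simp_all
    qed
    have "list_all2 (\<lambda>as zs. length zs = length as \<and> zs \<in> lists (carrier E)) xss (map (map fst) xss)"
      unfolding list_all2_map2 list_all2_same using xss map_fst_closed by fastforce
    moreover have "map fst (map2 (act ?D) \<nu>s xss) = map2 (act E) \<nu>s (map (map fst) xss)"
      using list_all2_lengthD[OF \<nu>s] by (induction xss \<nu>s rule: list_induct2) auto
    ultimately have 2: "act E ?\<mu> (map fst (concat xss)) = act E \<mu> (map fst (map2 (act ?D) \<nu>s xss))"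
      using key[of "map (map fst) xss"] by (simp add: map_concat)
    show "act ?D ?\<mu> (concat xss) = act ?D \<mu> (map2 (act ?D) \<nu>s xss)"
      unfolding dual_alg_simps(5)[of E ?\<mu>] dual_alg_simps(5)[of E \<mu>] 1 2 ..
  next
    fix xs \<mu> \<sigma> assume "xs \<in> lists (carrier ?D)" and \<mu>: "\<mu> \<in> ops P (length xs)" and \<sigma>: "\<sigma> permutes {..<length xs}"
    then have xs: "xs \<in> lists ?C" by simp
    have fx: "map fst xs \<in> lists (carrier E)" by (rule map_fst_closed[OF xs])
    have p: "permute_list \<sigma> xs \<in> lists ?C" using xs set_permute_list[OF \<sigma>] by (simp add: in_lists_conv_set)
    have \<mu>\<sigma>: "op_sym P (length xs) \<mu> \<sigma> \<in> ops P (length xs)" by (rule M.sym_closed[OF \<sigma> \<mu>])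
    have snd: "snd (xs ! i) \<in> carrier E" if "i < length xs" for i
      using xs that by (metis in_listsD mem_Times_iff nth_mem)
    let ?g = "\<lambda>i. act E \<mu> ((map fst xs)[i := snd (xs ! i)])"
    have u: "(map fst xs)[i := snd (xs ! i)] \<in> lists (carrier E)" if "i < length xs" for i
      using fx snd[OF that] set_update_subset_insert[of "map fst xs" i "snd (xs ! i)"] by (auto simp: in_lists_conv_set)
    have gc: "?g \<in> {..<length xs} \<rightarrow> carrier E"
      using u \<mu> by (intro Pi_I M.act_closed) simp_all
    have \<sigma>i: "\<sigma> i < length xs" if "i < length xs" for i using permutes_in_image[OF \<sigma>, of i] that by simp
    have "der E (act E (op_sym P (length xs) \<mu> \<sigma>)) (permute_list \<sigma> xs) =
        (\<Oplus>\<^bsub>E\<^esub>i\<in>{..<length (permute_list \<sigma> xs)}. act E (op_sym P (length xs) \<mu> \<sigma>)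
          ((map fst (permute_list \<sigma> xs))[i := snd (permute_list \<sigma> xs ! i)]))"
      using \<mu>\<sigma> by (intro der_eq_finsum[OF p] M.act_closed) simp_all
    \<comment> \<open>The \<open>i\<close>-th term for the permuted list is the
      \<open>\<sigma> i\<close>-th term for the original list, by the symmetry law of
      \<open>E\<close>.\<close>
    also have "\<dots> = (\<Oplus>\<^bsub>E\<^esub>i\<in>{..<length xs}. ?g (\<sigma> i))"
    proof (rule M.M.finsum_cong')
      show "(\<lambda>i. ?g (\<sigma> i)) \<in> {..<length xs} \<rightarrow> carrier E" using gc \<sigma>i by auto
      fix i assume "i \<in> {..<length xs}"
      then have i: "i < length xs" by simp
      have "(map fst (permute_list \<sigma> xs))[i := snd (permute_list \<sigma> xs ! i)] =
          permute_list \<sigma> ((map fst xs)[\<sigma> i := snd (xs ! \<sigma> i)])"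
        using list_update_permute[of \<sigma> "map fst xs" i "snd (xs ! \<sigma> i)"] \<sigma> i
        by (simp add: permute_list_map[OF \<sigma>] permute_list_nth[OF \<sigma> i])
      then show "act E (op_sym P (length xs) \<mu> \<sigma>) ((map fst (permute_list \<sigma> xs))[i := snd (permute_list \<sigma> xs ! i)]) = ?g (\<sigma> i)"
        using E.act_sym[OF u[OF \<sigma>i[OF i]], of \<mu> \<sigma>] \<mu> \<sigma> by simp
    qed simp
    also have "\<dots> = (\<Oplus>\<^bsub>E\<^esub>i\<in>\<sigma> ` {..<length xs}. ?g i)"
      using gc permutes_image[OF \<sigma>] permutes_inj_on[OF \<sigma>] by (intro M.M.finsum_reindex[symmetric]) simp_all
    also have "\<dots> = der E (act E \<mu>) xs"
      unfolding permutes_image[OF \<sigma>] using \<mu> by (intro der_eq_finsum[OF xs, symmetric] M.act_closed) simp_all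
    finally show "act ?D (op_sym P (length xs) \<mu> \<sigma>) (permute_list \<sigma> xs) = act ?D \<mu> xs"
      using E.act_sym[OF fx, of \<mu> \<sigma>] \<mu> \<sigma> by (simp add: permute_list_map[OF \<sigma>])
  qed
qed

section \<open>The tangent algebra and its universal property\<close>

locale tangent = multilinear_act R P A
  for R (structure) and P :: "('r, 'p, 'n) operad_scheme"
    and A :: "('r, 'p, 'a, 'm) operad_alg_scheme" +
  assumes alg: "operad_algebra R P A"

lemma tangentI: "operad_algebra R P A \<Longrightarrow> tangent R P A"
  by (intro tangent.intro operad_algebra_imp_multilinear tangent_axioms.intro)

context tangent
begin

abbreviation "SA \<equiv> free_alg R P (prod_mod A A)"
abbreviation "TA \<equiv> tan_alg R P A"
abbreviation "TN \<equiv> tan_null R P A"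

interpretation AA: operad_module R P "prod_mod A A"
  by (intro operad_module.intro prod_mod_module module_axioms operad_axioms)

lemma free_pair_algebra: "operad_algebra R P SA"
  by (rule AA.free_operad_algebra)

interpretation SA: multilinear_act R P SA
  by (rule AA.free_multilinear_act)

lemma pair_fgen: "pair_elem R P A a b = AA.fgen (a, b)"
  by (simp add: pair_elem_def AA.fgen_def)

lemma pair_closed: "a \<in> carrier A \<Longrightarrow> b \<in> carrier A \<Longrightarrow> pair_elem R P A a b \<in> carrier SA"
  unfolding pair_fgen by (rule AA.fgen_closed) simp

lemma pair_add:
  "a \<in> carrier A \<Longrightarrow> b \<in> carrier A \<Longrightarrow> c \<in> carrier A \<Longrightarrow> d \<in> carrier A \<Longrightarrow>
    pair_elem R P A (a \<oplus>\<^bsub>A\<^esub> c) (b \<oplus>\<^bsub>A\<^esub> d) = pair_elem R P A a b \<oplus>\<^bsub>SA\<^esub> pair_elem R P A c d"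
  using mod_homD(2)[OF AA.fgen_hom, of "(a, b)" "(c, d)"] by (simp add: pair_fgen)

lemma pair_smult:
  "a \<in> carrier A \<Longrightarrow> b \<in> carrier A \<Longrightarrow> r \<in> carrier R \<Longrightarrow>
    pair_elem R P A (r \<odot>\<^bsub>A\<^esub> a) (r \<odot>\<^bsub>A\<^esub> b) = r \<odot>\<^bsub>SA\<^esub> pair_elem R P A a b"
  using mod_homD(3)[OF AA.fgen_hom, of r "(a, b)"] by (simp add: pair_fgen)

lemma pair_split: "a \<in> carrier A \<Longrightarrow> b \<in> carrier A \<Longrightarrow>
    pair_elem R P A a b = pair_elem R P A a \<zero>\<^bsub>A\<^esub> \<oplus>\<^bsub>SA\<^esub> pair_elem R P A \<zero>\<^bsub>A\<^esub> b"
  using pair_add[of a "\<zero>\<^bsub>A\<^esub>" "\<zero>\<^bsub>A\<^esub>" b] by simp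

lemma base_list_closed: "as \<in> lists (carrier A) \<Longrightarrow> map (\<lambda>a. pair_elem R P A a \<zero>\<^bsub>A\<^esub>) as \<in> lists (carrier SA)"
  using pair_closed by auto

lemma diff_term_closed:
  assumes "as \<in> lists (carrier A)" "\<mu> \<in> ops P (length as)" "i < length as"
  shows "(map (\<lambda>a. pair_elem R P A a \<zero>\<^bsub>A\<^esub>) as)[i := pair_elem R P A \<zero>\<^bsub>A\<^esub> (as ! i)] \<in> lists (carrier SA)"
    and "act SA \<mu> ((map (\<lambda>a. pair_elem R P A a \<zero>\<^bsub>A\<^esub>) as)[i := pair_elem R P A \<zero>\<^bsub>A\<^esub> (as ! i)]) \<in> carrier SA"
proof -
  have "as ! i \<in> carrier A" using assms by (metis in_listsD nth_mem)
  then show *: "(map (\<lambda>a. pair_elem R P A a \<zero>\<^bsub>A\<^esub>) as)[i := pair_elem R P A \<zero>\<^bsub>A\<^esub> (as ! i)] \<in> lists (carrier SA)"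
    by (intro update_lists_closed base_list_closed pair_closed assms M.zero_closed)
  show "act SA \<mu> ((map (\<lambda>a. pair_elem R P A a \<zero>\<^bsub>A\<^esub>) as)[i := pair_elem R P A \<zero>\<^bsub>A\<^esub> (as ! i)]) \<in> carrier SA"
    using assms(2) by (intro SA.act_closed *) simp
qed

lemma tan_rels_closed:
  assumes "(x, y) \<in> tan_rels R P A"
  shows "x \<in> carrier SA \<and> y \<in> carrier SA"
  using assms
proof cases
  case (base_act as \<mu>)
  then show ?thesis
    using SA.act_closed[OF base_list_closed[OF base_act(3)], of \<mu>]
      pair_closed[OF act_closed[OF base_act(3,4)] M.zero_closed] by simp
next
  case (diff_act as \<mu>)
  have "y \<in> carrier SA"
    unfolding diff_act(2) by (rule SA.M.finsum_closed) (use diff_term_closed(2)[OF diff_act(3,4)] in simp)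
  then show ?thesis
    using diff_act(1) pair_closed[OF M.zero_closed act_closed[OF diff_act(3,4)]] by simp
qed

lemma tan_null_ideal: "alg_ideal R P SA TN"
  unfolding tan_null_def by (rule SA.gen_ideal_ideal) (rule tan_rels_closed)

lemma tan_operad_algebra: "operad_algebra R P TA"
  unfolding tan_alg_def by (rule quot_operad_algebra[OF free_pair_algebra tan_null_ideal])

interpretation TA: multilinear_act R P TA
  by (rule operad_algebra_imp_multilinear[OF tan_operad_algebra])

lemma tan_proj_hom: "(\<lambda>x. TN +>\<^bsub>SA\<^esub> x) \<in> mod_hom R SA TA"
  unfolding tan_alg_def by (rule SA.quot_proj_hom[OF alg_idealD(1)[OF tan_null_ideal]])

lemma tan_act:
  "xs \<in> lists (carrier SA) \<Longrightarrow> \<mu> \<in> ops P (length xs) \<Longrightarrow>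
    act TA \<mu> (map (\<lambda>x. TN +>\<^bsub>SA\<^esub> x) xs) = TN +>\<^bsub>SA\<^esub> act SA \<mu> xs"
  unfolding tan_alg_def by (rule SA.quot_act[OF tan_null_ideal])

lemma tan_rel_eq:
  assumes "(x, y) \<in> tan_rels R P A"
  shows "TN +>\<^bsub>SA\<^esub> x = TN +>\<^bsub>SA\<^esub> y"
proof -
  have "x \<ominus>\<^bsub>SA\<^esub> y \<in> TN" unfolding tan_null_def by (rule gen_ideal_gen[OF assms])
  then show ?thesis
    using SA.coset_eq_iff[OF alg_idealD(1)[OF tan_null_ideal]] tan_rels_closed[OF assms] by blast
qed

lemma tan_base_closed: "a \<in> carrier A \<Longrightarrow> tan_base R P A a \<in> carrier TA"
  unfolding tan_base_def by (intro mod_homD(1)[OF tan_proj_hom] pair_closed) simp_all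

lemma tan_d_closed: "a \<in> carrier A \<Longrightarrow> tan_d R P A a \<in> carrier TA"
  unfolding tan_d_def by (intro mod_homD(1)[OF tan_proj_hom] pair_closed) simp_all

lemma tan_base_hom: "tan_base R P A \<in> mod_hom R A TA"
proof (rule mod_homI)
  fix x y assume xy: "x \<in> carrier A" "y \<in> carrier A"
  show "tan_base R P A (x \<oplus>\<^bsub>A\<^esub> y) = tan_base R P A x \<oplus>\<^bsub>TA\<^esub> tan_base R P A y"
    unfolding tan_base_def using xy pair_add[of x "\<zero>\<^bsub>A\<^esub>" y "\<zero>\<^bsub>A\<^esub>"]
    by (subst mod_homD(2)[OF tan_proj_hom, symmetric]) (simp_all add: pair_closed)
next
  fix r x assume xy: "r \<in> carrier R" "x \<in> carrier A"
  show "tan_base R P A (r \<odot>\<^bsub>A\<^esub> x) = r \<odot>\<^bsub>TA\<^esub> tan_base R P A x"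
    unfolding tan_base_def using xy pair_smult[of x "\<zero>\<^bsub>A\<^esub>" r]
    by (subst mod_homD(3)[OF tan_proj_hom, symmetric]) (simp_all add: pair_closed)
qed (rule tan_base_closed)

lemma tan_d_hom: "tan_d R P A \<in> mod_hom R A TA"
proof (rule mod_homI)
  fix x y assume xy: "x \<in> carrier A" "y \<in> carrier A"
  show "tan_d R P A (x \<oplus>\<^bsub>A\<^esub> y) = tan_d R P A x \<oplus>\<^bsub>TA\<^esub> tan_d R P A y"
    unfolding tan_d_def using xy pair_add[of "\<zero>\<^bsub>A\<^esub>" x "\<zero>\<^bsub>A\<^esub>" y]
    by (subst mod_homD(2)[OF tan_proj_hom, symmetric]) (simp_all add: pair_closed)
next
  fix r x assume xy: "r \<in> carrier R" "x \<in> carrier A"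
  show "tan_d R P A (r \<odot>\<^bsub>A\<^esub> x) = r \<odot>\<^bsub>TA\<^esub> tan_d R P A x"
    unfolding tan_d_def using xy pair_smult[of "\<zero>\<^bsub>A\<^esub>" x r]
    by (subst mod_homD(3)[OF tan_proj_hom, symmetric]) (simp_all add: pair_closed)
qed (rule tan_d_closed)

lemma tan_base_act:
  assumes as: "as \<in> lists (carrier A)" "\<mu> \<in> ops P (length as)"
  shows "tan_base R P A (act A \<mu> as) = act TA \<mu> (map (tan_base R P A) as)"
  using tan_act[OF base_list_closed[OF as(1)], of \<mu>] tan_rel_eq[OF tan_rels.base_act[OF as]] as(2)
  by (simp add: tan_base_def[abs_def] comp_def)

text \<open>The Leibniz relation descends because the projection to the quotient commutes with
  finite sums and with the action.\<close>

lemma tan_d_act: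
  assumes as: "as \<in> lists (carrier A)" "\<mu> \<in> ops P (length as)"
  shows "tan_d R P A (act A \<mu> as) =
    (\<Oplus>\<^bsub>TA\<^esub>i\<in>{..<length as}. act TA \<mu> ((map (tan_base R P A) as)[i := tan_d R P A (as ! i)]))"
proof -
  let ?t = "\<lambda>i. (map (\<lambda>a. pair_elem R P A a \<zero>\<^bsub>A\<^esub>) as)[i := pair_elem R P A \<zero>\<^bsub>A\<^esub> (as ! i)]"
  have m: "map (\<lambda>x. TN +>\<^bsub>SA\<^esub> x) (?t i) = (map (tan_base R P A) as)[i := tan_d R P A (as ! i)]" for i
    by (simp add: map_update tan_base_def[abs_def] tan_d_def comp_def)
  have "tan_d R P A (act A \<mu> as) = TN +>\<^bsub>SA\<^esub> (\<Oplus>\<^bsub>SA\<^esub>i\<in>{..<length as}. act SA \<mu> (?t i))"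
    unfolding tan_d_def by (rule tan_rel_eq[OF tan_rels.diff_act[OF as]])
  also have "\<dots> = (\<Oplus>\<^bsub>TA\<^esub>i\<in>{..<length as}. TN +>\<^bsub>SA\<^esub> act SA \<mu> (?t i))"
    using diff_term_closed(2)[OF as]
    by (intro mod_hom_finsum[OF SA.module_axioms TA.module_axioms tan_proj_hom]) simp_all
  also have "\<dots> = (\<Oplus>\<^bsub>TA\<^esub>i\<in>{..<length as}. act TA \<mu> ((map (tan_base R P A) as)[i := tan_d R P A (as ! i)]))"
  proof (rule TA.M.finsum_cong')
    fix i assume "i \<in> {..<length as}"
    then have i: "i < length as" by simp
    have e: "act TA \<mu> (map (\<lambda>x. TN +>\<^bsub>SA\<^esub> x) (?t i)) = TN +>\<^bsub>SA\<^esub> act SA \<mu> (?t i)"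
      using as(2) by (intro tan_act[OF diff_term_closed(1)[OF as i]]) simp
    then show "TN +>\<^bsub>SA\<^esub> act SA \<mu> (?t i) = act TA \<mu> ((map (tan_base R P A) as)[i := tan_d R P A (as ! i)])"
      unfolding m by simp
  next
    show "(\<lambda>i. act TA \<mu> ((map (tan_base R P A) as)[i := tan_d R P A (as ! i)])) \<in> {..<length as} \<rightarrow> carrier TA"
    proof
      fix i assume "i \<in> {..<length as}"
      then have "as ! i \<in> carrier A" using as(1) by (metis in_listsD lessThan_iff nth_mem)
      moreover have "map (tan_base R P A) as \<in> lists (carrier TA)" using as(1) tan_base_closed by auto
      ultimately show "act TA \<mu> ((map (tan_base R P A) as)[i := tan_d R P A (as ! i)]) \<in> carrier TA"
        using as(2) by (intro TA.act_closed update_lists_closed tan_d_closed) simp_all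
    qed
  qed simp
  finally show ?thesis .
qed

lemma tan_p_hom: "tan_p R P A \<in> alg_hom R P A TA"
  unfolding tan_p_def by (rule alg_homI[OF tan_base_hom tan_base_act module_axioms act_closed])

text \<open>One half of the representation of derivations. The relation \<open>base_act\<close>
  handles the first component; the Leibniz rule says that the second is the \<epsilon>-coefficient
  of the action on pairs.\<close>

lemma tan_hom_dual:
  assumes E: "multilinear_act R P E" and y: "y \<in> alg_hom R P TA E"
  shows "(\<lambda>a\<in>carrier A. (y (tan_base R P A a), y (tan_d R P A a))) \<in> alg_hom R P A (dual_alg E)"
proof (rule alg_homI[OF _ _ module_axioms act_closed])
  interpret E: multilinear_act R P E by fact
  let ?k = "\<lambda>a. (y (tan_base R P A a), y (tan_d R P A a))"
  note yh = alg_hom_mod_hom[OF y] and bD = mod_homD[OF tan_base_hom] and dD = mod_homD[OF tan_d_hom]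
  note yD = mod_homD[OF yh]
  show "?k \<in> mod_hom R A (dual_alg E)"
    by (rule mod_homI) (auto simp: bD dD yD)
  fix xs \<mu> assume xs: "xs \<in> lists (carrier A)" "\<mu> \<in> ops P (length xs)"
  have bl: "map (tan_base R P A) xs \<in> lists (carrier TA)" using xs(1) bD(1) by auto
  have kl: "map ?k xs \<in> lists (carrier E \<times> carrier E)" using xs(1) bD(1) dD(1) yD(1) by auto
  have fst: "y (tan_base R P A (act A \<mu> xs)) = act E \<mu> (map fst (map ?k xs))"
    using alg_hom_act[OF y bl, of \<mu>] xs tan_base_act[OF xs] by (simp add: comp_def)
  have xi: "xs ! i \<in> carrier A" if "i < length xs" for i using xs(1) that by (metis in_listsD nth_mem)
  have tl: "(map (tan_base R P A) xs)[i := tan_d R P A (xs ! i)] \<in> lists (carrier TA)" if "i < length xs" for i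
    using xi[OF that] bl dD(1) by (intro update_lists_closed) simp_all
  have tc: "act TA \<mu> ((map (tan_base R P A) xs)[i := tan_d R P A (xs ! i)]) \<in> carrier TA" if "i < length xs" for i
    using tl[OF that] xs(2) by (intro TA.act_closed) simp_all
  have "y (tan_d R P A (act A \<mu> xs)) =
      (\<Oplus>\<^bsub>E\<^esub>i\<in>{..<length xs}. y (act TA \<mu> ((map (tan_base R P A) xs)[i := tan_d R P A (xs ! i)])))"
    unfolding tan_d_act[OF xs] using tc
    by (intro mod_hom_finsum[OF TA.module_axioms E.module_axioms yh]) simp_all
  also have "\<dots> = (\<Oplus>\<^bsub>E\<^esub>i\<in>{..<length (map ?k xs)}. act E \<mu> ((map fst (map ?k xs))[i := snd (map ?k xs ! i)]))"
  proof (rule E.M.finsum_cong')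
    fix i assume "i \<in> {..<length (map ?k xs)}"
    then have i: "i < length xs" by simp
    show "y (act TA \<mu> ((map (tan_base R P A) xs)[i := tan_d R P A (xs ! i)])) =
        act E \<mu> ((map fst (map ?k xs))[i := snd (map ?k xs ! i)])"
      using alg_hom_act[OF y tl[OF i], of \<mu>] xs(2) i by (simp add: map_update comp_def)
  next
    show "(\<lambda>i. act E \<mu> ((map fst (map ?k xs))[i := snd (map ?k xs ! i)])) \<in> {..<length (map ?k xs)} \<rightarrow> carrier E"
    proof
      fix i assume "i \<in> {..<length (map ?k xs)}"
      then have i: "i < length xs" by simp
      have "snd (map ?k xs ! i) \<in> carrier E" using i xi[OF i] dD(1) yD(1) by simp
      then show "act E \<mu> ((map fst (map ?k xs))[i := snd (map ?k xs ! i)]) \<in> carrier E"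
        using xs(2) by (intro E.act_closed update_lists_closed map_fst_closed[OF kl]) simp_all
    qed
  qed simp
  also have "\<dots> = der E (act E \<mu>) (map ?k xs)"
    using xs(2) by (intro E.M.der_eq_finsum[OF kl, symmetric] E.act_closed) simp_all
  finally show "?k (act A \<mu> xs) = act (dual_alg E) \<mu> (map ?k xs)"
    unfolding dual_alg_simps using fst by simp
qed

text \<open>The other half: \<open>k\<close> yields a morphism on the free algebra over the product,
  and the relations of the tangent algebra hold because \<open>k\<close> respects
  operations.\<close>

theorem tan_lift:
  assumes E: "operad_algebra R P E" and k: "k \<in> alg_hom R P A (dual_alg E)"
  shows "\<exists>y\<in>alg_hom R P TA E. \<forall>a\<in>carrier A. y (tan_base R P A a) = fst (k a) \<and> y (tan_d R P A a) = snd (k a)"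
proof -
  interpret E: multilinear_act R P E by (rule operad_algebra_imp_multilinear) fact
  have dm: "module R (dual_alg E)"
    using multilinear_act.axioms(1)[OF operad_algebra_imp_multilinear[OF dual_operad_algebra[OF E]]] .
  note kh = alg_hom_mod_hom[OF k]
  note kD = mod_homD[OF kh]
  have kc: "fst (k a) \<in> carrier E" "snd (k a) \<in> carrier E" if "a \<in> carrier A" for a
    using kD(1)[OF that] by auto
  have k0: "k \<zero>\<^bsub>A\<^esub> = (\<zero>\<^bsub>E\<^esub>, \<zero>\<^bsub>E\<^esub>)" using mod_hom_zero[OF module_axioms dm kh] by simp
  \<comment> \<open>The pair \<open>(a, b)\<close> becomes a + d b in the tangent algebra, which
    prescribes its image.\<close>
  let ?\<phi> = "\<lambda>(a, b). fst (k a) \<oplus>\<^bsub>E\<^esub> snd (k b)"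
  have "?\<phi> \<in> mod_hom R (prod_mod A A) E"
    by (rule mod_homI) (auto simp: kc kD(2,3) E.M.a_ac E.smult_r_distr)
  from AA.free_lift[OF E this] obtain G where G: "G \<in> alg_hom R P SA E"
    and Gv: "\<And>a b. a \<in> carrier A \<Longrightarrow> b \<in> carrier A \<Longrightarrow> G (pair_elem R P A a b) = fst (k a) \<oplus>\<^bsub>E\<^esub> snd (k b)"
    by (force simp: pair_fgen)
  note Gh = alg_hom_mod_hom[OF G]
  have Gb: "G (pair_elem R P A a \<zero>\<^bsub>A\<^esub>) = fst (k a)" and Gd: "G (pair_elem R P A \<zero>\<^bsub>A\<^esub> a) = snd (k a)" if "a \<in> carrier A" for a
    using Gv[OF that M.zero_closed] Gv[OF M.zero_closed that] kc[OF that] by (simp_all add: k0)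
  \<comment> \<open>Comparing components of \<open>k\<close> at a value of the action: the first
    gives \<open>base_act\<close>, the second gives \<open>diff_act\<close> once \<open>der\<close>
    is written as a sum.\<close>
  have rel: "G x = G y" if "(x, y) \<in> tan_rels R P A" for x y
    using that
  proof cases
    case (base_act as \<mu>)
    have mb: "map G (map (\<lambda>a. pair_elem R P A a \<zero>\<^bsub>A\<^esub>) as) = map fst (map k as)" using base_act(3) Gb by auto
    have "G x = act E \<mu> (map fst (map k as))"
      unfolding base_act(1) mb[symmetric] using base_act(4) by (intro alg_hom_act[OF G base_list_closed[OF base_act(3)]]) simp
    also have "\<dots> = fst (k (act A \<mu> as))" using alg_hom_act[OF k base_act(3,4)] by simp
    also have "\<dots> = G y" unfolding base_act(2) using Gb[OF act_closed[OF base_act(3,4)]] by simp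
    finally show ?thesis .
  next
    case (diff_act as \<mu>)
    let ?t = "\<lambda>i. (map (\<lambda>a. pair_elem R P A a \<zero>\<^bsub>A\<^esub>) as)[i := pair_elem R P A \<zero>\<^bsub>A\<^esub> (as ! i)]"
    have mb: "map G (map (\<lambda>a. pair_elem R P A a \<zero>\<^bsub>A\<^esub>) as) = map fst (map k as)" using diff_act(3) Gb by auto
    have kl: "map k as \<in> lists (carrier E \<times> carrier E)" using diff_act(3) kD(1) by (simp add: in_lists_conv_set)
    have ai: "as ! i \<in> carrier A" if "i < length as" for i using diff_act(3) that by (metis in_listsD nth_mem)
    have "G y = (\<Oplus>\<^bsub>E\<^esub>i\<in>{..<length as}. G (act SA \<mu> (?t i)))"
      unfolding diff_act(2) using diff_term_closed(2)[OF diff_act(3,4)]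
      by (intro mod_hom_finsum[OF SA.module_axioms E.module_axioms Gh]) simp_all
    also have "\<dots> = (\<Oplus>\<^bsub>E\<^esub>i\<in>{..<length (map k as)}. act E \<mu> ((map fst (map k as))[i := snd (map k as ! i)]))"
    proof (rule E.M.finsum_cong')
      fix i assume "i \<in> {..<length (map k as)}"
      then have i: "i < length as" by simp
      have "G (act SA \<mu> (?t i)) = act E \<mu> (map G (?t i))"
        using diff_act(4) by (intro alg_hom_act[OF G diff_term_closed(1)[OF diff_act(3,4) i]]) simp
      then show "G (act SA \<mu> (?t i)) = act E \<mu> ((map fst (map k as))[i := snd (map k as ! i)])"
        unfolding map_update mb using Gd[OF ai[OF i]] i by simp
    next
      show "(\<lambda>i. act E \<mu> ((map fst (map k as))[i := snd (map k as ! i)])) \<in> {..<length (map k as)} \<rightarrow> carrier E"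
      proof
        fix i assume "i \<in> {..<length (map k as)}"
        then have i: "i < length as" by simp
        have "snd (map k as ! i) \<in> carrier E" using i kc(2)[OF ai[OF i]] by simp
        then show "act E \<mu> ((map fst (map k as))[i := snd (map k as ! i)]) \<in> carrier E"
          using diff_act(4) by (intro E.act_closed update_lists_closed map_fst_closed[OF kl]) simp_all
      qed
    qed simp
    also have "\<dots> = der E (act E \<mu>) (map k as)"
      using diff_act(4) by (intro E.M.der_eq_finsum[OF kl, symmetric] E.act_closed) simp_all
    also have "\<dots> = snd (k (act A \<mu> as))" using alg_hom_act[OF k diff_act(3,4)] by simp
    also have "\<dots> = G x" unfolding diff_act(1) using Gd[OF act_closed[OF diff_act(3,4)]] by simp
    finally show ?thesis by simp
  qed
  have "TN \<subseteq> {x \<in> carrier SA. G x = \<zero>\<^bsub>E\<^esub>}"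
    unfolding tan_null_def
  proof (rule gen_ideal_least[OF SA.hom_kernel_ideal[OF E.multilinear_act_axioms G]])
    fix x y assume r: "(x, y) \<in> tan_rels R P A"
    note c = tan_rels_closed[OF r]
    then show "x \<ominus>\<^bsub>SA\<^esub> y \<in> {x \<in> carrier SA. G x = \<zero>\<^bsub>E\<^esub>}"
      using mod_hom_minus[OF SA.module_axioms E.module_axioms Gh, of x y] rel[OF r]
        E.minus_eq_zero_iff mod_homD(1)[OF Gh] by simp
  qed
  then have null: "\<And>x. x \<in> TN \<Longrightarrow> G x = \<zero>\<^bsub>E\<^esub>" by blast
  from SA.quot_lift[OF tan_null_ideal E.multilinear_act_axioms Gh alg_hom_act[OF G] null]
  obtain y where y: "y \<in> alg_hom R P TA E" "\<And>x. x \<in> carrier SA \<Longrightarrow> y (TN +>\<^bsub>SA\<^esub> x) = G x"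
    unfolding tan_alg_def by blast
  have "y (tan_base R P A a) = fst (k a) \<and> y (tan_d R P A a) = snd (k a)" if "a \<in> carrier A" for a
    unfolding tan_base_def tan_d_def using that by (simp add: y(2) pair_closed Gb Gd)
  then show ?thesis using y(1) by blast
qed

text \<open>Pulled back to the free algebra over the product, both morphisms are determined on
  pairs, and every pair projects to a sum of a base and a \<open>d\<close> generator.\<close>

lemma tan_ext:
  assumes E: "multilinear_act R P E" and y: "y \<in> alg_hom R P TA E" and z: "z \<in> alg_hom R P TA E"
    and b: "\<And>a. a \<in> carrier A \<Longrightarrow> y (tan_base R P A a) = z (tan_base R P A a)"
    and d: "\<And>a. a \<in> carrier A \<Longrightarrow> y (tan_d R P A a) = z (tan_d R P A a)"
  shows "y = z"
proof (rule alg_hom_eqI[OF y z])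
  let ?\<pi> = "restrict (\<lambda>x. TN +>\<^bsub>SA\<^esub> x) (carrier SA)"
  have \<pi>: "?\<pi> \<in> alg_hom R P SA TA"
    by (rule alg_homI[OF tan_proj_hom tan_act[symmetric] SA.module_axioms SA.act_closed])
  have "compose (carrier SA) y ?\<pi> = compose (carrier SA) z ?\<pi>"
  proof (rule AA.free_ext[OF E])
    fix v assume "v \<in> carrier (prod_mod A A)"
    then obtain a c where v: "v = (a, c)" "a \<in> carrier A" "c \<in> carrier A" by auto
    have p: "AA.fgen v \<in> carrier SA" using v by (intro AA.fgen_closed) simp
    have e: "?\<pi> (AA.fgen v) = tan_base R P A a \<oplus>\<^bsub>TA\<^esub> tan_d R P A c"
      using p v pair_split[OF v(2,3)] mod_homD(2)[OF tan_proj_hom pair_closed[OF v(2) M.zero_closed] pair_closed[OF M.zero_closed v(3)]]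
      by (simp add: pair_fgen[symmetric] tan_base_def tan_d_def)
    show "compose (carrier SA) y ?\<pi> (AA.fgen v) = compose (carrier SA) z ?\<pi> (AA.fgen v)"
      using p mod_homD(2)[OF alg_hom_mod_hom[OF y] tan_base_closed[OF v(2)] tan_d_closed[OF v(3)]]
        mod_homD(2)[OF alg_hom_mod_hom[OF z] tan_base_closed[OF v(2)] tan_d_closed[OF v(3)]] b[OF v(2)] d[OF v(3)]
      unfolding compose_apply[OF p] e by simp
  qed (rule alg_hom_compose[OF \<pi> y SA.multilinear_act_axioms] alg_hom_compose[OF \<pi> z SA.multilinear_act_axioms])+
  then have ce: "compose (carrier SA) y ?\<pi> x = compose (carrier SA) z ?\<pi> x" for x by (rule fun_cong)
  fix X assume "X \<in> carrier TA"
  then obtain x where "x \<in> carrier SA" "X = TN +>\<^bsub>SA\<^esub> x" by (auto simp: tan_alg_def)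
  then show "y X = z X" using ce[of x] by simp
qed

end

text \<open>Every term of the Leibniz sum has a zero among its arguments. With the identity as
  \<open>f\<close> this is the inclusion of constants, which represents
  \<open>tan_z\<close>.\<close>

lemma dual_zero_section:
  assumes A: "multilinear_act R P A" and E: "multilinear_act R P E" and f: "f \<in> alg_hom R P A E"
  shows "(\<lambda>a\<in>carrier A. (f a, \<zero>\<^bsub>E\<^esub>)) \<in> alg_hom R P A (dual_alg E)"
proof -
  interpret A: multilinear_act R P A by fact
  interpret E: multilinear_act R P E by fact
  note fD = mod_homD[OF alg_hom_mod_hom[OF f]]
  let ?k = "\<lambda>a. (f a, \<zero>\<^bsub>E\<^esub>)"
  show ?thesis
  proof (rule alg_homI[OF _ _ A.module_axioms A.act_closed])
    show "?k \<in> mod_hom R A (dual_alg E)" by (rule mod_homI) (auto simp: fD)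
    fix xs \<mu> assume xs: "xs \<in> lists (carrier A)" "\<mu> \<in> ops P (length xs)"
    have kl: "map ?k xs \<in> lists (carrier E \<times> carrier E)" using xs(1) fD(1) by (simp add: in_lists_conv_set)
    have fl: "map f xs \<in> lists (carrier E)" using xs(1) fD(1) by (simp add: in_lists_conv_set)
    have "der E (act E \<mu>) (map ?k xs) =
        (\<Oplus>\<^bsub>E\<^esub>i\<in>{..<length (map ?k xs)}. act E \<mu> ((map fst (map ?k xs))[i := snd (map ?k xs ! i)]))"
      using xs(2) by (intro E.M.der_eq_finsum[OF kl] E.act_closed) simp_all
    also have "\<dots> = \<zero>\<^bsub>E\<^esub>"
      using xs(2) E.act_arg_zero[OF fl, of \<mu>] by (intro E.M.add.finprod_one_eqI) (simp add: comp_def)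
    finally show "?k (act A \<mu> xs) = act (dual_alg E) \<mu> (map ?k xs)"
      using alg_hom_act[OF f xs] by (simp add: comp_def)
  qed
qed

text \<open>Dually to the vertical lift, this is the algebra morphism sending \<open>\<epsilon>\<close> to \<open>\<epsilon> \<epsilon>'\<close>.\<close>

lemma dual_vertical_lift:
  assumes E: "operad_algebra R P E"
  shows "(\<lambda>p\<in>carrier (dual_alg E). ((fst p, \<zero>\<^bsub>E\<^esub>), (\<zero>\<^bsub>E\<^esub>, snd p))) \<in>
    alg_hom R P (dual_alg E) (dual_alg (dual_alg E))"
proof -
  interpret E: multilinear_act R P E by (rule operad_algebra_imp_multilinear) fact
  let ?D = "dual_alg E" and ?C = "carrier E \<times> carrier E"
  have Dm: "multilinear_act R P ?D" by (rule operad_algebra_imp_multilinear[OF dual_operad_algebra[OF E]])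
  interpret D: multilinear_act R P ?D by fact
  let ?k = "\<lambda>p. ((fst p, \<zero>\<^bsub>E\<^esub>), (\<zero>\<^bsub>E\<^esub>, snd p))"
  have inr: "(\<lambda>y. (\<zero>\<^bsub>E\<^esub>, y)) \<in> mod_hom R E ?D" by (rule mod_homI) simp_all
  show ?thesis
  proof (rule alg_homI[OF _ _ D.module_axioms D.act_closed])
    show "?k \<in> mod_hom R ?D (dual_alg ?D)" by (rule mod_homI) auto
    fix xs \<mu> assume "xs \<in> lists (carrier ?D)" and \<mu>: "\<mu> \<in> ops P (length xs)"
    then have xs: "xs \<in> lists ?C" by simp
    have fl: "map fst xs \<in> lists (carrier E)" by (rule map_fst_closed[OF xs])
    have xi: "xs ! i \<in> ?C" if "i < length xs" for i using xs that by (metis in_listsD nth_mem)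
    have kl: "map ?k xs \<in> lists (carrier ?D \<times> carrier ?D)" using xs by (auto simp: in_lists_conv_set)
    \<comment> \<open>The constant terms as dual numbers. These are the first components of the
      outer pairs, while the second components carry the coefficients of
      \<open>\<epsilon>\<close>.\<close>
    let ?ps = "map (\<lambda>p. (fst p, \<zero>\<^bsub>E\<^esub>)) xs"
    have psl: "?ps \<in> lists ?C" using xs by (auto simp: in_lists_conv_set)
    have zs: "act ?D \<mu> ?ps = (act E \<mu> (map fst xs), \<zero>\<^bsub>E\<^esub>)"
    proof -
      have c: "map (\<lambda>a\<in>carrier E. (restrict (\<lambda>x. x) (carrier E) a, \<zero>\<^bsub>E\<^esub>)) (map fst xs) = ?ps" using xs by auto
      show ?thesis
        using alg_hom_act[OF dual_zero_section[OF E.multilinear_act_axioms E.multilinear_act_axioms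
              id_alg_hom[OF E.multilinear_act_axioms]] fl, of \<mu>] \<mu> E.act_closed[OF fl, of \<mu>]
        unfolding c by simp
    qed
    have gc: "act E \<mu> ((map fst xs)[i := snd (xs ! i)]) \<in> carrier E" if "i < length xs" for i
      using fl xi[OF that] \<mu> by (intro E.act_closed update_lists_closed) auto
    \<comment> \<open>Expanding the inner action, the term with index \<open>j\<close> has a zero
      argument at place \<open>j\<close> unless \<open>j = i\<close>, so only the original Leibniz
      term remains.\<close>
    have term_eq: "act ?D \<mu> (?ps[i := (\<zero>\<^bsub>E\<^esub>, snd (xs ! i))]) = (\<zero>\<^bsub>E\<^esub>, act E \<mu> ((map fst xs)[i := snd (xs ! i)]))"
      if i: "i < length xs" for i
    proof -
      let ?q = "?ps[i := (\<zero>\<^bsub>E\<^esub>, snd (xs ! i))]"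
      have ql: "?q \<in> lists ?C" using psl xi[OF i] by (intro update_lists_closed) auto
      have qf: "map fst ?q = (map fst xs)[i := \<zero>\<^bsub>E\<^esub>]" by (simp add: map_update comp_def)
      have "der E (act E \<mu>) ?q = (\<Oplus>\<^bsub>E\<^esub>j\<in>{..<length ?q}. act E \<mu> ((map fst ?q)[j := snd (?q ! j)]))"
        using \<mu> by (intro E.M.der_eq_finsum[OF ql] E.act_closed) simp_all
      also have "\<dots> = (\<Oplus>\<^bsub>E\<^esub>j\<in>{..<length xs}. if j = i then act E \<mu> ((map fst xs)[j := snd (xs ! j)]) else \<zero>\<^bsub>E\<^esub>)"
      proof (rule E.M.finsum_cong')
        fix j assume "j \<in> {..<length xs}"
        then have j: "j < length xs" by simp
        show "act E \<mu> ((map fst ?q)[j := snd (?q ! j)]) =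
            (if j = i then act E \<mu> ((map fst xs)[j := snd (xs ! j)]) else \<zero>\<^bsub>E\<^esub>)"
        proof (cases "j = i")
          case True
          then show ?thesis unfolding qf using i by simp
        next
          case False
          then have "snd (?q ! j) = \<zero>\<^bsub>E\<^esub>" using j by simp
          then show ?thesis
            using E.act_arg_zero[OF map_fst_closed[OF ql], of \<mu> j] j \<mu> False by simp
        qed
      qed (use gc in auto)
      also have "\<dots> = act E \<mu> ((map fst xs)[i := snd (xs ! i)])"
        using i gc by (intro E.M.add.finprod_singleton_swap) auto
      finally have "der E (act E \<mu>) ?q = act E \<mu> ((map fst xs)[i := snd (xs ! i)])" .
      moreover have "act E \<mu> (map fst ?q) = \<zero>\<^bsub>E\<^esub>"
        unfolding qf using i \<mu> by (intro E.act_arg_zero[OF fl]) simp_all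
      ultimately show ?thesis by simp
    qed
    have "der ?D (act ?D \<mu>) (map ?k xs) =
        (\<Oplus>\<^bsub>?D\<^esub>i\<in>{..<length (map ?k xs)}. act ?D \<mu> ((map fst (map ?k xs))[i := snd (map ?k xs ! i)]))"
      using \<mu> by (intro D.M.der_eq_finsum[OF kl] D.act_closed) simp_all
    also have "\<dots> = (\<Oplus>\<^bsub>?D\<^esub>i\<in>{..<length xs}. (\<zero>\<^bsub>E\<^esub>, act E \<mu> ((map fst xs)[i := snd (xs ! i)])))"
    proof (rule D.M.finsum_cong')
      fix i assume "i \<in> {..<length xs}"
      then have i: "i < length xs" by simp
      have e: "map fst (map ?k xs) = ?ps" "snd (map ?k xs ! i) = (\<zero>\<^bsub>E\<^esub>, snd (xs ! i))" using i by simp_all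
      show "act ?D \<mu> ((map fst (map ?k xs))[i := snd (map ?k xs ! i)]) = (\<zero>\<^bsub>E\<^esub>, act E \<mu> ((map fst xs)[i := snd (xs ! i)]))"
        unfolding e by (rule term_eq[OF i])
    qed (use gc in auto)
    also have "\<dots> = (\<zero>\<^bsub>E\<^esub>, \<Oplus>\<^bsub>E\<^esub>i\<in>{..<length xs}. act E \<mu> ((map fst xs)[i := snd (xs ! i)]))"
      using gc by (intro mod_hom_finsum[OF E.module_axioms D.module_axioms inr, symmetric]) auto
    also have "(\<Oplus>\<^bsub>E\<^esub>i\<in>{..<length xs}. act E \<mu> ((map fst xs)[i := snd (xs ! i)])) = der E (act E \<mu>) xs"
      using \<mu> by (intro E.M.der_eq_finsum[OF xs, symmetric] E.act_closed) simp_all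
    finally have 1: "der ?D (act ?D \<mu>) (map ?k xs) = (\<zero>\<^bsub>E\<^esub>, der E (act E \<mu>) xs)" .
    have mf: "map fst (map ?k xs) = ?ps" by simp
    show "?k (act ?D \<mu> xs) = act (dual_alg ?D) \<mu> (map ?k xs)"
      unfolding dual_alg_simps(5)[of ?D] mf zs 1 by simp
  qed
qed

section \<open>The structure maps of the tangent structure\<close>

context tangent
begin

interpretation TA: multilinear_act R P TA
  by (rule operad_algebra_imp_multilinear[OF tan_operad_algebra])

text \<open>This justifies the definite description: existence comes from the inclusion of constants
  into the dual numbers, uniqueness from \<open>tan_ext\<close>.\<close>

lemma tan_z_spec:
  "tan_z R P A \<in> alg_hom R P TA A \<and>
    (\<forall>a\<in>carrier A. tan_z R P A (tan_base R P A a) = a \<and> tan_z R P A (tan_d R P A a) = \<zero>\<^bsub>A\<^esub>)"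
proof -
  let ?Q = "\<lambda>z. z \<in> alg_hom R P TA A \<and> (\<forall>a\<in>carrier A. z (tan_base R P A a) = a \<and> z (tan_d R P A a) = \<zero>\<^bsub>A\<^esub>)"
  obtain z where Q: "?Q z"
    using tan_lift[OF alg dual_zero_section[OF multilinear_act_axioms multilinear_act_axioms
          id_alg_hom[OF multilinear_act_axioms]]] by auto
  have uniq: "y = z" if "?Q y" "?Q z" for y z
    using that by (intro tan_ext[OF multilinear_act_axioms]) auto
  have "?Q (THE z. ?Q z)" by (rule theI[of ?Q, OF Q uniq[OF _ Q]])
  then show ?thesis unfolding tan_z_def .
qed

text \<open>The universal derivation: the morphism a |-> a + \<epsilon> d a that represents the
  identity of the tangent algebra.\<close>

lemma tan_unit_hom:
  "(\<lambda>a\<in>carrier A. (tan_base R P A a, tan_d R P A a)) \<in> alg_hom R P A (dual_alg TA)"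
proof -
  have "(\<lambda>a\<in>carrier A. (restrict (\<lambda>x. x) (carrier TA) (tan_base R P A a), restrict (\<lambda>x. x) (carrier TA) (tan_d R P A a)))
      \<in> alg_hom R P A (dual_alg TA)"
    by (rule tan_hom_dual[OF TA.multilinear_act_axioms id_alg_hom[OF TA.multilinear_act_axioms]])
  also have "(\<lambda>a\<in>carrier A. (restrict (\<lambda>x. x) (carrier TA) (tan_base R P A a), restrict (\<lambda>x. x) (carrier TA) (tan_d R P A a))) =
     (\<lambda>a\<in>carrier A. (tan_base R P A a, tan_d R P A a))"
    using tan_base_closed tan_d_closed by (intro restrict_ext) simp
  finally show ?thesis .
qed

text \<open>The composite of \<open>f\<close> with the universal derivation of \<open>B\<close>
  represents the required morphism.\<close>

lemma tan_map_spec: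
  assumes B: "operad_algebra R P B" and f: "f \<in> alg_hom R P A B"
  shows "tan_map R P A B f \<in> alg_hom R P TA (tan_alg R P B) \<and>
    (\<forall>a\<in>carrier A. tan_map R P A B f (tan_base R P A a) = tan_base R P B (f a) \<and>
       tan_map R P A B f (tan_d R P A a) = tan_d R P B (f a))"
proof -
  interpret B: tangent R P B by (rule tangentI) fact
  let ?Q = "\<lambda>g. g \<in> alg_hom R P TA (tan_alg R P B) \<and>
    (\<forall>a\<in>carrier A. g (tan_base R P A a) = tan_base R P B (f a) \<and> g (tan_d R P A a) = tan_d R P B (f a))"
  obtain g where Q: "?Q g"
    using tan_lift[OF B.tan_operad_algebra alg_hom_compose[OF f B.tan_unit_hom multilinear_act_axioms]]
      alg_hom_closed[OF f] by auto
  have uniq: "y = z" if "?Q y" "?Q z" for y z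
    using that by (intro tan_ext[OF operad_algebra_imp_multilinear[OF B.tan_operad_algebra]]) auto
  have "?Q (THE g. ?Q g)" by (rule theI[of ?Q, OF Q uniq[OF _ Q]])
  then show ?thesis unfolding tan_map_def .
qed

text \<open>Representing the outer tangent functor leaves a comparison on the inner one with values
  in dual numbers. The assumption \<open>hom\<close> leaves open which subset \<open>X\<close>
  decides it: the whole carrier in general, the generators for a free algebra.\<close>

lemma tan2_ext:
  assumes E: "multilinear_act R P E" and y: "y \<in> alg_hom R P (tan_alg R P TA) E" and z: "z \<in> alg_hom R P (tan_alg R P TA) E"
    and hom: "\<And>f g. f \<in> alg_hom R P TA (dual_alg E) \<Longrightarrow> g \<in> alg_hom R P TA (dual_alg E) \<Longrightarrow>
      (\<And>x. x \<in> X \<Longrightarrow> f (tan_base R P A x) = g (tan_base R P A x)) \<Longrightarrow>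
      (\<And>x. x \<in> X \<Longrightarrow> f (tan_d R P A x) = g (tan_d R P A x)) \<Longrightarrow> f = g"
    and X: "X \<subseteq> carrier A"
    and eq: "\<And>x. x \<in> X \<Longrightarrow> y (tan_base R P TA (tan_base R P A x)) = z (tan_base R P TA (tan_base R P A x))"
      "\<And>x. x \<in> X \<Longrightarrow> y (tan_base R P TA (tan_d R P A x)) = z (tan_base R P TA (tan_d R P A x))"
      "\<And>x. x \<in> X \<Longrightarrow> y (tan_d R P TA (tan_base R P A x)) = z (tan_d R P TA (tan_base R P A x))"
      "\<And>x. x \<in> X \<Longrightarrow> y (tan_d R P TA (tan_d R P A x)) = z (tan_d R P TA (tan_d R P A x))"
  shows "y = z"
proof -
  interpret TT: tangent R P TA by (rule tangentI[OF tan_operad_algebra])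
  let ?k = "\<lambda>y. \<lambda>a\<in>carrier TA. (y (tan_base R P TA a), y (tan_d R P TA a))"
  have "?k y = ?k z"
  proof (rule hom[OF TT.tan_hom_dual[OF E y] TT.tan_hom_dual[OF E z]])
    fix x assume x: "x \<in> X"
    then have c: "tan_base R P A x \<in> carrier TA" "tan_d R P A x \<in> carrier TA"
      using X tan_base_closed tan_d_closed by auto
    show "?k y (tan_base R P A x) = ?k z (tan_base R P A x)" "?k y (tan_d R P A x) = ?k z (tan_d R P A x)"
      using c eq[OF x] by simp_all
  qed
  then have k: "?k y a = ?k z a" for a by (rule fun_cong)
  show ?thesis
  proof (rule TT.tan_ext[OF E y z])
    fix a assume "a \<in> carrier TA"
    then show "y (tan_base R P TA a) = z (tan_base R P TA a)" "y (tan_d R P TA a) = z (tan_d R P TA a)"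
      using k[of a] by simp_all
  qed
qed

lemma tan_l_spec:
  "tan_l R P A \<in> alg_hom R P (tan_alg R P TA) TA \<and>
    (\<forall>a\<in>carrier A.
      tan_l R P A (tan_base R P TA (tan_base R P A a)) = tan_base R P A a \<and>
      tan_l R P A (tan_base R P TA (tan_d R P A a)) = \<zero>\<^bsub>TA\<^esub> \<and>
      tan_l R P A (tan_d R P TA (tan_base R P A a)) = \<zero>\<^bsub>TA\<^esub> \<and>
      tan_l R P A (tan_d R P TA (tan_d R P A a)) = tan_d R P A a)"
proof -
  interpret TT: tangent R P TA by (rule tangentI[OF tan_operad_algebra])
  let ?Q = "\<lambda>l. l \<in> alg_hom R P (tan_alg R P TA) TA \<and>
    (\<forall>a\<in>carrier A.
      l (tan_base R P TA (tan_base R P A a)) = tan_base R P A a \<and>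
      l (tan_base R P TA (tan_d R P A a)) = \<zero>\<^bsub>TA\<^esub> \<and>
      l (tan_d R P TA (tan_base R P A a)) = \<zero>\<^bsub>TA\<^esub> \<and>
      l (tan_d R P TA (tan_d R P A a)) = tan_d R P A a)"
  \<comment> \<open>Applying the representation twice, the lift corresponds to a |-> a + \<epsilon>
    \<epsilon>' d a; \<open>h\<close> is the intermediate stage, with values in the dual numbers
    over the tangent algebra.\<close>
  obtain h where h: "h \<in> alg_hom R P TA (dual_alg TA)"
    "\<forall>a\<in>carrier A. h (tan_base R P A a) = (tan_base R P A a, \<zero>\<^bsub>TA\<^esub>) \<and> h (tan_d R P A a) = (\<zero>\<^bsub>TA\<^esub>, tan_d R P A a)"
    using tan_lift[OF dual_operad_algebra[OF tan_operad_algebra]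
        alg_hom_compose[OF tan_unit_hom dual_vertical_lift[OF tan_operad_algebra] multilinear_act_axioms]]
      tan_base_closed tan_d_closed by auto
  obtain l where "l \<in> alg_hom R P (tan_alg R P TA) TA"
    "\<forall>x\<in>carrier TA. l (tan_base R P TA x) = fst (h x) \<and> l (tan_d R P TA x) = snd (h x)"
    using TT.tan_lift[OF tan_operad_algebra h(1)] by blast
  then have Q: "?Q l" using h(2) tan_base_closed tan_d_closed by simp
  have uniq: "y = z" if y: "?Q y" and z: "?Q z" for y z
  proof (rule tan2_ext[OF TA.multilinear_act_axioms, of y z "carrier A"])
    fix f g assume f: "f \<in> alg_hom R P TA (dual_alg TA)" "g \<in> alg_hom R P TA (dual_alg TA)"
      "\<And>x. x \<in> carrier A \<Longrightarrow> f (tan_base R P A x) = g (tan_base R P A x)"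
      "\<And>x. x \<in> carrier A \<Longrightarrow> f (tan_d R P A x) = g (tan_d R P A x)"
    then show "f = g"
      by (rule tan_ext[OF operad_algebra_imp_multilinear[OF dual_operad_algebra[OF tan_operad_algebra]]])
  qed (use y z in auto)
  have "?Q (THE l. ?Q l)" by (rule theI[of ?Q, OF Q uniq[OF _ Q]])
  then show ?thesis unfolding tan_l_def Let_def .
qed

end

section \<open>The initial algebra\<close>

lemma initial_alg_simps [simp]:
  "carrier (initial_alg P) = ops P 0"
  "\<zero>\<^bsub>initial_alg P\<^esub> = \<zero>\<^bsub>op_mod P 0\<^esub>"
  "x \<oplus>\<^bsub>initial_alg P\<^esub> y = x \<oplus>\<^bsub>op_mod P 0\<^esub> y"
  "r \<odot>\<^bsub>initial_alg P\<^esub> x = r \<odot>\<^bsub>op_mod P 0\<^esub> x"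
  "act (initial_alg P) \<mu> \<nu>s = op_comp P (replicate (length \<nu>s) 0) \<nu>s \<mu>"
  by (simp_all add: initial_alg_def)

context operad
begin

text \<open>The right unit law in arity 0, where the list of inserted units is empty.\<close>

lemma initial_act_Nil: "\<mu> \<in> ops P 0 \<Longrightarrow> act (initial_alg P) \<mu> [] = \<mu>"
  using comp_unit_right[of \<mu> 0] by simp

text \<open>P(0) is closed under the operations because arities that are all zero add up to zero;
  its laws are the operad axioms for such composites.\<close>

lemma initial_operad_algebra: "operad_algebra R P (initial_alg P)"
proof -
  let ?I = "initial_alg P"
  have mod: "module R ?I"
    by (rule module_surj_image[OF op_module[of 0], where f = "\<lambda>x. x"]) simp_all
  have l: "list_all2 (\<lambda>k \<nu>. \<nu> \<in> ops P k) (replicate (length xs) 0) xs" if "xs \<in> lists (ops P 0)" for xs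
    using that by (auto simp: list_all2_conv_all_nth in_lists_conv_set)
  have m: "\<mu> \<in> ops P (length (replicate (length xs) (0::nat)))" if "\<mu> \<in> ops P (length xs)" for \<mu> and xs :: "'b list"
    using that by simp
  have s: "sum_list (replicate n 0) = (0::nat)" for n by (simp add: sum_list_replicate)
  show ?thesis
  proof (intro operad_algebra.intro mod operad_axioms operad_algebra_axioms.intro)
    fix as \<mu> assume as: "as \<in> lists (carrier ?I)" "\<mu> \<in> ops P (length as)"
    then have l: "list_all2 (\<lambda>k \<nu>. \<nu> \<in> ops P k) (replicate (length as) 0) as" and m: "\<mu> \<in> ops P (length (replicate (length as) (0::nat)))"
      using l m by simp_all
    show "act ?I \<mu> as \<in> carrier ?I"
      using comp_closed[OF m l] by (simp add: s)
    { fix \<mu>' assume "\<mu>' \<in> ops P (length as)"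
      then show "act ?I (\<mu> \<oplus>\<^bsub>op_mod P (length as)\<^esub> \<mu>') as = act ?I \<mu> as \<oplus>\<^bsub>?I\<^esub> act ?I \<mu>' as"
        using comp_add[OF m _ l, of \<mu>'] by (simp add: s) }
    { fix r assume "r \<in> carrier R"
      then show "act ?I (r \<odot>\<^bsub>op_mod P (length as)\<^esub> \<mu>) as = r \<odot>\<^bsub>?I\<^esub> act ?I \<mu> as"
        using comp_smult[OF m _ l, of r] by (simp add: s) }
    { fix i a b assume "i < length as" "a \<in> carrier ?I" "b \<in> carrier ?I"
      then show "act ?I \<mu> (as[i := a \<oplus>\<^bsub>?I\<^esub> b]) = act ?I \<mu> (as[i := a]) \<oplus>\<^bsub>?I\<^esub> act ?I \<mu> (as[i := b])"
        using comp_args_add[OF m l, of i a b] by (simp add: s) }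
    { fix i a r assume "i < length as" "a \<in> carrier ?I" "r \<in> carrier R"
      then show "act ?I \<mu> (as[i := r \<odot>\<^bsub>?I\<^esub> a]) = r \<odot>\<^bsub>?I\<^esub> act ?I \<mu> (as[i := a])"
        using comp_args_smult[OF m l, of i a r] by (simp add: s) }
    { fix \<sigma> assume \<sigma>: "\<sigma> permutes {..<length as}"
      have p: "permute_list \<sigma> (replicate (length as) (0::nat)) = replicate (length as) 0"
        using \<sigma> permutes_in_image[OF \<sigma>] by (intro nth_equalityI) (simp_all add: permute_list_nth)
      have "block_perm \<sigma> (replicate (length as) 0) permutes {..<0}"
        using block_perm_permutes[of \<sigma> "replicate (length as) 0"] \<sigma> by (simp add: s)
      \<comment> \<open>All blocks are empty, so the block permutation permutes the empty set and
        acts trivially.\<close>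
      then have b: "block_perm \<sigma> (replicate (length as) 0) = id" by simp
      show "act ?I (op_sym P (length as) \<mu> \<sigma>) (permute_list \<sigma> as) = act ?I \<mu> as"
        using comp_sym[OF m l, of \<sigma>] \<sigma> comp_closed[OF m l] sym_id by (simp add: p b s) }
  next
    fix a assume "a \<in> carrier ?I"
    then show "act ?I (op_unit P) [a] = a" using comp_unit_left[of a 0] by simp
  next
    fix ass \<mu> \<nu>s assume ass: "ass \<in> lists (lists (carrier ?I))" "\<mu> \<in> ops P (length ass)"
        and \<nu>s: "list_all2 (\<lambda>as \<nu>. \<nu> \<in> ops P (length as)) ass \<nu>s"
    let ?lss = "map (\<lambda>as. replicate (length as) (0::nat)) ass"
    have 1: "list_all2 (\<lambda>ls \<nu>. \<nu> \<in> ops P (length ls)) ?lss \<nu>s" using \<nu>s by (simp add: list_all2_map1)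
    have 2: "list_all2 (list_all2 (\<lambda>l \<xi>. \<xi> \<in> ops P l)) ?lss ass"
      unfolding list_all2_map1 list_all2_same using ass(1) l by fastforce
    have 3: "\<mu> \<in> ops P (length ?lss)" using ass(2) by simp
    have c: "concat ?lss = replicate (length (concat ass)) 0"
      by (induction ass) (simp_all add: replicate_add)
    have ml: "map length ?lss = map length ass" "map sum_list ?lss = replicate (length ass) 0"
      by (induction ass) (simp_all add: s)
    have z: "map (\<lambda>(ls, \<xi>s, \<nu>). op_comp P ls \<xi>s \<nu>) (zip ?lss (zip ass \<nu>s)) = map2 (act ?I) \<nu>s ass"
      using list_all2_lengthD[OF \<nu>s] by (induction ass \<nu>s rule: list_induct2) simp_all
    define D where "D = map2 (act ?I) \<nu>s ass"
    have lD: "length D = length ass" using list_all2_lengthD[OF \<nu>s] by (simp add: D_def)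
    show "act ?I (op_comp P (map length ass) \<nu>s \<mu>) (concat ass) = act ?I \<mu> (map2 (act ?I) \<nu>s ass)"
      using comp_assoc[OF 3 1 2] unfolding c ml z unfolding D_def[symmetric] by (simp add: lD)
  qed
qed

text \<open>Respect for operations is the composition law of \<open>A\<close> for inner operations
  without arguments, that is, with empty lists as blocks.\<close>

lemma initial_map_hom:
  assumes A: "operad_algebra R P A"
  shows "initial_map P A \<in> alg_hom R P (initial_alg P) A"
proof -
  interpret A: operad_algebra R P A by fact
  interpret I: multilinear_act R P "initial_alg P"
    by (rule operad_algebra_imp_multilinear[OF initial_operad_algebra])
  show ?thesis
    unfolding initial_map_def initial_alg_simps(1)[symmetric]
  proof (rule alg_homI[OF _ _ I.module_axioms I.act_closed])
    show "(\<lambda>\<mu>. act A \<mu> []) \<in> mod_hom R (initial_alg P) A"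
      using A.act_closed[of "[]"] A.act_add[of "[]"] A.act_smult[of "[]"] by (intro mod_homI) simp_all
    fix xs \<mu> assume xs: "xs \<in> lists (carrier (initial_alg P))" "\<mu> \<in> ops P (length xs)"
    have 2: "map2 (act A) xs (replicate (length xs) []) = map (\<lambda>\<mu>. act A \<mu> []) xs"
      by (induction xs) simp_all
    have "act A (op_comp P (map length zss) xs \<mu>) (concat zss) = act A \<mu> (map2 (act A) xs zss)"
      if z: "zss = replicate (length xs) []" for zss
    proof (rule A.act_comp)
      show "list_all2 (\<lambda>as \<nu>. \<nu> \<in> ops P (length as)) zss xs"
        using xs(1) z by (auto simp: list_all2_conv_all_nth in_lists_conv_set)
    qed (use xs(2) z in \<open>auto simp: in_lists_conv_set\<close>)
    from this[OF refl]
    show "act A (act (initial_alg P) \<mu> xs) [] = act A \<mu> (map (\<lambda>\<mu>. act A \<mu> []) xs)"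
      unfolding 2 by simp
  qed
qed

lemma initial_hom_unique:
  assumes v: "v \<in> alg_hom R P (initial_alg P) A" and \<mu>: "\<mu> \<in> ops P 0"
  shows "v \<mu> = act A \<mu> []"
  using alg_hom_act[OF v, of "[]" \<mu>] initial_act_Nil[OF \<mu>] \<mu> by simp

end

section \<open>Free algebras are differential objects\<close>

lemma compose_eqD: "compose A g f = h \<Longrightarrow> x \<in> A \<Longrightarrow> g (f x) = h x"
  by auto

context operad_module
begin

interpretation SS: multilinear_act R P SS by (rule free_multilinear_act)
interpretation TS: tangent R P SS by (rule tangentI[OF free_operad_algebra])
interpretation TSm: multilinear_act R P "tan_alg R P SS"
  by (rule operad_algebra_imp_multilinear[OF TS.tan_operad_algebra])
interpretation II: multilinear_act R P "initial_alg P"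
  by (rule operad_algebra_imp_multilinear[OF initial_operad_algebra])

lemma zero_mod_hom: "module R E \<Longrightarrow> (\<lambda>_. \<zero>\<^bsub>E\<^esub>) \<in> mod_hom R V E"
proof -
  assume "module R E"
  then interpret E: module R E .
  show ?thesis by (rule mod_homI) simp_all
qed

text \<open>By \<open>tan_hom_dual\<close> the question is moved to morphisms from the free algebra
  into dual numbers, where \<open>free_ext\<close> decides it.\<close>

lemma tan_free_ext:
  assumes E: "operad_algebra R P E" and y: "y \<in> alg_hom R P (tan_alg R P SS) E"
    and z: "z \<in> alg_hom R P (tan_alg R P SS) E"
    and b: "\<And>v. v \<in> carrier V \<Longrightarrow> y (tan_base R P SS (fgen v)) = z (tan_base R P SS (fgen v))"
    and d: "\<And>v. v \<in> carrier V \<Longrightarrow> y (tan_d R P SS (fgen v)) = z (tan_d R P SS (fgen v))"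
  shows "y = z"
proof -
  note E' = operad_algebra_imp_multilinear[OF E]
  let ?k = "\<lambda>y. \<lambda>a\<in>carrier SS. (y (tan_base R P SS a), y (tan_d R P SS a))"
  have "?k y = ?k z"
  proof (rule free_ext[OF operad_algebra_imp_multilinear[OF dual_operad_algebra[OF E]]
        TS.tan_hom_dual[OF E' y] TS.tan_hom_dual[OF E' z]])
    fix v assume "v \<in> carrier V"
    then show "?k y (fgen v) = ?k z (fgen v)" using b d fgen_closed by simp
  qed
  then have k: "?k y a = ?k z a" for a by (rule fun_cong)
  show ?thesis
  proof (rule TS.tan_ext[OF E' y z])
    fix a assume "a \<in> carrier SS"
    then show "y (tan_base R P SS a) = z (tan_base R P SS a)" "y (tan_d R P SS a) = z (tan_d R P SS a)"
      using k[of a] by simp_all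
  qed
qed

text \<open>The instance of \<open>tan2_ext\<close> whose test set is the image of \<open>V\<close>;
  \<open>tan_free_ext\<close>, with dual numbers as target, supplies its assumption
  \<open>hom\<close>.\<close>

lemma tan2_free_ext:
  assumes E: "operad_algebra R P E"
    and y: "y \<in> alg_hom R P (tan_alg R P (tan_alg R P SS)) E"
    and z: "z \<in> alg_hom R P (tan_alg R P (tan_alg R P SS)) E"
    and eq: "\<And>v. v \<in> carrier V \<Longrightarrow>
        y (tan_base R P (tan_alg R P SS) (tan_base R P SS (fgen v))) = z (tan_base R P (tan_alg R P SS) (tan_base R P SS (fgen v)))"
      "\<And>v. v \<in> carrier V \<Longrightarrow>
        y (tan_base R P (tan_alg R P SS) (tan_d R P SS (fgen v))) = z (tan_base R P (tan_alg R P SS) (tan_d R P SS (fgen v)))"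
      "\<And>v. v \<in> carrier V \<Longrightarrow>
        y (tan_d R P (tan_alg R P SS) (tan_base R P SS (fgen v))) = z (tan_d R P (tan_alg R P SS) (tan_base R P SS (fgen v)))"
      "\<And>v. v \<in> carrier V \<Longrightarrow>
        y (tan_d R P (tan_alg R P SS) (tan_d R P SS (fgen v))) = z (tan_d R P (tan_alg R P SS) (tan_d R P SS (fgen v)))"
  shows "y = z"
proof (rule TS.tan2_ext[OF operad_algebra_imp_multilinear[OF E] y z, of "fgen ` carrier V"])
  fix f g assume f: "f \<in> alg_hom R P (tan_alg R P SS) (dual_alg E)" "g \<in> alg_hom R P (tan_alg R P SS) (dual_alg E)"
      "\<And>x. x \<in> fgen ` carrier V \<Longrightarrow> f (tan_base R P SS x) = g (tan_base R P SS x)"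
      "\<And>x. x \<in> fgen ` carrier V \<Longrightarrow> f (tan_d R P SS x) = g (tan_d R P SS x)"
  show "f = g"
    by (rule tan_free_ext[OF dual_operad_algebra[OF E] f(1,2) f(3,4)[OF imageI]])
qed (use fgen_closed eq in auto)

lemma hom_free_elem:
  assumes f: "f \<in> alg_hom R P SS E" and vs: "vs \<in> lists (carrier V)" "\<mu> \<in> ops P (length vs)"
  shows "f (free_elem R P V \<mu> vs) = act E \<mu> (map (\<lambda>v. f (fgen v)) vs)"
proof -
  have "map fgen vs \<in> lists (carrier SS)" using vs(1) fgen_closed by auto
  then show ?thesis
    using alg_hom_act[OF f, of "map fgen vs" \<mu>] free_elem_eq_act[OF vs] vs(2) by (simp add: comp_def)
qed

lemma unit_free_elem: "v \<in> carrier V \<Longrightarrow> [v] \<in> lists (carrier V) \<and> op_unit P \<in> ops P (length [v])"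
  using unit_closed by simp

text \<open>Each equivalence makes two claims: the map has the listed values, and no other morphism
  has them. Uniqueness follows from the values at the classes (1; v).\<close>

theorem free_differential_object:
  shows "\<exists>\<zeta> L.
      (\<forall>\<zeta>'. \<zeta>' = \<zeta> \<longleftrightarrow> \<zeta>' \<in> alg_hom R P SS (initial_alg P) \<and>
        (\<forall>vs\<in>lists (carrier V). \<forall>\<mu>\<in>ops P (length vs).
          \<zeta>' (free_elem R P V \<mu> vs) = (if vs = [] then \<mu> else \<zero>\<^bsub>op_mod P 0\<^esub>))) \<and>
      (\<forall>L'. L' = L \<longleftrightarrow> L' \<in> alg_hom R P (tan_alg R P SS) SS \<and>
        (\<forall>vs\<in>lists (carrier V). \<forall>\<mu>\<in>ops P (length vs).
          L' (tan_base R P SS (free_elem R P V \<mu> vs)) =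
            (if vs = [] then free_elem R P V \<mu> vs else \<zero>\<^bsub>SS\<^esub>) \<and>
          L' (tan_d R P SS (free_elem R P V \<mu> vs)) =
            (if length vs = 1 then free_elem R P V \<mu> vs else \<zero>\<^bsub>SS\<^esub>))) \<and>
      differential_object TYPE('e) R P SS \<zeta> L"
proof -
  let ?I = "initial_alg P" and ?T = "tan_alg R P SS" and ?b = "tan_base R P SS" and ?d = "tan_d R P SS"
  let ?t = "initial_map P SS"
  have t: "?t \<in> alg_hom R P ?I SS" by (rule initial_map_hom[OF free_operad_algebra])
  have t0: "?t \<zero>\<^bsub>op_mod P 0\<^esub> = \<zero>\<^bsub>SS\<^esub>"
    using mod_hom_zero[OF II.module_axioms SS.module_axioms alg_hom_mod_hom[OF t]] by simp
  obtain \<zeta> where \<zeta>: "\<zeta> \<in> alg_hom R P SS ?I" and \<zeta>g: "\<And>v. v \<in> carrier V \<Longrightarrow> \<zeta> (fgen v) = \<zero>\<^bsub>op_mod P 0\<^esub>"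
    using free_lift[OF initial_operad_algebra zero_mod_hom[OF II.module_axioms]] by auto
  have \<zeta>0: "\<zeta> \<zero>\<^bsub>SS\<^esub> = \<zero>\<^bsub>op_mod P 0\<^esub>"
    using mod_hom_zero[OF SS.module_axioms II.module_axioms alg_hom_mod_hom[OF \<zeta>]] by simp
  \<comment> \<open>Every argument becomes zero. In arity 0 there is none and \<open>\<mu>\<close>
    itself remains; in positive arity multilinearity gives zero.\<close>
  have \<zeta>val: "\<zeta> (free_elem R P V \<mu> vs) = (if vs = [] then \<mu> else \<zero>\<^bsub>op_mod P 0\<^esub>)"
    if vs: "vs \<in> lists (carrier V)" "\<mu> \<in> ops P (length vs)" for \<mu> vs
  proof -
    have m: "map (\<lambda>v. \<zeta> (fgen v)) vs = map (\<lambda>_. \<zero>\<^bsub>?I\<^esub>) vs" using vs(1) \<zeta>g by auto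
    have e: "\<zeta> (free_elem R P V \<mu> vs) = act ?I \<mu> (map (\<lambda>_. \<zero>\<^bsub>?I\<^esub>) vs)"
      unfolding hom_free_elem[OF \<zeta> vs] m ..
    show ?thesis
    proof (cases "vs = []")
      case True
      then show ?thesis using e initial_act_Nil vs(2) by simp
    next
      case False
      have "act ?I \<mu> (map (\<lambda>_. \<zero>\<^bsub>?I\<^esub>) vs) = \<zero>\<^bsub>?I\<^esub>"
        using False vs(2) II.M.zero_closed by (intro II.act_zero_mem) (auto simp: neq_Nil_conv)
      then show ?thesis using e False by simp
    qed
  qed
  have dual: "operad_algebra R P (dual_alg SS)" by (rule dual_operad_algebra[OF free_operad_algebra])
  \<comment> \<open>The assignment v |-> \<epsilon> v. Its vanishing constant term will be the value
    of \<open>L\<close> on v, its coefficient v the value on d v.\<close>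
  have "(\<lambda>v. (\<zero>\<^bsub>SS\<^esub>, fgen v)) \<in> mod_hom R V (dual_alg SS)"
    using mod_homD[OF fgen_hom] by (intro mod_homI) simp_all
  from free_lift[OF dual this] obtain k where k: "k \<in> alg_hom R P SS (dual_alg SS)"
    and kg: "\<And>v. v \<in> carrier V \<Longrightarrow> k (fgen v) = (\<zero>\<^bsub>SS\<^esub>, fgen v)" by blast
  from TS.tan_lift[OF free_operad_algebra k] obtain L where L: "L \<in> alg_hom R P ?T SS"
    and Lk: "\<And>a. a \<in> carrier SS \<Longrightarrow> L (?b a) = fst (k a)" "\<And>a. a \<in> carrier SS \<Longrightarrow> L (?d a) = snd (k a)" by blast
  have Lg: "L (?b (fgen v)) = \<zero>\<^bsub>SS\<^esub>" "L (?d (fgen v)) = fgen v" if "v \<in> carrier V" for v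
    using Lk[OF fgen_closed[OF that]] kg[OF that] by simp_all
  have b0: "?b \<zero>\<^bsub>SS\<^esub> = \<zero>\<^bsub>?T\<^esub>" and d0: "?d \<zero>\<^bsub>SS\<^esub> = \<zero>\<^bsub>?T\<^esub>"
    by (rule mod_hom_zero[OF SS.module_axioms TSm.module_axioms TS.tan_base_hom],
        rule mod_hom_zero[OF SS.module_axioms TSm.module_axioms TS.tan_d_hom])
  have L0: "L \<zero>\<^bsub>?T\<^esub> = \<zero>\<^bsub>SS\<^esub>"
    by (rule mod_hom_zero[OF TSm.module_axioms SS.module_axioms alg_hom_mod_hom[OF L]])
  have bc: "?b (fgen v) \<in> carrier ?T" "?d (fgen v) \<in> carrier ?T" if "v \<in> carrier V" for v
    using TS.tan_base_closed TS.tan_d_closed fgen_closed[OF that] by auto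

  \<comment> \<open>Both composites send every generator v to zero.\<close>
  have "compose (carrier SS) L (tan_p R P SS) = compose (carrier SS) ?t \<zeta>"
    by (rule free_ext[OF SS.multilinear_act_axioms alg_hom_compose[OF TS.tan_p_hom L SS.multilinear_act_axioms]
          alg_hom_compose[OF \<zeta> t SS.multilinear_act_axioms]])
      (simp add: fgen_closed tan_p_def Lg \<zeta>g t0)
  from compose_eqD[OF this] have Lp: "L (?b a) = ?t (\<zeta> a)" if "a \<in> carrier SS" for a
    using that by (fastforce simp: tan_p_def)
  then have prop1: "\<forall>a\<in>carrier SS. L (tan_p R P SS a) = ?t (\<zeta> a)" by (simp add: tan_p_def)

  \<comment> \<open>On base elements \<open>L\<close> factors through \<open>\<zeta>\<close>, so its
    values follow from those of \<open>\<zeta>\<close>; a constant goes to P(0) and comes back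
    unchanged.\<close>
  have Lvalb: "L (?b (free_elem R P V \<mu> vs)) = (if vs = [] then free_elem R P V \<mu> vs else \<zero>\<^bsub>SS\<^esub>)"
    if vs: "vs \<in> lists (carrier V)" "\<mu> \<in> ops P (length vs)" for \<mu> vs
  proof -
    have c: "free_elem R P V \<mu> vs \<in> carrier SS"
      unfolding free_elem_eq_act[OF vs] using vs fgen_closed by (intro SS.act_closed) auto
    have "?t \<mu> = free_elem R P V \<mu> vs" if "vs = []"
      using that vs free_elem_eq_act[OF vs] by (simp add: initial_map_def)
    then show ?thesis unfolding Lp[OF c] \<zeta>val[OF vs] using t0 by simp
  qed
  have Lvald: "L (?d (free_elem R P V \<mu> vs)) = (if length vs = 1 then free_elem R P V \<mu> vs else \<zero>\<^bsub>SS\<^esub>)"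
    if vs: "vs \<in> lists (carrier V)" "\<mu> \<in> ops P (length vs)" for \<mu> vs
  proof -
    have gl: "map fgen vs \<in> lists (carrier SS)" using vs(1) fgen_closed by auto
    have c: "free_elem R P V \<mu> vs \<in> carrier SS"
      unfolding free_elem_eq_act[OF vs] using vs gl by (intro SS.act_closed) simp_all
    let ?ps = "map (\<lambda>v. (\<zero>\<^bsub>SS\<^esub>, fgen v)) vs"
    have pl: "?ps \<in> lists (carrier SS \<times> carrier SS)" using vs(1) fgen_closed by auto
    have m: "map (\<lambda>v. k (fgen v)) vs = ?ps" using vs(1) kg by auto
    have e: "L (?d (free_elem R P V \<mu> vs)) = der SS (act SS \<mu>) ?ps"
      unfolding Lk(2)[OF c] hom_free_elem[OF k vs] m by simp
    show ?thesis
    proof (cases "length vs = 1")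
      case True
      then obtain v where v: "vs = [v]" by (auto simp: length_Suc_conv)
      have "act SS \<mu> [fgen v] \<in> carrier SS" using SS.act_closed[OF gl, of \<mu>] vs(2) v by simp
      then show ?thesis using e free_elem_eq_act[OF vs] v by simp
    next
      case False
      have fl: "map fst ?ps \<in> lists (carrier SS)" by (rule map_fst_closed[OF pl])
      have "der SS (act SS \<mu>) ?ps = (\<Oplus>\<^bsub>SS\<^esub>i\<in>{..<length ?ps}. act SS \<mu> ((map fst ?ps)[i := snd (?ps ! i)]))"
        using vs(2) by (intro SS.M.der_eq_finsum[OF pl] SS.act_closed) simp_all
      also have "\<dots> = \<zero>\<^bsub>SS\<^esub>"
      proof (rule SS.M.add.finprod_one_eqI)
        fix i assume "i \<in> {..<length ?ps}"
        then have i: "i < length vs" by simp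
        \<comment> \<open>A second place, different from \<open>i\<close>. It exists because
          \<open>i\<close> is a place of a list whose length is not one, and there the argument is
          still zero; for the empty list the sum has no terms.\<close>
        define j where "j = (if i = 0 then 1 else 0 :: nat)"
        have j: "j < length vs" "j \<noteq> i" using i False by (auto simp: j_def)
        let ?l = "(map fst ?ps)[i := snd (?ps ! i)]"
        have "?l ! j = \<zero>\<^bsub>SS\<^esub>" using j by simp
        then have z: "\<zero>\<^bsub>SS\<^esub> \<in> set ?l" using nth_mem[of j ?l] j(1) by simp
        have "snd (?ps ! i) \<in> carrier SS" using i vs(1) fgen_closed by (simp add: in_lists_conv_set)
        then have "?l \<in> lists (carrier SS)" by (rule update_lists_closed[OF fl])
        then show "act SS \<mu> ?l = \<zero>\<^bsub>SS\<^esub>" using vs(2) by (intro SS.act_zero_mem z) simp_all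
      qed
      finally show ?thesis using e False by simp
    qed
  qed

  have \<zeta>uniq: "\<zeta>' = \<zeta>" if h: "\<zeta>' \<in> alg_hom R P SS ?I"
    and val: "\<forall>vs\<in>lists (carrier V). \<forall>\<mu>\<in>ops P (length vs).
          \<zeta>' (free_elem R P V \<mu> vs) = (if vs = [] then \<mu> else \<zero>\<^bsub>op_mod P 0\<^esub>)" for \<zeta>'
  proof (rule free_ext[OF II.multilinear_act_axioms h \<zeta>])
    fix v assume v: "v \<in> carrier V"
    then show "\<zeta>' (fgen v) = \<zeta> (fgen v)"
      using val unit_free_elem[OF v] \<zeta>g[OF v] by (simp add: fgen_def)
  qed
  have Luniq: "L' = L" if h: "L' \<in> alg_hom R P ?T SS"
    and val: "\<forall>vs\<in>lists (carrier V). \<forall>\<mu>\<in>ops P (length vs).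
          L' (?b (free_elem R P V \<mu> vs)) = (if vs = [] then free_elem R P V \<mu> vs else \<zero>\<^bsub>SS\<^esub>) \<and>
          L' (?d (free_elem R P V \<mu> vs)) = (if length vs = 1 then free_elem R P V \<mu> vs else \<zero>\<^bsub>SS\<^esub>)" for L'
  proof (rule tan_free_ext[OF free_operad_algebra h L])
    fix v assume v: "v \<in> carrier V"
    have "L' (?b (free_elem R P V (op_unit P) [v])) = \<zero>\<^bsub>SS\<^esub> \<and>
      L' (?d (free_elem R P V (op_unit P) [v])) = free_elem R P V (op_unit P) [v]"
      using bspec[OF bspec[OF val, of "[v]"], of "op_unit P"] unit_free_elem[OF v] by simp
    then show "L' (?b (fgen v)) = L (?b (fgen v))" "L' (?d (fgen v)) = L (?d (fgen v))"
      using Lg[OF v] by (simp_all add: fgen_def)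
  qed

  have z: "tan_z R P SS \<in> alg_hom R P ?T SS"
    and zv: "\<And>a. a \<in> carrier SS \<Longrightarrow> tan_z R P SS (?b a) = a" "\<And>a. a \<in> carrier SS \<Longrightarrow> tan_z R P SS (?d a) = \<zero>\<^bsub>SS\<^esub>"
    using TS.tan_z_spec by blast+
  \<comment> \<open>Both composites vanish on v and on d v: either the inner map gives zero already,
    or it gives v, which \<open>\<zeta>\<close> kills.\<close>
  have "compose (carrier ?T) \<zeta> L = compose (carrier ?T) \<zeta> (tan_z R P SS)"
    by (rule tan_free_ext[OF initial_operad_algebra alg_hom_compose[OF L \<zeta> TSm.multilinear_act_axioms]
          alg_hom_compose[OF z \<zeta> TSm.multilinear_act_axioms]])
      (simp_all add: bc Lg zv fgen_closed \<zeta>0 \<zeta>g)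
  from compose_eqD[OF this] have "\<zeta> (L x) = \<zeta> (tan_z R P SS x)" if "x \<in> carrier ?T" for x
    using that by simp
  then have prop2: "\<forall>x\<in>carrier ?T. \<zeta> (L x) = \<zeta> (tan_z R P SS x)" by blast

  let ?TT = "tan_alg R P ?T" and ?M = "tan_map R P ?T SS L" and ?l = "tan_l R P SS"
  interpret TT: tangent R P ?T by (rule tangentI[OF TS.tan_operad_algebra])
  have TTm: "multilinear_act R P ?TT" by (rule operad_algebra_imp_multilinear[OF TT.tan_operad_algebra])
  have M: "?M \<in> alg_hom R P ?TT ?T"
    and Mv: "\<And>x. x \<in> carrier ?T \<Longrightarrow> ?M (tan_base R P ?T x) = ?b (L x)"
      "\<And>x. x \<in> carrier ?T \<Longrightarrow> ?M (tan_d R P ?T x) = ?d (L x)"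
    using TT.tan_map_spec[OF free_operad_algebra L] by blast+
  have l: "?l \<in> alg_hom R P ?TT ?T"
    and lv: "\<And>a. a \<in> carrier SS \<Longrightarrow> ?l (tan_base R P ?T (?b a)) = ?b a"
      "\<And>a. a \<in> carrier SS \<Longrightarrow> ?l (tan_base R P ?T (?d a)) = \<zero>\<^bsub>?T\<^esub>"
      "\<And>a. a \<in> carrier SS \<Longrightarrow> ?l (tan_d R P ?T (?b a)) = \<zero>\<^bsub>?T\<^esub>"
      "\<And>a. a \<in> carrier SS \<Longrightarrow> ?l (tan_d R P ?T (?d a)) = ?d a"
    using TS.tan_l_spec by blast+
  \<comment> \<open>Both composites vanish on three kinds of generators and send d' d v to v. On the
    base generator over d v the routes differ: \<open>?M\<close> gives v, killed afterwards by
    \<open>L\<close>, while \<open>?l\<close> gives zero at once.\<close>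
  have "compose (carrier ?TT) L ?M = compose (carrier ?TT) L ?l"
    by (rule tan2_free_ext[OF free_operad_algebra alg_hom_compose[OF M L TTm] alg_hom_compose[OF l L TTm]])
      (simp_all add: bc TT.tan_base_closed TT.tan_d_closed Mv lv fgen_closed Lg b0 d0 L0)
  from compose_eqD[OF this] have "L (?M y) = L (?l y)" if "y \<in> carrier ?TT" for y
    using that by simp
  then have prop3: "\<forall>y\<in>carrier ?TT. L (?M y) = L (?l y)" by blast

  have push: "\<exists>!w. w \<in> alg_hom R P SS E \<and> (\<forall>x\<in>carrier ?T. w (L x) = u x) \<and> (\<forall>x\<in>carrier ?I. w (?t x) = v x)"
    if E: "operad_algebra R P E" and u: "u \<in> alg_hom R P ?T E" and v: "v \<in> alg_hom R P ?I E"
      and uv: "\<forall>x\<in>carrier SS. u (tan_p R P SS x) = v (\<zeta> x)"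
    for E :: "('r, 'p, 'e) operad_alg" and u v
  proof -
    interpret E: multilinear_act R P E by (rule operad_algebra_imp_multilinear[OF E])
    have uh: "(\<lambda>x. u (?d (fgen x))) \<in> mod_hom R V E"
      using mod_homD[OF fgen_hom] mod_homD[OF TS.tan_d_hom] mod_homD[OF alg_hom_mod_hom[OF u]]
      by (intro mod_homI) simp_all
    obtain w where w: "w \<in> alg_hom R P SS E" and wg: "\<And>x. x \<in> carrier V \<Longrightarrow> w (fgen x) = u (?d (fgen x))"
      using free_lift[OF E uh] by blast
    have w0: "w \<zero>\<^bsub>SS\<^esub> = \<zero>\<^bsub>E\<^esub>" by (rule mod_hom_zero[OF SS.module_axioms E.module_axioms alg_hom_mod_hom[OF w]])
    have v0: "v \<zero>\<^bsub>op_mod P 0\<^esub> = \<zero>\<^bsub>E\<^esub>"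
      using mod_hom_zero[OF II.module_axioms E.module_axioms alg_hom_mod_hom[OF v]] by simp
    \<comment> \<open>Automatic, since a morphism out of P(0) is determined by its action on
      operations without arguments.\<close>
    have wt: "w (?t x) = v x" if x: "x \<in> carrier ?I" for x
    proof -
      have "w (?t x) = act E x []"
        using initial_hom_unique[OF alg_hom_compose[OF t w II.multilinear_act_axioms], of x] x by simp
      then show ?thesis using initial_hom_unique[OF v, of x] x by simp
    qed
    have "compose (carrier ?T) w L = u"
    proof (rule tan_free_ext[OF E alg_hom_compose[OF L w TSm.multilinear_act_axioms] u])
      fix x assume x: "x \<in> carrier V"
      \<comment> \<open>This is where compatibility of \<open>u\<close> and \<open>v\<close> enters:
        \<open>u\<close> on base generators factors through \<open>\<zeta>\<close>, which is zero
        there.\<close>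
      have "u (?b (fgen x)) = \<zero>\<^bsub>E\<^esub>"
        using uv[rule_format, OF fgen_closed[OF x]] \<zeta>g[OF x] v0 fgen_closed[OF x] by (simp add: tan_p_def)
      then show "compose (carrier ?T) w L (?b (fgen x)) = u (?b (fgen x))"
        using bc[OF x] Lg[OF x] w0 by simp
      show "compose (carrier ?T) w L (?d (fgen x)) = u (?d (fgen x))"
        using bc[OF x] Lg[OF x] wg[OF x] by simp
    qed
    from compose_eqD[OF this] have wL: "w (L x) = u x" if "x \<in> carrier ?T" for x
      using that by simp
    show ?thesis
    proof (rule ex1I[of _ w])
      fix w' assume w': "w' \<in> alg_hom R P SS E \<and> (\<forall>x\<in>carrier ?T. w' (L x) = u x) \<and> (\<forall>x\<in>carrier ?I. w' (?t x) = v x)"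
      show "w' = w"
      proof (rule free_ext[OF E.multilinear_act_axioms])
        fix x assume x: "x \<in> carrier V"
        \<comment> \<open>Every generator v equals L(d v), so \<open>u\<close> dictates the value of
          any mediating morphism on it.\<close>
        have "w' (L (?d (fgen x))) = u (?d (fgen x))" using w' bc[OF x] by blast
        then show "w' (fgen x) = w (fgen x)" using Lg[OF x] wg[OF x] by simp
      qed (use w' w in auto)
    qed (use w wL wt in auto)
  qed
  have "is_pushout TYPE('e) R P SS ?T ?I SS (tan_p R P SS) \<zeta> L ?t"
    unfolding is_pushout_def
  proof (intro conjI allI impI TS.tan_p_hom \<zeta> L t prop1)
    fix E :: "('r, 'p, 'e) operad_alg" and u v
    assume h: "operad_algebra R P E \<and> u \<in> alg_hom R P ?T E \<and> v \<in> alg_hom R P ?I E \<and>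
      (\<forall>x\<in>carrier SS. u (tan_p R P SS x) = v (\<zeta> x))"
    show "\<exists>!w. w \<in> alg_hom R P SS E \<and> (\<forall>x\<in>carrier ?T. w (L x) = u x) \<and> (\<forall>x\<in>carrier ?I. w (?t x) = v x)"
      using h by (elim conjE) (rule push; assumption)
  qed
  then have diff: "differential_object TYPE('e) R P SS \<zeta> L"
    unfolding differential_object_def by (intro conjI free_operad_algebra \<zeta> L prop1 prop2 prop3)
  show ?thesis
  proof (rule exI[of _ \<zeta>], rule exI[of _ L], intro conjI allI diff iffI; (elim conjE)?)
    fix \<zeta>' assume "\<zeta>' = \<zeta>"
    then show "\<zeta>' \<in> alg_hom R P SS ?I" and "\<forall>vs\<in>lists (carrier V). \<forall>\<mu>\<in>ops P (length vs).
        \<zeta>' (free_elem R P V \<mu> vs) = (if vs = [] then \<mu> else \<zero>\<^bsub>op_mod P 0\<^esub>)"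
      using \<zeta> \<zeta>val by simp_all
  next
    fix L' assume "L' = L"
    then show "L' \<in> alg_hom R P ?T SS" and "\<forall>vs\<in>lists (carrier V). \<forall>\<mu>\<in>ops P (length vs).
        L' (?b (free_elem R P V \<mu> vs)) = (if vs = [] then free_elem R P V \<mu> vs else \<zero>\<^bsub>SS\<^esub>) \<and>
        L' (?d (free_elem R P V \<mu> vs)) = (if length vs = 1 then free_elem R P V \<mu> vs else \<zero>\<^bsub>SS\<^esub>)"
      using L Lvalb Lvald by simp_all
  qed (rule \<zeta>uniq Luniq; assumption)+
qed

text \<open>Mutually inverse morphisms: v |-> (v, 0), d v |-> (0, v) in one direction and (v, w) |->
  v + d w in the other. Both round trips are compared with the identity on generators.\<close>

theorem tan_free_iso: "\<exists>\<phi>. \<phi> \<in> alg_iso R P (tan_alg R P SS) (free_alg R P (prod_mod V V))"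
proof -
  interpret W: operad_module R P "prod_mod V V"
    by (intro operad_module.intro prod_mod_module module_axioms operad_axioms)
  let ?T = "tan_alg R P SS" and ?b = "tan_base R P SS" and ?d = "tan_d R P SS" and ?W = "free_alg R P (prod_mod V V)"
  interpret WW: multilinear_act R P ?W by (rule W.free_multilinear_act)
  note W = W.free_operad_algebra
  note gD = mod_homD[OF W.fgen_hom]
  have gadd: "W.fgen (a \<oplus>\<^bsub>V\<^esub> c, b \<oplus>\<^bsub>V\<^esub> d) = W.fgen (a, b) \<oplus>\<^bsub>?W\<^esub> W.fgen (c, d)"
    if "a \<in> carrier V" "b \<in> carrier V" "c \<in> carrier V" "d \<in> carrier V" for a b c d
    using gD(2)[of "(a, b)" "(c, d)"] that by simp
  have gsm: "W.fgen (r \<odot>\<^bsub>V\<^esub> a, r \<odot>\<^bsub>V\<^esub> b) = r \<odot>\<^bsub>?W\<^esub> W.fgen (a, b)"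
    if "a \<in> carrier V" "b \<in> carrier V" "r \<in> carrier R" for a b r
    using gD(3)[of r "(a, b)"] that by simp
  have gc: "W.fgen (a, b) \<in> carrier ?W" if "a \<in> carrier V" "b \<in> carrier V" for a b
    using gD(1)[of "(a, b)"] that by simp
  \<comment> \<open>The derivation v |-> (v, 0) + \<epsilon> (0, v), which represents the morphism
    out of the tangent algebra.\<close>
  have "(\<lambda>v. (W.fgen (v, \<zero>\<^bsub>V\<^esub>), W.fgen (\<zero>\<^bsub>V\<^esub>, v))) \<in> mod_hom R V (dual_alg ?W)"
  proof (rule mod_homI)
    fix x y assume "x \<in> carrier V" "y \<in> carrier V"
    then show "(W.fgen (x \<oplus>\<^bsub>V\<^esub> y, \<zero>\<^bsub>V\<^esub>), W.fgen (\<zero>\<^bsub>V\<^esub>, x \<oplus>\<^bsub>V\<^esub> y)) =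
        (W.fgen (x, \<zero>\<^bsub>V\<^esub>), W.fgen (\<zero>\<^bsub>V\<^esub>, x)) \<oplus>\<^bsub>dual_alg ?W\<^esub> (W.fgen (y, \<zero>\<^bsub>V\<^esub>), W.fgen (\<zero>\<^bsub>V\<^esub>, y))"
      using gadd[of x "\<zero>\<^bsub>V\<^esub>" y "\<zero>\<^bsub>V\<^esub>"] gadd[of "\<zero>\<^bsub>V\<^esub>" x "\<zero>\<^bsub>V\<^esub>" y] by simp
  next
    fix r x assume "r \<in> carrier R" "x \<in> carrier V"
    then show "(W.fgen (r \<odot>\<^bsub>V\<^esub> x, \<zero>\<^bsub>V\<^esub>), W.fgen (\<zero>\<^bsub>V\<^esub>, r \<odot>\<^bsub>V\<^esub> x)) =
        r \<odot>\<^bsub>dual_alg ?W\<^esub> (W.fgen (x, \<zero>\<^bsub>V\<^esub>), W.fgen (\<zero>\<^bsub>V\<^esub>, x))"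
      using gsm[of x "\<zero>\<^bsub>V\<^esub>" r] gsm[of "\<zero>\<^bsub>V\<^esub>" x r] by simp
  qed (simp add: gc)
  from free_lift[OF dual_operad_algebra[OF W] this] obtain k where k: "k \<in> alg_hom R P SS (dual_alg ?W)"
    and kg: "\<And>v. v \<in> carrier V \<Longrightarrow> k (fgen v) = (W.fgen (v, \<zero>\<^bsub>V\<^esub>), W.fgen (\<zero>\<^bsub>V\<^esub>, v))" by blast
  from TS.tan_lift[OF W k] obtain \<phi> where \<phi>: "\<phi> \<in> alg_hom R P ?T ?W"
    and "\<And>a. a \<in> carrier SS \<Longrightarrow> \<phi> (?b a) = fst (k a) \<and> \<phi> (?d a) = snd (k a)" by blast
  then have \<phi>g: "\<phi> (?b (fgen v)) = W.fgen (v, \<zero>\<^bsub>V\<^esub>)" "\<phi> (?d (fgen v)) = W.fgen (\<zero>\<^bsub>V\<^esub>, v)" if "v \<in> carrier V" for v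
    using kg[OF that] fgen_closed[OF that] by simp_all
  note bD = mod_homD[OF TS.tan_base_hom] and dD = mod_homD[OF TS.tan_d_hom] and fD = mod_homD[OF fgen_hom]
  have bc: "?b (fgen v) \<in> carrier ?T" "?d (fgen v) \<in> carrier ?T" if "v \<in> carrier V" for v
    using bD(1) dD(1) fgen_closed[OF that] by auto
  have "(\<lambda>(v, w). ?b (fgen v) \<oplus>\<^bsub>?T\<^esub> ?d (fgen w)) \<in> mod_hom R (prod_mod V V) ?T"
    by (rule mod_homI) (auto simp: bD dD fD TSm.M.a_ac TSm.smult_r_distr)
  from W.free_lift[OF TS.tan_operad_algebra this] obtain \<psi> where \<psi>: "\<psi> \<in> alg_hom R P ?W ?T"
    and "\<forall>v\<in>carrier (prod_mod V V). \<psi> (W.fgen v) = (case v of (v, w) \<Rightarrow> ?b (fgen v) \<oplus>\<^bsub>?T\<^esub> ?d (fgen w))" by blast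
  then have \<psi>g: "\<psi> (W.fgen (v, w)) = ?b (fgen v) \<oplus>\<^bsub>?T\<^esub> ?d (fgen w)" if "v \<in> carrier V" "w \<in> carrier V" for v w
    using that by auto
  have f0: "fgen \<zero>\<^bsub>V\<^esub> = \<zero>\<^bsub>SS\<^esub>" by (rule mod_hom_zero[OF module_axioms SS.module_axioms fgen_hom])
  have b0: "?b \<zero>\<^bsub>SS\<^esub> = \<zero>\<^bsub>?T\<^esub>" and d0: "?d \<zero>\<^bsub>SS\<^esub> = \<zero>\<^bsub>?T\<^esub>"
    by (rule mod_hom_zero[OF SS.module_axioms TSm.module_axioms TS.tan_base_hom],
        rule mod_hom_zero[OF SS.module_axioms TSm.module_axioms TS.tan_d_hom])
  \<comment> \<open>The round trip gives v + d 0 on v and 0 + d v on d v; the zero summands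
    disappear because \<open>fgen\<close>, \<open>tan_base\<close> and \<open>tan_d\<close> are
    linear.\<close>
  have "compose (carrier ?T) \<psi> \<phi> = restrict (\<lambda>x. x) (carrier ?T)"
    by (rule tan_free_ext[OF TS.tan_operad_algebra alg_hom_compose[OF \<phi> \<psi> TSm.multilinear_act_axioms]
          id_alg_hom[OF TSm.multilinear_act_axioms]])
      (simp_all add: bc \<phi>g \<psi>g f0 b0 d0)
  from compose_eqD[OF this] have 1: "\<psi> (\<phi> x) = x" if "x \<in> carrier ?T" for x
    using that by simp
  have "compose (carrier ?W) \<phi> \<psi> = restrict (\<lambda>x. x) (carrier ?W)"
  proof (rule W.free_ext[OF WW.multilinear_act_axioms alg_hom_compose[OF \<psi> \<phi> WW.multilinear_act_axioms]
        id_alg_hom[OF WW.multilinear_act_axioms]])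
    fix p assume "p \<in> carrier (prod_mod V V)"
    then obtain v w where p: "p = (v, w)" "v \<in> carrier V" "w \<in> carrier V" by auto
    have "\<phi> (\<psi> (W.fgen p)) = W.fgen (v, \<zero>\<^bsub>V\<^esub>) \<oplus>\<^bsub>?W\<^esub> W.fgen (\<zero>\<^bsub>V\<^esub>, w)"
      unfolding p(1) \<psi>g[OF p(2,3)] using mod_homD(2)[OF alg_hom_mod_hom[OF \<phi>]] bc p(2,3) by (simp add: \<phi>g)
    also have "\<dots> = W.fgen p" using gadd[of v "\<zero>\<^bsub>V\<^esub>" "\<zero>\<^bsub>V\<^esub>" w] p by simp
    finally show "compose (carrier ?W) \<phi> \<psi> (W.fgen p) = restrict (\<lambda>x. x) (carrier ?W) (W.fgen p)"
      using gc p by simp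
  qed
  from compose_eqD[OF this] have 2: "\<phi> (\<psi> x) = x" if "x \<in> carrier ?W" for x
    using that by simp
  have "bij_betw \<phi> (carrier ?T) (carrier ?W)"
    by (rule bij_betwI[where g = \<psi>]) (auto simp: 1 2 alg_hom_closed[OF \<phi>] alg_hom_closed[OF \<psi>])
  then show ?thesis using \<phi> by (auto simp: alg_iso_def)
qed

end

text \<open>The type \<open>'e\<close> of the test algebras is a free type variable, so the pushout
  property is available against algebras on every type.\<close>

theorem lemma4p6p7:
  fixes R :: "('r, 'k) ring_scheme"
    and P :: "('r, 'p, 'n) operad_scheme"
    and V :: "('r, 'v, 'm) module_scheme"
  assumes "operad R P" and "module R V"
  shows "let S = free_alg R P V in
    (\<exists>\<zeta> L.
      (\<forall>\<zeta>'. \<zeta>' = \<zeta> \<longleftrightarrow> \<zeta>' \<in> alg_hom R P S (initial_alg P) \<and>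
        (\<forall>vs\<in>lists (carrier V). \<forall>\<mu>\<in>ops P (length vs).
          \<zeta>' (free_elem R P V \<mu> vs) = (if vs = [] then \<mu> else \<zero>\<^bsub>op_mod P 0\<^esub>))) \<and>
      (\<forall>L'. L' = L \<longleftrightarrow> L' \<in> alg_hom R P (tan_alg R P S) S \<and>
        (\<forall>vs\<in>lists (carrier V). \<forall>\<mu>\<in>ops P (length vs).
          L' (tan_base R P S (free_elem R P V \<mu> vs)) =
            (if vs = [] then free_elem R P V \<mu> vs else \<zero>\<^bsub>S\<^esub>) \<and>
          L' (tan_d R P S (free_elem R P V \<mu> vs)) =
            (if length vs = 1 then free_elem R P V \<mu> vs else \<zero>\<^bsub>S\<^esub>))) \<and>
      differential_object TYPE('e) R P S \<zeta> L) \<and>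
    (\<exists>\<phi>. \<phi> \<in> alg_iso R P (tan_alg R P S) (free_alg R P (prod_mod V V)))"
proof -
  interpret operad_module R P V by (intro operad_module.intro assms)
  show ?thesis
    unfolding Let_def using free_differential_object tan_free_iso by (rule conjI)
qed

end
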